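(* Let $e_1,e_2,e_3$ be nonzero integers with $e_1+e_2+e_3=0$, $2\,\|\,e_1$, $2\,\|\,e_2$, $4\mid e_3$. Let $n=p_1\cdots p_k$ be an odd positive square-free integer coprime with $e_1e_2e_3$, whose prime factors are quadratic residues modulo each odd prime factor of $e_1e_2e_3$. Assume that - neither $E$ nor $E^{(n)}$ has a rational point of order $4$; - $e_3>0$ and $e_1<0$; - $\left(\frac{p^*}{q}\right)=1$ for all odd primes $p\mid n$, $q\mid e_1e_3$. If $\mathrm{Sel}_2(E/\mathbb{Q})\cong(\mathbb{Z}/2\mathbb{Z})^2$, then every class of $\mathrm{Sel}_2'(E^{(n)})$ has a unique representative $(d_1,d_2,d_3)$ with $d_i$ (possibly negative) divisors of $n$, $d_2>0$ and $d_3\equiv1\pmod 4$, and the map $(d_1,d_2,d_3)\mapsto\begin{pmatrix}\mathbf{y}\\ \mathbf{z}\end{pmatrix}$, where $\mathbf{y}=(v_{p_i}(d_2))_i^{\mathrm T}$, $\mathbf{z}=(v_{p_i}(d_3))_i^{\mathrm T}\in\mathbb{F}_2^k$, induces an isomorphism $$\mathrm{Sel}_2'(E^{(n)})\xrightarrow{\sim}\ker\begin{pmatrix}\mathbf{A}+\mathbf{D}_{-e_1}&\mathbf{D}_{-e_1e_3}\\ \mathbf{D}_{-e_1e_2}&\mathbf{A}^{\mathrm T}+\mathbf{D}_{-e_1}\end{pmatrix}.$$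
   Context: For a nonzero integer $m$, $E^{(m)}$ is $y^2=x(x-e_1m)(x+e_2m)$, $E=E^{(1)}$. For $\Lambda=(d_1,d_2,d_3)$ of nonzero square-free integers with $d_1d_2d_3$ a square, $D^{(m)}_\Lambda\subset\mathbb{P}^3$ is defined by $e_1mt^2+d_2u_2^2-d_3u_3^2=0$, $e_2mt^2+d_3u_3^2-d_1u_1^2=0$, $e_3mt^2+d_1u_1^2-d_2u_2^2=0$. $\mathrm{Sel}_2(E^{(m)}/\mathbb{Q})$ is identified with the group (componentwise multiplication) of $\Lambda\in(\mathbb{Q}^\times/\mathbb{Q}^{\times2})^3$ with $d_1d_2d_3\in\mathbb{Q}^{\times2}$ and $D^{(m)}_\Lambda(\mathbb{A}_{\mathbb{Q}})\ne\emptyset$; rational 2-torsion points correspond to $(1,1,1)$, $(-e_3m,-e_1e_3,e_1m)$, $(-e_2e_3,e_3m,-e_2m)$, $(e_2m,-e_1m,-e_1e_2)$. $\mathrm{Sel}_2'(E^{(m)})=\mathrm{Sel}_2(E^{(m)}/\mathbb{Q})/(E^{(m)}(\mathbb{Q})_{\rm tors}/2E^{(m)}(\mathbb{Q})_{\rm tors})$. $[\alpha,\beta]_v$ is the additive Hilbert symbol, $(\alpha,\beta)_v=(-1)^{[\alpha,\beta]_v}$. $\mathbf{A}=([p_j,-n]_{p_i})_{i,j}\in M_k(\mathbb{F}_2)$. For $u$ coprime to $n$, $\mathbf{D}_u=\mathrm{diag}([u/p_1],\dots,[u/p_k])$, with $[u/p]\in\mathbb{F}_2$ equal to $0$ if $u$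 is a quadratic residue mod $p$ and $1$ otherwise. For an odd integer $m$, $m^*=(-1)^{(m-1)/2}m\equiv1\pmod 4$. $2\,\|\,m$ means $2\mid m$, $4\nmid m$. *)

theory Defs
  imports "HOL-Number_Theory.Number_Theory" "HOL-Computational_Algebra.Squarefree" "HOL-Library.Z2"
begin

text \<open>Elements of Q^x/Q^x2 are represented by their unique square-free integer
  representative (sign included).  sqf x is the square-free part of a nonzero integer x.\<close>
definition sqf :: "int \<Rightarrow> int" where
  "sqf x = (THE d. squarefree d \<and> (\<exists>s. x = d * s^2))"

type_synonym triple = "int \<times> int \<times> int"

definition tsqf :: "triple \<Rightarrow> triple" where
  "tsqf a = (case a of (a1, a2, a3) \<Rightarrow> (sqf a1, sqf a2, sqf a3))"

definition tmul :: "triple \<Rightarrow> triple \<Rightarrow> triple" where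
  "tmul a b = (case a of (a1, a2, a3) \<Rightarrow> case b of (b1, b2, b3) \<Rightarrow>
      (sqf (a1 * b1), sqf (a2 * b2), sqf (a3 * b3)))"

text \<open>A system of homogeneous integral forms in nv variables has a nontrivial
  Q_p-point iff for every N it has a primitive integral solution modulo p^N
  (compactness of the primitive vectors of Z_p^nv).\<close>
definition padic_sol :: "nat \<Rightarrow> nat \<Rightarrow> ((nat \<Rightarrow> int) \<Rightarrow> int list) \<Rightarrow> bool" where
  "padic_sol p nv F = (\<forall>N::nat. \<exists>x::nat \<Rightarrow> int.
      (\<exists>i<nv. \<not> int p dvd x i) \<and> (\<forall>v\<in>set (F x). (int p ^ N) dvd v))"

definition real_sol :: "nat \<Rightarrow> ((nat \<Rightarrow> real) \<Rightarrow> real list) \<Rightarrow> bool" where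
  "real_sol nv F = (\<exists>x::nat \<Rightarrow> real. (\<exists>i<nv. x i \<noteq> 0) \<and> (\<forall>v\<in>set (F x). v = 0))"

text \<open>Variables: x 0 = t, x 1 = u1, x 2 = u2, x 3 = u3.\<close>
definition D_eqs :: "int \<Rightarrow> int \<Rightarrow> int \<Rightarrow> int \<Rightarrow> triple \<Rightarrow> (nat \<Rightarrow> 'a::comm_ring_1) \<Rightarrow> 'a list" where
  "D_eqs e1 e2 e3 m L x = (case L of (d1, d2, d3) \<Rightarrow>
     [of_int (e1 * m) * (x 0)^2 + of_int d2 * (x 2)^2 - of_int d3 * (x 3)^2,
      of_int (e2 * m) * (x 0)^2 + of_int d3 * (x 3)^2 - of_int d1 * (x 1)^2,
      of_int (e3 * m) * (x 0)^2 + of_int d1 * (x 1)^2 - of_int d2 * (x 2)^2])"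

definition D_adelic :: "int \<Rightarrow> int \<Rightarrow> int \<Rightarrow> int \<Rightarrow> triple \<Rightarrow> bool" where
  "D_adelic e1 e2 e3 m L =
     (real_sol 4 (D_eqs e1 e2 e3 m L) \<and> (\<forall>p. prime p \<longrightarrow> padic_sol p 4 (D_eqs e1 e2 e3 m L)))"

definition Sel2 :: "int \<Rightarrow> int \<Rightarrow> int \<Rightarrow> int \<Rightarrow> triple set" where
  "Sel2 e1 e2 e3 m = {(d1, d2, d3). d1 \<noteq> 0 \<and> d2 \<noteq> 0 \<and> d3 \<noteq> 0 \<and>
      squarefree d1 \<and> squarefree d2 \<and> squarefree d3 \<and>
      (\<exists>s::int. d1 * d2 * d3 = s^2) \<and> D_adelic e1 e2 e3 m (d1, d2, d3)}"

text \<open>Image of the rational 2-torsion of E^(m) in Sel_2.\<close>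
definition Tors :: "int \<Rightarrow> int \<Rightarrow> int \<Rightarrow> int \<Rightarrow> triple set" where
  "Tors e1 e2 e3 m = {(1, 1, 1), tsqf (-e3 * m, -e1 * e3, e1 * m),
      tsqf (-e2 * e3, e3 * m, -e2 * m), tsqf (e2 * m, -e1 * m, -e1 * e2)}"

definition sel_class :: "int \<Rightarrow> int \<Rightarrow> int \<Rightarrow> int \<Rightarrow> triple \<Rightarrow> triple set" where
  "sel_class e1 e2 e3 m L = tmul L ` Tors e1 e2 e3 m"

section \<open>Rational points of order 4 on E^(m): y^2 = x(x - e1 m)(x + e2 m)\<close>

text \<open>The curve is y^2 = x^3 + a x^2 + b x with a = (e2 - e1) m, b = - e1 e2 m^2.
  For an affine point P = (x,y) with y \<noteq> 0, 2P is given by the tangent formula;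
  P has order 4 iff 2P is a point of order 2, i.e. an affine point with y-coordinate 0.\<close>
definition ec_double :: "rat \<Rightarrow> rat \<Rightarrow> rat \<times> rat \<Rightarrow> rat \<times> rat" where
  "ec_double a b P = (case P of (x, y) \<Rightarrow>
     let l = (3 * x^2 + 2 * a * x + b) / (2 * y);
         x3 = l^2 - a - 2 * x
     in (x3, - (y + l * (x3 - x))))"

definition has_order4_point :: "int \<Rightarrow> int \<Rightarrow> int \<Rightarrow> bool" where
  "has_order4_point e1 e2 m = (let a = of_int ((e2 - e1) * m); b = of_int (- e1 * e2 * m^2) in
     \<exists>x y :: rat. y^2 = x^3 + a * x^2 + b * x \<and> y \<noteq> 0 \<and> snd (ec_double a b (x, y)) = 0)"

definition hilb_add :: "nat \<Rightarrow> int \<Rightarrow> int \<Rightarrow> bit" where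
  "hilb_add p a b = (if padic_sol p 3 (\<lambda>x. [a * (x 0)^2 + b * (x 1)^2 - (x 2)^2]) then 0 else 1)"

definition lsym :: "int \<Rightarrow> nat \<Rightarrow> bit" where
  "lsym u p = (if QuadRes (int p) u then 0 else 1)"

definition pstar :: "nat \<Rightarrow> int" where
  "pstar p = (-1) ^ ((p - 1) div 2) * int p"

definition matA :: "nat \<Rightarrow> (nat \<Rightarrow> nat) \<Rightarrow> nat \<Rightarrow> nat \<Rightarrow> bit" where
  "matA n p i j = hilb_add (p i) (int (p j)) (- int n)"

definition Ker :: "int \<Rightarrow> int \<Rightarrow> int \<Rightarrow> nat \<Rightarrow> nat \<Rightarrow> (nat \<Rightarrow> nat) \<Rightarrow> ((nat \<Rightarrow> bit) \<times> (nat \<Rightarrow> bit)) set" where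
  "Ker e1 e2 e3 n k p = {(y, z). (\<forall>i\<ge>k. y i = 0 \<and> z i = 0) \<and>
     (\<forall>i<k. (\<Sum>j<k. matA n p i j * y j) + lsym (- e1) (p i) * y i
              + lsym (- e1 * e3) (p i) * z i = 0 \<and>
           lsym (- e1 * e2) (p i) * y i + (\<Sum>j<k. matA n p j i * z j)
              + lsym (- e1) (p i) * z i = 0)}"

definition Phi :: "nat \<Rightarrow> (nat \<Rightarrow> nat) \<Rightarrow> triple \<Rightarrow> (nat \<Rightarrow> bit) \<times> (nat \<Rightarrow> bit)" where
  "Phi k p L = (case L of (d1, d2, d3) \<Rightarrow>
     ((\<lambda>i. if i < k then of_nat (multiplicity (int (p i)) d2) else 0),
      (\<lambda>i. if i < k then of_nat (multiplicity (int (p i)) d3) else 0)))"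

definition good_rep :: "nat \<Rightarrow> triple \<Rightarrow> bool" where
  "good_rep n L = (case L of (d1, d2, d3) \<Rightarrow>
     d1 dvd int n \<and> d2 dvd int n \<and> d3 dvd int n \<and> d2 > 0 \<and> d3 mod 4 = 1)"

end

theory Submission
  imports Defs
begin

text \<open>
  The local conditions on a triple \<open>(d1, d2, d3)\<close> are redundant: each equation of the 2-covering is a
  conic, and a conic that is isotropic at every place other than 2 is isotropic at 2 by the product
  formula for Hilbert symbols. For odd \<open>di\<close> with \<open>d3 \<equiv> 1 (mod 4)\<close> this already forces
  solubility over the 2-adic numbers.

  Translating by 2-torsion makes any Selmer triple of the twist odd, in exactly one way, since the four
  torsion classes are told apart by the parities of \<open>d2\<close> and \<open>d3\<close>. Split off the part of \<open>di\<close>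
  dividing \<open>n\<close>, with signs such that the factor of \<open>d2\<close> is positive and that of \<open>d3\<close> is 1 modulo 4.
  By the residue conditions on the primes of \<open>n\<close> the remaining triple satisfies the conditions of the
  untwisted curve at every place except possibly 2, hence also at 2. The Selmer group of the untwisted
  curve consists of torsion classes only, so the remaining triple, being odd, is trivial.

  For a triple of divisors of \<open>n\<close> only the conditions at the primes of \<open>n\<close> are left. There the
  local image is generated by the 2-torsion, and in terms of Legendre symbols the condition is the
  vanishing of the two corresponding rows of the matrix; quadratic reciprocity, applied to the
  \<open>p*\<close> whose product is \<open>d3\<close>, turns the second row into one of the transpose of \<open>A\<close>.
\<close>

subsection \<open>Legendre symbols and points over residue fields\<close>

text \<open>The 2-adic conditions on \<open>E\<close> and on its twist cannot be compared directly,
  because nothing makes \<open>n\<close> a square in Q_2; the product formula carries the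
  information to 2 from the other places. Two of the three conics suffice: as 2 divides
  \<open>e1\<close> and \<open>e2\<close> exactly once, their symbols, together with the square
  product of the \<open>di\<close> and the class of \<open>d3\<close> modulo 4, leave two
  possibilities for the triple modulo 8. The second obstacle is a sign. Normalising
  \<open>d3\<close> modulo 4 changes \<open>d1\<close> and \<open>d3\<close> by a common sign, and
  -1 may be a nonresidue at a prime of \<open>e1 e2 e3\<close>. At primes of \<open>e1 e3\<close>
  the condition on \<open>p*\<close> settles this; at the other primes of \<open>e2\<close>
  multiplication by an element of norm -1 shows that changing both signs preserves solubility.
  Solubility means congruences modulo all powers of a prime, so Hensel lifting, continuity of
  symbols and the loss of primitivity under a change of coordinates all appear as statements about
  explicit powers.\<close>

lemma Legendre_cong:
  assumes "[a = b] (mod q)"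
  shows "Legendre a q = Legendre b q"
proof -
  have "[a = 0] (mod q) \<longleftrightarrow> [b = 0] (mod q)"
    using assms cong_trans cong_sym by blast
  moreover have "QuadRes q a \<longleftrightarrow> QuadRes q b"
    unfolding QuadRes_def using assms cong_trans cong_sym by blast
  ultimately show ?thesis by (simp add: Legendre_def)
qed

lemma Legendre_values: "Legendre a q = -1 \<or> Legendre a q = 0 \<or> Legendre a q = 1"
  by (simp add: Legendre_def)

lemma Legendre_eq_0_iff: "Legendre a q = 0 \<longleftrightarrow> q dvd a"
  by (simp add: Legendre_def cong_0_iff)

lemma Legendre_eq_1_iff: "Legendre a q = 1 \<longleftrightarrow> \<not> q dvd a \<and> QuadRes q a"
  by (simp add: Legendre_def cong_0_iff)

lemma odd_prime_int: "prime (q::int) \<Longrightarrow> 2 < q \<Longrightarrow> odd q"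
  using primes_dvd_imp_eq[of 2 q] two_is_prime_nat by (metis less_irrefl prime_int_numeral_eq two_is_prime_nat)

lemma odd_prime_int_natE:
  fixes q :: int
  assumes "prime q" "2 < q"
  obtains r where "q = int r" "prime r" "odd r"
proof -
  obtain r where r: "q = int r" using assms(2) by (metis nonneg_int_cases less_imp_le zero_less_numeral order_less_trans)
  moreover have "prime r" using assms(1) r by simp
  moreover have "odd r" using odd_prime_int[OF assms] r by simp
  ultimately show ?thesis by (rule that)
qed

lemma Legendre_mult:
  fixes q :: int
  assumes "prime q" "2 < q"
  shows "Legendre (a * b) q = Legendre a q * Legendre b q"
proof -
  obtain r where r: "q = int r" "prime r" using odd_prime_int_natE[OF assms] .
  have pr: "prime r" "2 < r" using assms r by auto
  note E = euler_criterion[OF pr]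
  have "[Legendre (a * b) q = (a * b) ^ ((r - 1) div 2)] (mod q)" using E r by simp
  also have "(a * b) ^ ((r - 1) div 2) = a ^ ((r - 1) div 2) * b ^ ((r - 1) div 2)"
    by (rule power_mult_distrib)
  also have "[\<dots> = Legendre a q * Legendre b q] (mod q)"
    using cong_mult[OF E[of a] E[of b]] r by (simp add: cong_sym)
  finally have "q dvd Legendre (a * b) q - Legendre a q * Legendre b q"
    by (simp add: cong_iff_dvd_diff)
  moreover have "\<bar>Legendre (a * b) q - Legendre a q * Legendre b q\<bar> < q"
    using assms(2) Legendre_values[of "a * b" q] Legendre_values[of a q] Legendre_values[of b q] by auto
  ultimately show ?thesis using dvd_imp_le_int[of "Legendre (a * b) q - Legendre a q * Legendre b q" q]
    by fastforce
qed

lemma Legendre_square: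
  assumes "\<not> q dvd a" "prime (q::int)"
  shows "Legendre (a ^ 2) q = 1"
  using assms unfolding Legendre_eq_1_iff QuadRes_def
  by (metis cong_refl prime_dvd_power)

lemma Legendre_1: "prime (q::int) \<Longrightarrow> Legendre 1 q = 1"
  using Legendre_square[of q 1] by (auto simp: prime_int_iff)

lemma Legendre_mult_self:
  assumes "prime (q::int)" "2 < q" "\<not> q dvd a"
  shows "Legendre a q * Legendre a q = 1"
  using assms Legendre_square[of q a] Legendre_mult[of q a a] by (simp add: power2_eq_square)

section \<open>Counting squares and character sums modulo an odd prime\<close>

lemma inj_on_square_residues:
  fixes q :: int
  assumes "prime q" "2 < q" "\<not> q dvd a"
  shows "inj_on (\<lambda>x. (a * x ^ 2 + c) mod q) {0..(q - 1) div 2}"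
proof (rule inj_onI)
  fix x y assume x: "x \<in> {0..(q - 1) div 2}" and y: "y \<in> {0..(q - 1) div 2}"
    and "(a * x ^ 2 + c) mod q = (a * y ^ 2 + c) mod q"
  hence "q dvd (a * x ^ 2 + c) - (a * y ^ 2 + c)" by (simp add: mod_eq_dvd_iff)
  also have "(a * x ^ 2 + c) - (a * y ^ 2 + c) = a * ((x - y) * (x + y))"
    by (simp add: algebra_simps power2_eq_square)
  finally have "q dvd x - y \<or> q dvd x + y" using assms by (simp add: prime_dvd_mult_iff)
  thus "x = y"
  proof
    assume "q dvd x - y"
    moreover have "\<bar>x - y\<bar> < q" using x y assms(2) by auto
    ultimately show ?thesis using dvd_imp_le_int[of "x - y" q] by fastforce
  next
    assume d: "q dvd x + y"
    have "2 * x \<le> q - 1" "2 * y \<le> q - 1" using x y by auto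
    hence "x + y < q" by linarith
    hence "x + y = 0" using d x y zdvd_imp_le[of q "x + y"] by fastforce
    thus ?thesis using x y by auto
  qed
qed

text \<open>Pigeonhole: \<open>a x^2\<close> and \<open>c - b y^2\<close> each take
  \<open>(q + 1) / 2\<close> values modulo \<open>q\<close>, too many for the two value sets to be
  disjoint.\<close>

lemma binary_form_surj_mod:
  fixes q :: int
  assumes "prime q" "2 < q" "\<not> q dvd a" "\<not> q dvd b"
  obtains x y where "[a * x ^ 2 + b * y ^ 2 = c] (mod q)"
proof -
  let ?I = "{0..(q - 1) div 2}"
  let ?f = "\<lambda>x. (a * x ^ 2 + 0) mod q" and ?g = "\<lambda>x. ((- b) * x ^ 2 + c) mod q"
  have card: "int (card ?I) = (q + 1) div 2" using assms(2) odd_prime_int[OF assms(1,2)] by (auto elim!: oddE)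
  have "card (?f ` ?I) = card ?I" "card (?g ` ?I) = card ?I"
    by (rule card_image, rule inj_on_square_residues; use assms in simp)+
  moreover have sub: "?f ` ?I \<union> ?g ` ?I \<subseteq> {0..<q}" using assms(2) by auto
  have "card (?f ` ?I \<union> ?g ` ?I) \<le> nat q"
    using card_mono[OF _ sub] by simp
  moreover have "card (?f ` ?I \<union> ?g ` ?I) = card (?f ` ?I) + card (?g ` ?I)" if "?f ` ?I \<inter> ?g ` ?I = {}"
    using that by (intro card_Un_disjoint) auto
  ultimately have "?f ` ?I \<inter> ?g ` ?I \<noteq> {}"
    using card assms(2) odd_prime_int[OF assms(1,2)] by (auto elim!: oddE)
  then obtain x y where "?f x = ?g y" by auto
  hence "[a * x ^ 2 = (- b) * y ^ 2 + c] (mod q)" by (simp add: cong_def)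
  hence "[a * x ^ 2 + b * y ^ 2 = c] (mod q)" by (simp add: cong_iff_dvd_diff algebra_simps)
  thus ?thesis by (rule that)
qed

lemma exists_nonresidue:
  fixes q :: int
  assumes "prime q" "2 < q"
  obtains g where "Legendre g q = -1"
proof -
  let ?I = "{0..(q - 1) div 2}"
  let ?f = "\<lambda>x. (1 * x ^ 2 + 0) mod q"
  have "card (?f ` ?I) \<le> card ?I" by (rule card_image_le) simp
  also have "card ?I < card {0..<q}" using assms by auto
  finally have "card (?f ` ?I) < card {0..<q}" .
  then obtain g where g: "g \<in> {0..<q}" "g \<notin> ?f ` ?I"
    using card_mono[of "?f ` ?I" "{0..<q}"] by (metis finite_atLeastAtMost_int finite_imageI leD subsetI)
  have "g \<noteq> 0" using g(2) assms(2) image_eqI[of 0 ?f 0 ?I] by auto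
  hence nd: "\<not> q dvd g" using g(1) zdvd_imp_le[of q g] by auto
  have "\<not> QuadRes q g"
  proof
    assume "QuadRes q g"
    then obtain y where y: "[y ^ 2 = g] (mod q)" by (auto simp: QuadRes_def)
    define z where "z = y mod q"
    have z: "0 \<le> z" "z < q" using assms(2) by (auto simp: z_def)
    have zy: "[z = y] (mod q)" by (simp add: z_def)
    have "[z ^ 2 = g] (mod q)" using cong_pow[OF zy, of 2] y cong_trans by blast
    hence e: "z ^ 2 mod q = g" using g(1) by (simp add: cong_def)
    have "(q - z) ^ 2 = z ^ 2 + q * (q - 2 * z)" by (simp add: power2_eq_square algebra_simps)
    hence e': "(q - z) ^ 2 mod q = g" using e by simp
    \<comment> \<open>One of the two roots lies in the half system \<open>?I\<close>, whose squares
      \<open>g\<close> was chosen to avoid.\<close>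
    have "z \<in> ?I \<or> q - z \<in> ?I" using z odd_prime_int[OF assms] by (auto elim!: oddE)
    thus False using g(2) e e' by (metis (no_types, lifting) add.right_neutral image_eqI mult_1)
  qed
  hence "Legendre g q = -1" using nd by (simp add: Legendre_def cong_0_iff)
  thus ?thesis by (rule that)
qed

lemma sum_residues_affine:
  fixes q :: int and f :: "int \<Rightarrow> int"
  assumes "prime q" "\<not> q dvd a" "\<And>x y. [x = y] (mod q) \<Longrightarrow> f x = f y"
  shows "(\<Sum>x\<in>{0..<q}. f (a * x + b)) = (\<Sum>x\<in>{0..<q}. f x)"
proof -
  have q0: "q > 0" using assms(1) prime_gt_0_int by blast
  let ?h = "\<lambda>x. (a * x + b) mod q"
  have inj: "inj_on ?h {0..<q}"
  proof (rule inj_onI)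
    fix x y assume x: "x \<in> {0..<q}" and y: "y \<in> {0..<q}" and "?h x = ?h y"
    hence "q dvd (a * x + b) - (a * y + b)" by (simp add: mod_eq_dvd_iff)
    hence "q dvd a * (x - y)" by (simp add: algebra_simps)
    hence "q dvd x - y" using assms by (simp add: prime_dvd_mult_iff)
    moreover have "\<bar>x - y\<bar> < q" using x y by auto
    ultimately show "x = y" using dvd_imp_le_int[of "x - y" q] by fastforce
  qed
  have "?h ` {0..<q} = {0..<q}"
    using inj q0 by (intro endo_inj_surj) auto
  hence bij: "bij_betw ?h {0..<q} {0..<q}" using inj by (simp add: bij_betw_def)
  have "(\<Sum>x\<in>{0..<q}. f (a * x + b)) = (\<Sum>x\<in>{0..<q}. f (?h x))"
    by (intro sum.cong refl assms(3)) (simp add: cong_def)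
  also have "\<dots> = (\<Sum>x\<in>{0..<q}. f x)" by (rule sum.reindex_bij_betw[OF bij])
  finally show ?thesis .
qed

text \<open>Multiplying the variable by a nonresidue permutes the residues and negates the sum over
  all of them, which therefore vanishes; the shift by \<open>b\<close> is another
  permutation.\<close>

lemma sum_Legendre_linear:
  fixes q :: int
  assumes "prime q" "2 < q"
  shows "(\<Sum>x\<in>{0..<q}. Legendre (x + b) q) = 0"
proof -
  obtain g where g: "Legendre g q = -1" using exists_nonresidue[OF assms] .
  hence ng: "\<not> q dvd g" using Legendre_eq_0_iff[of g q] by auto
  have n1: "\<not> q dvd 1" using assms by auto
  note cg = Legendre_cong[of _ _ q]
  have "(\<Sum>x\<in>{0..<q}. Legendre x q) = (\<Sum>x\<in>{0..<q}. Legendre (g * x + 0) q)"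
    by (rule sum_residues_affine[symmetric, OF assms(1) ng cg])
  also have "\<dots> = - (\<Sum>x\<in>{0..<q}. Legendre x q)"
    by (simp add: Legendre_mult[OF assms] g sum_negf)
  finally have "(\<Sum>x\<in>{0..<q}. Legendre x q) = 0" by simp
  thus ?thesis using sum_residues_affine[OF assms(1) n1, of "\<lambda>x. Legendre x q" b] cg by simp
qed

text \<open>After a shift the sum is \<open>S c\<close> with \<open>c = a - b\<close>. Scaling
  \<open>x\<close> by \<open>c\<close> shows that \<open>S c\<close> is the same for all nonzero
  \<open>c\<close>; the sum of all \<open>S c\<close> vanishes by the linear case, and
  \<open>S 0 = q - 1\<close>.\<close>

lemma sum_Legendre_quadratic:
  fixes q :: int
  assumes "prime q" "2 < q" "\<not> q dvd a - b"
  shows "(\<Sum>x\<in>{0..<q}. Legendre (x + a) q * Legendre (x + b) q) = -1"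
proof -
  note mul = Legendre_mult[OF assms(1,2)]
  define S where "S c = (\<Sum>x\<in>{0..<q}. Legendre (x * (x + c)) q)" for c
  have scal: "S c = S 1" if "\<not> q dvd c" for c
  proof -
    have "S c = (\<Sum>x\<in>{0..<q}. Legendre ((c * x + 0) * ((c * x + 0) + c)) q)"
      unfolding S_def
      by (rule sum_residues_affine[OF assms(1) that, where f = "\<lambda>x. Legendre (x * (x + c)) q", symmetric])
        (intro Legendre_cong cong_mult cong_add cong_refl)
    also have "\<dots> = (\<Sum>x\<in>{0..<q}. Legendre (c ^ 2) q * Legendre (x * (x + 1)) q)"
      by (intro sum.cong refl) (simp add: mul[symmetric] algebra_simps power2_eq_square)
    also have "\<dots> = S 1" using Legendre_square[OF that assms(1)] by (simp add: S_def)
    finally show ?thesis .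
  qed
  have "(\<Sum>c\<in>{0..<q}. S c) = (\<Sum>x\<in>{0..<q}. \<Sum>c\<in>{0..<q}. Legendre (x * (x + c)) q)"
    unfolding S_def by (rule sum.swap)
  also have "\<dots> = (\<Sum>x\<in>{0..<q}. Legendre x q * (\<Sum>c\<in>{0..<q}. Legendre (c + x) q))"
    by (simp add: mul sum_distrib_left add.commute)
  also have "\<dots> = 0" by (simp add: sum_Legendre_linear[OF assms(1,2)])
  finally have tot: "(\<Sum>c\<in>{0..<q}. S c) = 0" .
  have split: "{0..<q} = insert 0 {1..<q}" using assms(2) by auto
  have nd: "\<not> q dvd x" if "x \<in> {1..<q}" for x using that zdvd_imp_le[of q x] by auto
  have S0: "S 0 = q - 1"
  proof -
    have "S 0 = Legendre 0 q + (\<Sum>x\<in>{1..<q}. Legendre (x ^ 2) q)"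
      unfolding S_def split by (simp add: power2_eq_square)
    also have "\<dots> = Legendre 0 q + (\<Sum>x\<in>{1..<q}. 1)"
      by (intro arg_cong2[of _ _ _ _ "(+)"] sum.cong refl Legendre_square nd assms)
    also have "Legendre 0 q = 0" by (simp add: Legendre_eq_0_iff)
    finally show ?thesis using assms(2) by simp
  qed
  have "(\<Sum>c\<in>{0..<q}. S c) = S 0 + (\<Sum>c\<in>{1..<q}. S 1)"
    unfolding split using sum.cong[OF refl scal[OF nd], of "{1..<q}"] by simp
  also have "\<dots> = (q - 1) * (1 + S 1)" using S0 assms(2) by (simp add: algebra_simps)
  finally have S1: "S 1 = -1" using tot assms(2) by simp
  have n1: "\<not> q dvd 1" using assms by auto
  have "(\<Sum>x\<in>{0..<q}. Legendre (x + a) q * Legendre (x + b) q)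
      = (\<Sum>x\<in>{0..<q}. Legendre ((1 * x + b) * ((1 * x + b) + (a - b))) q)"
    by (intro sum.cong refl) (simp add: mul[symmetric] algebra_simps)
  also have "\<dots> = S (a - b)"
    unfolding S_def
    by (rule sum_residues_affine[OF assms(1) n1, where f = "\<lambda>x. Legendre (x * (x + (a - b))) q"])
      (intro Legendre_cong cong_mult cong_add cong_refl)
  finally show ?thesis using scal[OF assms(3)] S1 by simp
qed

text \<open>Over the residue field all 2-coverings of the curve have equally many points: the affine
  part of a nontrivial one has four points more than that of the trivial one, which has four
  points at infinity.\<close>
lemma residue_point_nontrivial:
  fixes q :: int
  assumes "prime q" "2 < q" "\<not> q dvd a1 - a2" "\<not> q dvd a2 - a3"
    and "Legendre d1 q = -1" "Legendre d2 q = 1" "Legendre d3 q = -1"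
  obtains x where "Legendre (d1 * (x + a1)) q \<noteq> -1" "Legendre (d2 * (x + a2)) q \<noteq> -1"
    "Legendre (d3 * (x + a3)) q \<noteq> -1"
proof -
  note mul = Legendre_mult[OF assms(1,2)]
  define l where "l a x = Legendre (x + a) q" for a x
  have l1: "l a x = -1 \<or> l a x = 0 \<or> l a x = 1" for a x
    unfolding l_def by (rule Legendre_values)
  \<comment> \<open>The equation \<open>d u^2 = v\<close> has \<open>1 + Legendre (d * v) q\<close>
    solutions modulo \<open>q\<close>. Hence \<open>P x\<close> counts the points above
    \<open>x\<close> on the covering given by \<open>d1\<close>, \<open>d2\<close>,
    \<open>d3\<close>, and \<open>Q x\<close> those on the trivial covering.\<close>
  define P where "P x = (1 - l a1 x) * (1 + l a2 x) * (1 - l a3 x)" for x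
  define Q where "Q x = (1 + l a1 x) * (1 + l a2 x) * (1 + l a3 x)" for x
  have diff: "P x = Q x + (-2) * l a1 x + (-2) * l a3 x + (-2) * (l a1 x * l a2 x) + (-2) * (l a2 x * l a3 x)" for x
    unfolding P_def Q_def by (simp add: algebra_simps)
  have lin: "(\<Sum>x\<in>{0..<q}. l a x) = 0" for a
    unfolding l_def by (rule sum_Legendre_linear[OF assms(1,2)])
  have "(\<Sum>x\<in>{0..<q}. l a1 x * l a2 x) = -1" "(\<Sum>x\<in>{0..<q}. l a2 x * l a3 x) = -1"
    unfolding l_def by (rule sum_Legendre_quadratic[OF assms(1,2)], use assms in simp)+
  hence "(\<Sum>x\<in>{0..<q}. P x) = (\<Sum>x\<in>{0..<q}. Q x) + 4"
    unfolding diff sum.distrib sum_distrib_left[symmetric] using lin by simp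
  moreover have "Q x \<ge> 0" for x
    unfolding Q_def using l1[of a1 x] l1[of a2 x] l1[of a3 x] by auto
  hence "(\<Sum>x\<in>{0..<q}. Q x) \<ge> 0" by (intro sum_nonneg) auto
  ultimately have "(\<Sum>x\<in>{0..<q}. P x) \<noteq> 0" by linarith
  then obtain x where "P x \<noteq> 0" by (metis sum.neutral)
  hence "l a1 x \<noteq> 1" "l a2 x \<noteq> -1" "l a3 x \<noteq> 1" unfolding P_def by auto
  thus ?thesis using that[of x] assms(5-7) by (simp add: mul l_def)
qed

subsection \<open>Local solubility of the 2-coverings\<close>

text \<open>Here and below \<open>ai\<close> stands for \<open>ei * m\<close>.\<close>
definition cov_eqs :: "int \<Rightarrow> int \<Rightarrow> int \<Rightarrow> int \<Rightarrow> int \<Rightarrow> int \<Rightarrow> int \<Rightarrow> int \<Rightarrow> int \<Rightarrow> int \<Rightarrow> int \<Rightarrow> bool" where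
  "cov_eqs M a1 a2 a3 d1 d2 d3 t u1 u2 u3 \<longleftrightarrow>
     M dvd a1 * t^2 + d2 * u2^2 - d3 * u3^2 \<and>
     M dvd a2 * t^2 + d3 * u3^2 - d1 * u1^2 \<and>
     M dvd a3 * t^2 + d1 * u1^2 - d2 * u2^2"

abbreviation primitive :: "int \<Rightarrow> int \<Rightarrow> int \<Rightarrow> int \<Rightarrow> int \<Rightarrow> bool" where
  "primitive q t u1 u2 u3 \<equiv> \<not> (q dvd t \<and> q dvd u1 \<and> q dvd u2 \<and> q dvd u3)"

abbreviation primitive_sol :: "int \<Rightarrow> int \<Rightarrow> int \<Rightarrow> int \<Rightarrow> int \<Rightarrow> int \<Rightarrow> int \<Rightarrow> int \<Rightarrow> bool" where
  "primitive_sol q M a1 a2 a3 d1 d2 d3 \<equiv> \<exists>t u1 u2 u3. primitive q t u1 u2 u3 \<and>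
     cov_eqs M a1 a2 a3 d1 d2 d3 t u1 u2 u3"

definition loc_sol :: "int \<Rightarrow> int \<Rightarrow> int \<Rightarrow> int \<Rightarrow> int \<Rightarrow> int \<Rightarrow> int \<Rightarrow> bool" where
  "loc_sol q a1 a2 a3 d1 d2 d3 \<longleftrightarrow> (\<forall>N. primitive_sol q (q^N) a1 a2 a3 d1 d2 d3)"

definition real_cov :: "int \<Rightarrow> int \<Rightarrow> int \<Rightarrow> int \<Rightarrow> int \<Rightarrow> int \<Rightarrow> bool" where
  "real_cov a1 a2 a3 d1 d2 d3 \<longleftrightarrow> (\<exists>t u1 u2 u3 :: real.
     \<not> (t = 0 \<and> u1 = 0 \<and> u2 = 0 \<and> u3 = 0) \<and>
     a1 * t^2 + d2 * u2^2 - d3 * u3^2 = 0 \<and>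
     a2 * t^2 + d3 * u3^2 - d1 * u1^2 = 0 \<and>
     a3 * t^2 + d1 * u1^2 - d2 * u2^2 = 0)"

lemma ex_less_4: "(\<exists>i<4::nat. P i) \<longleftrightarrow> P 0 \<or> P 1 \<or> P 2 \<or> P 3"
  by (auto simp: numeral_eq_Suc less_Suc_eq)

lemma padic_sol_D_eqs:
  "padic_sol p 4 (D_eqs e1 e2 e3 m (d1, d2, d3)) \<longleftrightarrow>
     loc_sol (int p) (e1 * m) (e2 * m) (e3 * m) d1 d2 d3"
proof -
  have "(\<exists>x::nat \<Rightarrow> int. (\<exists>i<4. \<not> int p dvd x i) \<and>
          (\<forall>v\<in>set (D_eqs e1 e2 e3 m (d1, d2, d3) x). int p ^ N dvd v)) \<longleftrightarrow>
        (primitive_sol (int p) (int p ^ N) (e1 * m) (e2 * m) (e3 * m) d1 d2 d3)" (is "?L = ?R") for N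
  proof
    assume ?L
    then obtain x :: "nat \<Rightarrow> int" where "\<exists>i<4. \<not> int p dvd x i"
      "\<forall>v\<in>set (D_eqs e1 e2 e3 m (d1, d2, d3) x). int p ^ N dvd v" by blast
    thus ?R unfolding ex_less_4
      by (intro exI[of _ "x 0"] exI[of _ "x 1"] exI[of _ "x 2"] exI[of _ "x 3"])
        (auto simp: D_eqs_def cov_eqs_def)
  next
    assume ?R
    then obtain t u1 u2 u3 where "primitive (int p) t u1 u2 u3"
      "cov_eqs (int p ^ N) (e1 * m) (e2 * m) (e3 * m) d1 d2 d3 t u1 u2 u3" by blast
    thus ?L unfolding ex_less_4
      by (intro exI[of _ "\<lambda>i. if i = 0 then t else if i = 1 then u1 else if i = 2 then u2 else u3"])
        (auto simp: D_eqs_def cov_eqs_def)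
  qed
  thus ?thesis unfolding padic_sol_def loc_sol_def by blast
qed

lemma real_sol_D_eqs:
  "real_sol 4 (D_eqs e1 e2 e3 m (d1, d2, d3)) \<longleftrightarrow> real_cov (e1 * m) (e2 * m) (e3 * m) d1 d2 d3"
  (is "?L = ?R")
proof
  assume ?L
  then obtain x :: "nat \<Rightarrow> real" where "\<exists>i<4. x i \<noteq> 0"
    "\<forall>v\<in>set (D_eqs e1 e2 e3 m (d1, d2, d3) x). v = 0" unfolding real_sol_def by blast
  thus ?R unfolding ex_less_4 real_cov_def
    by (intro exI[of _ "x 0"] exI[of _ "x 1"] exI[of _ "x 2"] exI[of _ "x 3"])
      (auto simp: D_eqs_def)
next
  assume ?R
  then obtain t u1 u2 u3 :: real where "\<not> (t = 0 \<and> u1 = 0 \<and> u2 = 0 \<and> u3 = 0)"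
     "of_int (e1 * m) * t^2 + of_int d2 * u2^2 - of_int d3 * u3^2 = 0"
     "of_int (e2 * m) * t^2 + of_int d3 * u3^2 - of_int d1 * u1^2 = 0"
     "of_int (e3 * m) * t^2 + of_int d1 * u1^2 - of_int d2 * u2^2 = 0" unfolding real_cov_def by blast
  thus ?L unfolding real_sol_def ex_less_4
    by (intro exI[of _ "\<lambda>i. if i = 0 then t else if i = 1 then u1 else if i = 2 then u2 else u3"])
      (auto simp: D_eqs_def)
qed

lemma loc_sol_rotate: "loc_sol q a1 a2 a3 d1 d2 d3 \<Longrightarrow> loc_sol q a2 a3 a1 d2 d3 d1"
  unfolding loc_sol_def cov_eqs_def by blast

lemma loc_sol_rotate_iff: "loc_sol q a2 a3 a1 d2 d3 d1 \<longleftrightarrow> loc_sol q a1 a2 a3 d1 d2 d3"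
  using loc_sol_rotate by blast

lemma real_cov_rotate: "real_cov a1 a2 a3 d1 d2 d3 \<Longrightarrow> real_cov a2 a3 a1 d2 d3 d1"
  unfolding real_cov_def by blast

text \<open>The third equation is minus the sum of the other two because the \<open>ai\<close> add
  up to zero, so two congruences suffice.\<close>

lemma cov_eqsI:
  assumes "a1 + a2 + a3 = 0" "[d3 * u3^2 = a1 * t^2 + d2 * u2^2] (mod M)"
    "[d1 * u1^2 = a2 * t^2 + d3 * u3^2] (mod M)"
  shows "cov_eqs M a1 a2 a3 d1 d2 d3 t u1 u2 u3"
proof -
  have 1: "M dvd a1 * t^2 + d2 * u2^2 - d3 * u3^2" "M dvd a2 * t^2 + d3 * u3^2 - d1 * u1^2"
    using assms(2,3) by (simp_all add: cong_iff_dvd_diff cong_sym_eq[of _ "_ + _"] cong_sym)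
     (metis cong_iff_dvd_diff cong_sym)+
  have "a3 * t^2 + d1 * u1^2 - d2 * u2^2
      = - ((a1 * t^2 + d2 * u2^2 - d3 * u3^2) + (a2 * t^2 + d3 * u3^2 - d1 * u1^2))"
    using assms(1) by (simp add: algebra_simps) (metis add.assoc add.commute distrib_right mult_zero_left)
  thus ?thesis using 1 unfolding cov_eqs_def by (metis dvd_add dvd_minus_iff)
qed

lemma cov_eqs_dvd: "cov_eqs M a1 a2 a3 d1 d2 d3 t u1 u2 u3 \<Longrightarrow> M' dvd M \<Longrightarrow>
    cov_eqs M' a1 a2 a3 d1 d2 d3 t u1 u2 u3"
  unfolding cov_eqs_def using dvd_trans by blast

text \<open>A rational change of coordinates destroys primitivity by a bounded power of
  \<open>q\<close>. Starting with precision \<open>N + 2 * K\<close>, fewer than \<open>K\<close>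
  common factors \<open>q\<close> have to be divided out, and each costs a factor \<open>q^2\<close>
  of the modulus since the forms are quadratic.\<close>

lemma loc_sol_weaken_primitive:
  assumes "prime q" "\<And>N. primitive_sol (q^K) (q^N) a1 a2 a3 d1 d2 d3"
  shows "loc_sol q a1 a2 a3 d1 d2 d3"
proof -
  have q0: "q \<noteq> 0" using assms(1) by auto
  have red: "primitive_sol q (q^N) a1 a2 a3 d1 d2 d3"
    if "primitive (q^K) t u1 u2 u3"
      "cov_eqs (q^(N + 2 * K)) a1 a2 a3 d1 d2 d3 t u1 u2 u3" for K N t u1 u2 u3
    using that
  proof (induction K arbitrary: t u1 u2 u3)
    case 0
    thus ?case by simp
  next
    case (Suc K)
    show ?case
    proof (cases "q dvd t \<and> q dvd u1 \<and> q dvd u2 \<and> q dvd u3")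
      case True
      then obtain t' v1 v2 v3 where e: "t = q * t'" "u1 = q * v1" "u2 = q * v2" "u3 = q * v3"
        by (auto elim!: dvdE)
      have "\<not> (q^K dvd t' \<and> q^K dvd v1 \<and> q^K dvd v2 \<and> q^K dvd v3)"
        using Suc.prems(1) q0 by (auto simp: e)
      moreover have canc: "q ^ (N + 2 * K) dvd x * s^2 + y * r^2 - z * w^2"
        if "q ^ (N + 2 * Suc K) dvd x * (q * s)^2 + y * (q * r)^2 - z * (q * w)^2" for x y z s r w
      proof -
        have "x * (q * s)^2 + y * (q * r)^2 - z * (q * w)^2 = q^2 * (x * s^2 + y * r^2 - z * w^2)"
          by (simp add: algebra_simps power_mult_distrib)
        moreover have "q ^ (N + 2 * Suc K) = q^2 * q ^ (N + 2 * K)"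
          by (simp add: power_add power2_eq_square)
        ultimately show ?thesis using that q0 by (metis dvd_times_left_cancel_iff power_not_zero)
      qed
      have "cov_eqs (q^(N + 2 * K)) a1 a2 a3 d1 d2 d3 t' v1 v2 v3"
        using Suc.prems(2) unfolding cov_eqs_def e by (blast intro: canc)
      ultimately show ?thesis by (rule Suc.IH)
    next
      case False
      have "q^N dvd q^(N + 2 * Suc K)" by (simp add: le_imp_power_dvd)
      thus ?thesis using False cov_eqs_dvd[OF Suc.prems(2)] by blast
    qed
  qed
  show ?thesis unfolding loc_sol_def
  proof
    fix N
    obtain t u1 u2 u3 where "primitive (q^K) t u1 u2 u3"
      "cov_eqs (q^(N + 2 * K)) a1 a2 a3 d1 d2 d3 t u1 u2 u3" using assms(2) by blast
    thus "primitive_sol q (q^N) a1 a2 a3 d1 d2 d3" by (rule red)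
  qed
qed

lemma cov_eqs_dvd_terms:
  assumes "cov_eqs M a1 a2 a3 d1 d2 d3 t u1 u2 u3" "M dvd a1 * t^2" "M dvd a3 * t^2" "M dvd d2 * u2^2"
  shows "M dvd d3 * u3^2" "M dvd d1 * u1^2"
proof -
  have "M dvd a1 * t^2 + d2 * u2^2 - (a1 * t^2 + d2 * u2^2 - d3 * u3^2)"
    "M dvd (a3 * t^2 + d1 * u1^2 - d2 * u2^2) - a3 * t^2 + d2 * u2^2"
    using assms unfolding cov_eqs_def by (meson dvd_diff dvd_add)+
  thus "M dvd d3 * u3^2" "M dvd d1 * u1^2" by simp_all
qed

section \<open>Hensel lifting of square roots\<close>

lemma not_dvd_of_Legendre: "Legendre a q = 1 \<Longrightarrow> \<not> q dvd a" "Legendre a q = -1 \<Longrightarrow> \<not> q dvd a"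
  using Legendre_eq_0_iff[of a q] by auto

text \<open>Hensel's lemma for a square root of \<open>w / d\<close>. The hypothesis is on
  \<open>d * w\<close>, which has the same square class and avoids inverses.\<close>

lemma lift_sqrt:
  fixes q :: int
  assumes "prime q" "2 < q" "Legendre (d * w) q = 1"
  obtains u where "\<not> q dvd u" "[d * u^2 = w] (mod q^N)"
proof -
  have dw: "\<not> q dvd d" "\<not> q dvd w" using not_dvd_of_Legendre(1)[OF assms(3)] by auto
  obtain y where y: "[y^2 = d * w] (mod q)" using assms(3) by (auto simp: Legendre_eq_1_iff QuadRes_def)
  have cop: "coprime x q" if "\<not> q dvd x" for x
    using that assms(1) by (simp add: coprime_commute prime_imp_coprime)
  obtain d' where d': "[d * d' = 1] (mod q)" using cong_solve_coprime_int[OF cop[OF dw(1)]] by blast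
  have "\<exists>u. \<not> q dvd u \<and> [d * u^2 = w] (mod q^Suc N)" for N
  proof (induction N)
    case 0
    have "[d * (d' * y)^2 = d * d'^2 * (d * w)] (mod q)"
      using cong_mult[OF cong_refl[of "d * d'^2" q] y] by (simp add: power_mult_distrib mult_ac)
    moreover have "[d * d'^2 * (d * w) = w] (mod q)"
      using cong_mult[OF cong_mult[OF d' d'] cong_refl[of w q]] by (simp add: power2_eq_square mult_ac)
    ultimately have 1: "[d * (d' * y)^2 = w] (mod q)" by (rule cong_trans)
    hence "\<not> q dvd d' * y" using dw(2) cong_dvd_iff[OF 1] by (metis dvd_mult dvd_power zero_less_numeral dvd_trans)
    thus ?case using 1 by auto
  next
    case (Suc N)
    then obtain u where u: "\<not> q dvd u" "[d * u^2 = w] (mod q^Suc N)" by blast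
    then obtain k where k: "w - d * u^2 = q^Suc N * k"
      by (metis cong_iff_dvd_diff cong_sym dvdE)
    \<comment> \<open>The derivative \<open>2 d u\<close> is a unit, so the correction
      \<open>s\<close> can solve \<open>2 d u s = k\<close> modulo \<open>q\<close>. The quadratic
      term carries \<open>q^(2 * Suc N)\<close>, which vanishes at the new precision.\<close>
    have "\<not> q dvd 2 * d * u" using u(1) dw(1) assms(1,2) odd_prime_int[OF assms(1,2)]
      by (auto simp: prime_dvd_mult_iff dest: zdvd_imp_le)
    then obtain i where i: "[2 * d * u * i = 1] (mod q)" using cong_solve_coprime_int[OF cop] by blast
    define s where "s = i * k"
    have "[2 * d * u * s = k] (mod q)" using cong_mult[OF i cong_refl[of k q]] by (simp add: s_def mult_ac)
    then obtain l where l: "k - 2 * d * u * s = q * l" by (metis cong_iff_dvd_diff cong_sym dvdE)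
    have "w - d * (u + q^Suc N * s)^2 = q^Suc N * k - 2 * d * u * s * q^Suc N - d * s^2 * (q^Suc N)^2"
      using k by (simp add: power2_eq_square algebra_simps)
    also have "\<dots> = q^Suc N * (k - 2 * d * u * s) - d * s^2 * (q^Suc N)^2" by (simp add: algebra_simps)
    also have "\<dots> = q^Suc (Suc N) * (l - d * s^2 * q^N)"
      unfolding l by (simp add: power2_eq_square algebra_simps)
    finally have "[d * (u + q^Suc N * s)^2 = w] (mod q^Suc (Suc N))"
      by (metis cong_iff_dvd_diff cong_sym dvd_triv_left)
    moreover have "\<not> q dvd u + q^Suc N * s" using u(1) by (simp add: dvd_add_left_iff)
    ultimately show ?case by blast
  qed
  then obtain u where "\<not> q dvd u" "[d * u^2 = w] (mod q^Suc N)" by blast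
  moreover have "q^N dvd q^Suc N" by simp
  ultimately show ?thesis using that cong_dvd_modulus by blast
qed

lemma lift_sqrt_or_zero:
  fixes q :: int
  assumes "prime q" "2 < q" "w = 0 \<or> Legendre (d * w) q = 1"
  obtains u where "[d * u^2 = w] (mod q^N)"
proof (cases "w = 0")
  case True
  thus ?thesis using that[of 0] by simp
next
  case False
  thus ?thesis using lift_sqrt[OF assms(1,2), of d w N] assms(3) that by blast
qed

text \<open>Newton's step at 2, where the factor 2 of the derivative costs one exponent: if the
  error is an odd multiple of \<open>2^(N + 3)\<close>, adding \<open>2^(N + 2)\<close> to
  \<open>u\<close> changes \<open>d * u^2\<close> by another odd multiple of
  \<open>2^(N + 3)\<close>, and one binary digit is gained. The start \<open>u = 1\<close> is exact
  modulo 8.\<close>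

lemma lift_sqrt_2:
  fixes d w :: int
  assumes "odd d" "8 dvd w - d"
  obtains u where "odd u" "[d * u^2 = w] (mod 2^N)"
proof -
  have "\<exists>u. odd u \<and> 2^(N + 3) dvd w - d * u^2" for N
  proof (induction N)
    case 0
    thus ?case using assms by (intro exI[of _ 1]) simp
  next
    case (Suc N)
    then obtain u k where u: "odd u" and k: "w - d * u^2 = 2^(N + 3) * k" by (auto elim!: dvdE)
    show ?case
    proof (cases "even k")
      case True
      then obtain l where "k = 2 * l" by (rule evenE)
      hence "w - d * u^2 = 2^(Suc N + 3) * l" using k by (simp add: power_add)
      thus ?thesis using u by (metis dvd_triv_left)
    next
      case False
      have "w - d * (u + 2^(N + 2))^2 = 2^(N + 3) * k - d * (2^(N + 3) * u) - d * 2^(N + 3) * 2^(N + 1)"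
        unfolding k[symmetric] by (simp add: power2_eq_square algebra_simps power_add)
      also have "\<dots> = 2^(N + 3) * (k - d * u - d * 2^(N + 1))" by (simp add: algebra_simps)
      finally have e: "w - d * (u + 2^(N + 2))^2 = 2^(N + 3) * (k - d * u - d * 2^(N + 1))" .
      have "even (k - d * u - d * 2^(N + 1))" using False assms(1) u by simp
      then obtain l where "k - d * u - d * 2^(N + 1) = 2 * l" by (rule evenE)
      hence "w - d * (u + 2^(N + 2))^2 = 2^(Suc N + 3) * l" using e by (simp add: power_add)
      moreover have "odd (u + 2^(N + 2))" using u by simp
      ultimately show ?thesis by (metis dvd_triv_left)
    qed
  qed
  then obtain u where u: "odd u" "2^(N + 3) dvd w - d * u^2" by blast
  have "2^N dvd w - d * u^2" using u(2) by (metis dvd_trans le_add1 le_imp_power_dvd)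
  hence "[d * u^2 = w] (mod 2^N)" by (metis cong_iff_dvd_diff cong_sym)
  thus ?thesis using u(1) that by blast
qed

section \<open>Solubility criteria at an odd prime\<close>

lemma dvd_mult_square: "(q::int) dvd u \<Longrightarrow> q dvd d * u^2"
  by (simp add: power2_eq_square)

text \<open>If all \<open>di\<close> lie in one square class, the covering has a point at infinity,
  with \<open>t = 0\<close> and \<open>u1 = 1\<close>.\<close>

lemma loc_sol_squares:
  assumes "prime q" "2 < q" "a1 + a2 + a3 = 0" "Legendre (d2 * d1) q = 1" "Legendre (d3 * d1) q = 1"
  shows "loc_sol q a1 a2 a3 d1 d2 d3"
  unfolding loc_sol_def
proof
  fix N
  obtain u2 where u2: "[d2 * u2^2 = d1] (mod q^N)" using lift_sqrt[OF assms(1,2,4), of N] by blast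
  obtain u3 where u3: "[d3 * u3^2 = d1] (mod q^N)" using lift_sqrt[OF assms(1,2,5), of N] by blast
  have "cov_eqs (q^N) a1 a2 a3 d1 d2 d3 0 1 u2 u3"
    by (rule cov_eqsI[OF assms(3)]) (use u2 cong_trans[OF u3 cong_sym[OF u2]] cong_sym[OF u3] in auto)
  moreover have "\<not> q dvd 1" using assms(2) by auto
  ultimately show "primitive_sol q (q^N) a1 a2 a3 d1 d2 d3" by blast
qed

lemma loc_sol_good_nontrivial:
  assumes "prime q" "2 < q" "a1 + a2 + a3 = 0" "\<not> q dvd a1" "\<not> q dvd a2" "\<not> q dvd a3"
    and "Legendre d1 q = -1" "Legendre d2 q = 1" "Legendre d3 q = -1"
  shows "loc_sol q a1 a2 a3 d1 d2 d3"
proof -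
  have a3: "a2 - (- a1) = - a3" using assms(3) by simp
  have "\<not> q dvd a2 - (- a1)" "\<not> q dvd (- a1) - 0" using assms(4,6) unfolding a3 by auto
  from residue_point_nontrivial[OF assms(1,2) this assms(7-9)]
  obtain x where x: "Legendre (d1 * (x + a2)) q \<noteq> -1" "Legendre (d2 * (x + - a1)) q \<noteq> -1"
    "Legendre (d3 * (x + 0)) q \<noteq> -1" .
  have d: "\<not> q dvd d1" "\<not> q dvd d2" "\<not> q dvd d3" using assms(7-9) not_dvd_of_Legendre by blast+
  \<comment> \<open>Here \<open>t = 1\<close> and the parameter is \<open>x = d3 * u3^2\<close>, so
    the other two values are \<open>x - a1\<close> and \<open>x + a2\<close>. A value that vanishes
    modulo \<open>q\<close> cannot be lifted as a unit; the parameter is then moved to the exact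
    root 0, \<open>a1\<close> or \<open>- a2\<close>. The three roots are distinct modulo
    \<open>q\<close>, so the other values stay units.\<close>
  define y where "y = (if q dvd x then 0 else if q dvd x - a1 then a1 else if q dvd x + a2 then - a2 else x)"
  have neg: "- a2 - x = - (x + a2)" "- a2 - a1 = - (a1 + a2)" by simp_all
  have yx: "[y = x] (mod q)" unfolding y_def cong_iff_dvd_diff
    by (simp add: neg dvd_diff_commute[of q a1 x] del: minus_add_distrib)
  have nz: "w = 0 \<or> Legendre (d * w) q = 1" if "[w = v] (mod q)" "Legendre (d * v) q \<noteq> -1" "\<not> q dvd d"
    "w = 0 \<or> \<not> q dvd w" for d w v
    using that Legendre_values[of "d * w" q] Legendre_eq_0_iff[of "d * w" q] assms(1)
      Legendre_cong[OF cong_mult[OF cong_refl[of d q] that(1)]] by (auto simp: prime_dvd_mult_iff)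
  have "a1 + a2 = - a3" using assms(3) by simp
  hence n12: "\<not> q dvd a1 + a2" using assms(6) by simp
  have s: "y = 0 \<or> \<not> q dvd y" "y - a1 = 0 \<or> \<not> q dvd y - a1" "y + a2 = 0 \<or> \<not> q dvd y + a2"
    using assms(4,5) n12 unfolding y_def by (simp_all add: neg del: minus_add_distrib)
  have w3: "y = 0 \<or> Legendre (d3 * y) q = 1" by (rule nz[OF yx]) (use x d s in auto)
  have w2: "y - a1 = 0 \<or> Legendre (d2 * (y - a1)) q = 1"
    by (rule nz[OF cong_diff[OF yx cong_refl]]) (use x d s in auto)
  have w1: "y + a2 = 0 \<or> Legendre (d1 * (y + a2)) q = 1"
    by (rule nz[OF cong_add[OF yx cong_refl]]) (use x d s in auto)
  show ?thesis unfolding loc_sol_def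
  proof
    fix N
    obtain u1 where u1: "[d1 * u1^2 = y + a2] (mod q^N)" by (rule lift_sqrt_or_zero[OF assms(1,2) w1])
    obtain u2 where u2: "[d2 * u2^2 = y - a1] (mod q^N)" by (rule lift_sqrt_or_zero[OF assms(1,2) w2])
    obtain u3 where u3: "[d3 * u3^2 = y] (mod q^N)" by (rule lift_sqrt_or_zero[OF assms(1,2) w3])
    have "[d3 * u3^2 = a1 * 1^2 + d2 * u2^2] (mod q^N)"
      using cong_add[OF cong_refl[of a1] u2] u3 cong_trans[OF u3 cong_sym] by auto
    moreover have "[d1 * u1^2 = a2 * 1^2 + d3 * u3^2] (mod q^N)"
      using cong_add[OF cong_refl[of a2] u3] cong_trans[OF u1 cong_sym] by (auto simp: add.commute)
    ultimately have "cov_eqs (q^N) a1 a2 a3 d1 d2 d3 1 u1 u2 u3" by (rule cov_eqsI[OF assms(3)])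
    moreover have "\<not> q dvd 1" using assms(2) by auto
    ultimately show "primitive_sol q (q^N) a1 a2 a3 d1 d2 d3" by blast
  qed
qed

lemma Legendre_of_square_product:
  assumes "prime q" "2 < q" "\<not> q dvd d1" "\<not> q dvd d2" "\<not> q dvd d3" "d1 * d2 * d3 = s^2"
  shows "Legendre d1 q * Legendre d2 q * Legendre d3 q = 1"
proof -
  have "\<not> q dvd d1 * d2 * d3" using assms(1,3-5) by (simp add: prime_dvd_mult_iff)
  hence "\<not> q dvd s" unfolding assms(6) power2_eq_square by auto
  hence "Legendre (s^2) q = 1" using Legendre_square assms(1) by blast
  thus ?thesis unfolding assms(6)[symmetric] by (simp add: Legendre_mult[OF assms(1,2)])
qed

text \<open>A square product leaves zero or two nonresidues among the unit \<open>di\<close>. The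
  first case has a point at infinity; the second is the counting argument over the residue field,
  with the indices rotated until the residue stands in the middle.\<close>

lemma loc_sol_good_reduction:
  assumes "prime q" "2 < q" "a1 + a2 + a3 = 0" "\<not> q dvd a1" "\<not> q dvd a2" "\<not> q dvd a3"
    and "\<not> q dvd d1" "\<not> q dvd d2" "\<not> q dvd d3" "d1 * d2 * d3 = s^2"
  shows "loc_sol q a1 a2 a3 d1 d2 d3"
proof -
  note mul = Legendre_mult[OF assms(1,2)]
  have "Legendre d1 q * Legendre d2 q * Legendre d3 q = 1"
    using Legendre_of_square_product assms by blast
  then consider "Legendre d1 q = 1" "Legendre d2 q = 1" "Legendre d3 q = 1"
    | "Legendre d1 q = -1" "Legendre d2 q = 1" "Legendre d3 q = -1"
    | "Legendre d2 q = -1" "Legendre d3 q = 1" "Legendre d1 q = -1"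
    | "Legendre d3 q = -1" "Legendre d1 q = 1" "Legendre d2 q = -1"
    using Legendre_values[of d1 q] Legendre_values[of d2 q] Legendre_values[of d3 q] by auto
  thus ?thesis
  proof cases
    case 1
    show ?thesis by (rule loc_sol_squares[OF assms(1-3)]) (simp_all add: mul 1)
  next
    case 2
    show ?thesis by (rule loc_sol_good_nontrivial[OF assms(1-6) 2])
  next
    case 3
    have "loc_sol q a2 a3 a1 d2 d3 d1" by (rule loc_sol_good_nontrivial) (use assms 3 in auto)
    thus ?thesis by (simp add: loc_sol_rotate_iff)
  next
    case 4
    have "loc_sol q a3 a1 a2 d3 d1 d2" by (rule loc_sol_good_nontrivial) (use assms 4 in auto)
    thus ?thesis using loc_sol_rotate by blast
  qed
qed

text \<open>As \<open>q\<close> divides \<open>a2\<close>, the equation for \<open>u1\<close>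
  reduces to \<open>d1 u1^2 = d3 u3^2\<close>, which the last hypothesis solves once
  \<open>u3\<close> is a unit. Letting \<open>a1 t^2 + d2 u2^2\<close> represent the value
  \<open>d3\<close> makes \<open>u3^2\<close> congruent to 1.\<close>

lemma loc_sol_conic:
  assumes "prime q" "2 < q" "a1 + a2 + a3 = 0" "\<not> q dvd a1" "q dvd a2" "\<not> q dvd d2"
    and "Legendre (d1 * d3) q = 1"
  shows "loc_sol q a1 a2 a3 d1 d2 d3"
proof -
  obtain t u2 where tu: "[a1 * t^2 + d2 * u2^2 = d3] (mod q)"
    using binary_form_surj_mod[OF assms(1,2,4,6)] .
  define w where "w = a1 * t^2 + d2 * u2^2"
  have d3: "\<not> q dvd d3" using not_dvd_of_Legendre(1)[OF assms(7)] by auto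
  have "[d3 * w = d3^2] (mod q)" using cong_mult[OF cong_refl tu, of d3] by (simp add: w_def power2_eq_square)
  hence L3: "Legendre (d3 * w) q = 1" using Legendre_square[OF d3 assms(1)] Legendre_cong by metis
  have "[a2 * t^2 + w = 0 * t^2 + d3] (mod q)"
    unfolding w_def by (intro cong_add cong_mult tu cong_refl) (use assms(5) in \<open>simp add: cong_0_iff\<close>)
  hence "[d1 * (a2 * t^2 + w) = d1 * d3] (mod q)" using cong_mult[OF cong_refl, of _ _ q d1] by simp
  hence L1: "Legendre (d1 * (a2 * t^2 + w)) q = 1" using assms(7) Legendre_cong by metis
  show ?thesis unfolding loc_sol_def
  proof
    fix N
    obtain u3 where u3: "\<not> q dvd u3" "[d3 * u3^2 = w] (mod q^N)" by (rule lift_sqrt[OF assms(1,2) L3])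
    obtain u1 where u1: "[d1 * u1^2 = a2 * t^2 + w] (mod q^N)" by (rule lift_sqrt[OF assms(1,2) L1])
    have "cov_eqs (q^N) a1 a2 a3 d1 d2 d3 t u1 u2 u3"
    proof (rule cov_eqsI[OF assms(3)])
      show "[d3 * u3^2 = a1 * t^2 + d2 * u2^2] (mod q^N)" using u3(2) by (simp add: w_def)
      show "[d1 * u1^2 = a2 * t^2 + d3 * u3^2] (mod q^N)"
        using cong_trans[OF u1 cong_add[OF cong_refl cong_sym[OF u3(2)]]] .
    qed
    thus "primitive_sol q (q^N) a1 a2 a3 d1 d2 d3" using u3(1) by blast
  qed
qed

lemma Legendre_1_of_cong_squares:
  assumes "prime q" "q dvd b * t^2 - c * u^2" "\<not> q dvd t" "\<not> q dvd b" "\<not> q dvd c"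
  shows "Legendre (b * c) q = 1"
proof -
  have n: "\<not> q dvd b * c" using assms by (simp add: prime_dvd_mult_iff)
  have "coprime t q" using assms by (simp add: coprime_commute prime_imp_coprime)
  then obtain t' where t': "[t * t' = 1] (mod q)" using cong_solve_coprime_int by blast
  have "[b * t^2 = c * u^2] (mod q)" using assms(2) by (simp add: cong_iff_dvd_diff)
  hence "[b * t^2 * (c * t'^2) = c * u^2 * (c * t'^2)] (mod q)" by (rule cong_mult[OF _ cong_refl])
  moreover have "b * t^2 * (c * t'^2) = b * c * (t * t')^2" "c * u^2 * (c * t'^2) = (c * u * t')^2"
    by (simp_all add: power2_eq_square)
  ultimately have "[(c * u * t')^2 = b * c * (t * t')^2] (mod q)" using cong_sym by metis
  moreover have "[b * c * (t * t')^2 = b * c * 1^2] (mod q)" by (intro cong_mult cong_pow cong_refl t')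
  ultimately have "[(c * u * t')^2 = b * c] (mod q)" using cong_trans by fastforce
  thus ?thesis using n unfolding Legendre_eq_1_iff QuadRes_def by blast
qed

lemma prime_dvd_square_mult:
  assumes "prime (q::int)" "q dvd d * u^2" "\<not> q dvd d"
  shows "q dvd u"
  using assms by (metis prime_dvd_mult_iff prime_dvd_power)

text \<open>Modulo \<open>q\<close> the terms in \<open>t\<close> disappear, so the
  \<open>di\<close> agree up to squares once the \<open>ui\<close> are units; three equal classes
  with square product are trivial. If \<open>q\<close> divided all \<open>ui\<close>, then, dividing
  \<open>a1\<close> only once, it would divide \<open>t\<close> as well.\<close>

lemma loc_sol_twisted_units:
  assumes "prime q" "2 < q" "a1 + a2 + a3 = 0" "q dvd a1" "\<not> q^2 dvd a1" "q dvd a2"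
    and "\<not> q dvd d1" "\<not> q dvd d2" "\<not> q dvd d3" "d1 * d2 * d3 = s^2"
  shows "loc_sol q a1 a2 a3 d1 d2 d3 \<longleftrightarrow> Legendre d2 q = 1 \<and> Legendre d3 q = 1"
proof -
  note mul = Legendre_mult[OF assms(1,2)]
  have pr: "Legendre d1 q * Legendre d2 q * Legendre d3 q = 1"
    using Legendre_of_square_product assms by blast
  show ?thesis
  proof
    assume "Legendre d2 q = 1 \<and> Legendre d3 q = 1"
    thus "loc_sol q a1 a2 a3 d1 d2 d3" using pr
      by (intro loc_sol_squares[OF assms(1-3)]) (simp_all add: mul)
  next
    assume "loc_sol q a1 a2 a3 d1 d2 d3"
    then obtain t u1 u2 u3 where nd: "primitive q t u1 u2 u3"
      and eq: "cov_eqs (q^2) a1 a2 a3 d1 d2 d3 t u1 u2 u3" unfolding loc_sol_def by blast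
    have eq1: "cov_eqs q a1 a2 a3 d1 d2 d3 t u1 u2 u3" by (rule cov_eqs_dvd[OF eq]) simp
    have "q dvd (a1 * t^2 + d2 * u2^2 - d3 * u3^2) - a1 * t^2" "q dvd (a2 * t^2 + d3 * u3^2 - d1 * u1^2) - a2 * t^2"
      using eq1 assms(4,6) unfolding cov_eqs_def by (meson dvd_diff dvd_mult2)+
    hence c: "q dvd d2 * u2^2 - d3 * u3^2" "q dvd d3 * u3^2 - d1 * u1^2" by simp_all
    have u3: "\<not> q dvd u3"
    proof
      assume h: "q dvd u3"
      hence h2: "q dvd d3 * u3^2" by (rule dvd_mult_square)
      have "q dvd d2 * u2^2" "q dvd d1 * u1^2" using c h2
        by (simp_all add: dvd_diff_left_iff dvd_diff_right_iff)
      hence h3: "q dvd u2" "q dvd u1" using prime_dvd_square_mult assms by blast+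
      have "q^2 dvd d2 * u2^2" "q^2 dvd d3 * u3^2" using h h3 by (simp_all add: dvd_mult)
      hence "q^2 dvd (a1 * t^2 + d2 * u2^2 - d3 * u3^2) - d2 * u2^2 + d3 * u3^2"
        using eq unfolding cov_eqs_def by (meson dvd_diff dvd_add)
      hence "q^2 dvd a1 * t^2" by simp
      moreover have "\<not> q dvd t" using nd h h3 by blast
      hence "coprime (q^2) (t^2)" using assms(1) by (simp add: prime_imp_coprime)
      ultimately have "q^2 dvd a1" using coprime_dvd_mult_left_iff by blast
      thus False using assms(5) by blast
    qed
    have "\<not> q dvd u2"
    proof
      assume "q dvd u2"
      hence "q dvd d2 * u2^2" by (rule dvd_mult_square)
      hence "q dvd d3 * u3^2" using c(1) by (simp add: dvd_diff_right_iff)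
      thus False using u3 prime_dvd_square_mult assms by blast
    qed
    hence "Legendre (d2 * d3) q = 1" using Legendre_1_of_cong_squares[OF assms(1) c(1)] assms by blast
    moreover have "Legendre (d3 * d1) q = 1" using Legendre_1_of_cong_squares[OF assms(1) c(2) u3] assms by blast
    ultimately show "Legendre d2 q = 1 \<and> Legendre d3 q = 1"
      using pr Legendre_values[of d1 q] Legendre_values[of d2 q] Legendre_values[of d3 q] by (auto simp: mul)
  qed
qed

text \<open>Solubility forces \<open>q\<close> to divide \<open>u2\<close>; after division by
  \<open>q\<close> the two equations containing \<open>d2\<close> become
  \<open>b1 t^2 = c3 u3^2\<close> and \<open>- b3 t^2 = c1 u1^2\<close> modulo \<open>q\<close>,
  with \<open>t\<close> a unit. Conversely the two symbols give a point with \<open>u2 = 0\<close>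
  and \<open>t = 1\<close>.\<close>

lemma loc_sol_twisted_ramified:
  assumes "prime q" "2 < q" "b1 + b2 + b3 = 0" "\<not> q dvd b1" "\<not> q dvd b3"
    and "\<not> q dvd c1" "\<not> q dvd d2" "\<not> q dvd c3"
  shows "loc_sol q (q * b1) (q * b2) (q * b3) (q * c1) d2 (q * c3) \<longleftrightarrow>
    Legendre (b1 * c3) q = 1 \<and> Legendre (- b3 * c1) q = 1"
proof
  assume L: "Legendre (b1 * c3) q = 1 \<and> Legendre (- b3 * c1) q = 1"
  show "loc_sol q (q * b1) (q * b2) (q * b3) (q * c1) d2 (q * c3)"
    unfolding loc_sol_def
  proof
    fix N
    obtain u3 where u3: "[c3 * u3^2 = b1] (mod q^N)"
      using lift_sqrt[OF assms(1,2), of c3 b1 N] L by (auto simp: mult.commute)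
    obtain u1 where u1: "[c1 * u1^2 = - b3] (mod q^N)"
      using lift_sqrt[OF assms(1,2), of c1 "- b3" N] L by (auto simp: mult.commute)
    have "cov_eqs (q^N) (q * b1) (q * b2) (q * b3) (q * c1) d2 (q * c3) 1 u1 0 u3"
    proof (rule cov_eqsI)
      show "q * b1 + q * b2 + q * b3 = 0" using assms(3) by (metis distrib_left mult_zero_right)
      show "[q * c3 * u3^2 = q * b1 * 1^2 + d2 * 0^2] (mod q^N)"
        using cong_mult[OF cong_refl u3, of q] by (simp add: mult_ac)
      have b3: "- b3 = b2 + b1" using assms(3) by simp
      have "[q * (c1 * u1^2) = q * (b2 + b1)] (mod q^N)"
        using cong_mult[OF cong_refl u1, of q] b3 by simp
      moreover have "[q * (b2 + c3 * u3^2) = q * (b2 + b1)] (mod q^N)"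
        by (intro cong_mult cong_add cong_refl u3)
      ultimately have "[q * (c1 * u1^2) = q * (b2 + c3 * u3^2)] (mod q^N)" using cong_trans cong_sym by blast
      thus "[q * c1 * u1^2 = q * b2 * 1^2 + q * c3 * u3^2] (mod q^N)" by (simp add: algebra_simps)
    qed
    moreover have "\<not> q dvd 1" using assms(2) by auto
    ultimately show "primitive_sol q (q^N) (q * b1) (q * b2) (q * b3) (q * c1) d2 (q * c3)" by blast
  qed
next
  assume "loc_sol q (q * b1) (q * b2) (q * b3) (q * c1) d2 (q * c3)"
  then obtain t u1 u2 u3 where nd: "primitive q t u1 u2 u3"
    and eq: "cov_eqs (q^2) (q * b1) (q * b2) (q * b3) (q * c1) d2 (q * c3) t u1 u2 u3"
    unfolding loc_sol_def by blast
  have q0: "q \<noteq> 0" using assms(2) by auto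
  have "q dvd q * b1 * t^2 + d2 * u2^2 - q * c3 * u3^2"
    using eq unfolding cov_eqs_def by (meson dvd_power dvd_trans zero_less_numeral)
  hence "q dvd (q * b1 * t^2 + d2 * u2^2 - q * c3 * u3^2) - q * (b1 * t^2 - c3 * u3^2)"
    by (metis dvd_diff dvd_triv_left)
  hence "q dvd d2 * u2^2" by (simp add: algebra_simps)
  hence u2: "q dvd u2" using prime_dvd_square_mult assms by blast
  hence u22: "q^2 dvd d2 * u2^2" by (simp add: dvd_mult)
  have "q^2 dvd (q * b1 * t^2 + d2 * u2^2 - q * c3 * u3^2) - d2 * u2^2"
    "q^2 dvd (q * b3 * t^2 + q * c1 * u1^2 - d2 * u2^2) + d2 * u2^2"
    using eq u22 unfolding cov_eqs_def by (meson dvd_diff dvd_add)+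
  hence "q * q dvd q * (b1 * t^2 - c3 * u3^2)" "q * q dvd q * (b3 * t^2 + c1 * u1^2)"
    by (simp_all add: power2_eq_square algebra_simps)
  hence c: "q dvd b1 * t^2 - c3 * u3^2" "q dvd b3 * t^2 + c1 * u1^2" using q0 by simp_all
  have t: "\<not> q dvd t"
  proof
    assume h: "q dvd t"
    hence h2: "q dvd b1 * t^2" "q dvd b3 * t^2" by (rule dvd_mult_square)+
    have "q dvd c3 * u3^2" "q dvd c1 * u1^2" using c h2
      by (simp_all add: dvd_diff_right_iff dvd_add_right_iff)
    hence "q dvd u3" "q dvd u1" using prime_dvd_square_mult assms by blast+
    thus False using nd h u2 by blast
  qed
  have "q dvd - (b3 * t^2 + c1 * u1^2)" using c(2) by (subst dvd_minus_iff)
  hence c2: "q dvd (- b3) * t^2 - c1 * u1^2" by (simp add: algebra_simps)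
  show "Legendre (b1 * c3) q = 1 \<and> Legendre (- b3 * c1) q = 1"
    using Legendre_1_of_cong_squares[OF assms(1) c(1) t] Legendre_1_of_cong_squares[OF assms(1) c2 t] assms
    by auto
qed

lemma prime_square_dvd_mult:
  assumes "prime (q::int)" "q^2 dvd d * u^2" "\<not> q^2 dvd d"
  shows "q dvd u"
proof (rule ccontr)
  assume "\<not> q dvd u"
  hence "coprime (q^2) (u^2)" using assms(1) by (simp add: prime_imp_coprime)
  thus False using assms coprime_dvd_mult_left_iff by blast
qed

text \<open>A descent: modulo \<open>q\<close> the equation without \<open>d2\<close> gives
  \<open>q dvd t\<close>, the first one then gives \<open>q dvd u2\<close>, and modulo
  \<open>q^2\<close> the other coordinates follow. So a prime that divides exactly \<open>d1\<close>
  and \<open>d3\<close> must divide \<open>a2\<close>.\<close>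

lemma not_loc_sol_ramified:
  assumes "prime q" "\<not> q dvd a2" "q dvd d1" "q dvd d3" "\<not> q^2 dvd d1" "\<not> q^2 dvd d3" "\<not> q dvd d2"
  shows "\<not> loc_sol q a1 a2 a3 d1 d2 d3"
proof
  assume "loc_sol q a1 a2 a3 d1 d2 d3"
  then obtain t u1 u2 u3 where nd: "primitive q t u1 u2 u3"
    and eq: "cov_eqs (q^2) a1 a2 a3 d1 d2 d3 t u1 u2 u3" unfolding loc_sol_def by blast
  have eq1: "cov_eqs q a1 a2 a3 d1 d2 d3 t u1 u2 u3" by (rule cov_eqs_dvd[OF eq]) simp
  have h: "q dvd d3 * u3^2" "q dvd d1 * u1^2" using assms(3,4) by (simp_all add: dvd_mult2)
  have "q dvd (a2 * t^2 + d3 * u3^2 - d1 * u1^2) - d3 * u3^2 + d1 * u1^2"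
    using eq1 h unfolding cov_eqs_def by (meson dvd_diff dvd_add)
  hence "q dvd a2 * t^2" by simp
  hence t: "q dvd t" using prime_dvd_square_mult assms by blast
  have "q dvd a1 * t^2" using t by (rule dvd_mult_square)
  hence "q dvd (a1 * t^2 + d2 * u2^2 - d3 * u3^2) - a1 * t^2 + d3 * u3^2"
    using eq1 h unfolding cov_eqs_def by (meson dvd_diff dvd_add)
  hence "q dvd d2 * u2^2" by simp
  hence u2: "q dvd u2" using prime_dvd_square_mult assms by blast
  have sq: "q^2 dvd a1 * t^2" "q^2 dvd a3 * t^2" "q^2 dvd d2 * u2^2" using t u2 by (simp_all add: dvd_mult)
  note s3 = cov_eqs_dvd_terms[OF eq sq]
  have "q dvd u3" "q dvd u1" using prime_square_dvd_mult[OF assms(1)] s3 assms by blast+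
  thus False using nd t u2 by blast
qed

text \<open>Units that are residues are squares modulo every power of \<open>q\<close> and can be
  absorbed into the coordinates. This leads from the twist by \<open>n\<close> back to the untwisted
  curve.\<close>

lemma loc_sol_square_twist:
  assumes "prime q" "2 < q" "Legendre n q = 1" "Legendre g1 q = 1" "Legendre g2 q = 1" "Legendre g3 q = 1"
    and "loc_sol q (a1 * n) (a2 * n) (a3 * n) (g1 * d1) (g2 * d2) (g3 * d3)"
  shows "loc_sol q a1 a2 a3 d1 d2 d3"
  unfolding loc_sol_def
proof
  fix N
  have ex: "\<exists>u. \<not> q dvd u \<and> [u^2 = g] (mod q^N)" if g: "Legendre g q = 1" for g
    using lift_sqrt[OF assms(1,2), of 1 g N] g by auto
  obtain v where v: "\<not> q dvd v" "[v^2 = n] (mod q^N)" using ex assms by blast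
  obtain w1 where w1: "\<not> q dvd w1" "[w1^2 = g1] (mod q^N)" using ex assms by blast
  obtain w2 where w2: "\<not> q dvd w2" "[w2^2 = g2] (mod q^N)" using ex assms by blast
  obtain w3 where w3: "\<not> q dvd w3" "[w3^2 = g3] (mod q^N)" using ex assms by blast
  obtain t u1 u2 u3 where nd: "primitive q t u1 u2 u3"
    and eq: "cov_eqs (q^N) (a1 * n) (a2 * n) (a3 * n) (g1 * d1) (g2 * d2) (g3 * d3) t u1 u2 u3"
    using assms(7) unfolding loc_sol_def by blast
  have tr: "q^N dvd x * (v * t)^2 + y * (r * i)^2 - z * (s * j)^2"
    if "q^N dvd x * n * t^2 + g * y * i^2 - h * z * j^2" "[r^2 = g] (mod q^N)" "[s^2 = h] (mod q^N)"
    for x y z r s g h i j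
  proof -
    have "[x * v^2 * t^2 + r^2 * y * i^2 - s^2 * z * j^2 = x * n * t^2 + g * y * i^2 - h * z * j^2] (mod q^N)"
      by (intro cong_add cong_diff cong_mult cong_refl v that)
    moreover have "x * v^2 * t^2 + r^2 * y * i^2 - s^2 * z * j^2 = x * (v * t)^2 + y * (r * i)^2 - z * (s * j)^2"
      by (simp add: power_mult_distrib mult_ac)
    ultimately show ?thesis using that(1) cong_dvd_iff by metis
  qed
  have "cov_eqs (q^N) a1 a2 a3 d1 d2 d3 (v * t) (w1 * u1) (w2 * u2) (w3 * u3)"
    using eq w1 w2 w3 unfolding cov_eqs_def by (blast intro: tr)
  moreover have "\<not> (q dvd v * t \<and> q dvd w1 * u1 \<and> q dvd w2 * u2 \<and> q dvd w3 * u3)"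
    using nd v w1 w2 w3 assms(1) by (simp add: prime_dvd_mult_iff)
  ultimately show "primitive_sol q (q^N) a1 a2 a3 d1 d2 d3" by blast
qed

text \<open>\<open>-1\<close> is a norm for the square root of any unit \<open>c\<close>. A solution
  modulo \<open>q\<close> comes from counting, and it is lifted in whichever variable is a
  unit.\<close>

lemma norm_minus_one:
  fixes q :: int
  assumes "prime q" "2 < q" "\<not> q dvd c"
  obtains r s where "[r^2 - c * s^2 = -1] (mod q^N)"
proof -
  have "\<not> q dvd 1" "\<not> q dvd - c" using assms by auto
  from binary_form_surj_mod[OF assms(1,2) this] obtain r s where rs: "[1 * r^2 + - c * s^2 = -1] (mod q)" .
  have lift: "\<exists>u. [d * u^2 = w] (mod q^N)" if "[d * x^2 = w] (mod q)" "\<not> q dvd x" "\<not> q dvd d" for d x w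
  proof -
    have "q dvd d * x^2 - w * 1^2" using that(1) by (simp add: cong_iff_dvd_diff)
    moreover have "\<not> q dvd w"
      using cong_dvd_iff[OF that(1)] that(2,3) assms(1) by (metis prime_dvd_square_mult)
    ultimately have "Legendre (d * w) q = 1"
      using Legendre_1_of_cong_squares[OF assms(1), of d x w 1] that by blast
    thus ?thesis using lift_sqrt[OF assms(1,2)] by blast
  qed
  show ?thesis
  proof (cases "q dvd r")
    case False
    have "[1 * r^2 = c * s^2 - 1] (mod q)" using rs by (simp add: cong_iff_dvd_diff algebra_simps)
    then obtain u where "[1 * u^2 = c * s^2 - 1] (mod q^N)" using lift False \<open>\<not> q dvd 1\<close> by blast
    hence "[u^2 - c * s^2 = -1] (mod q^N)" by (simp add: cong_iff_dvd_diff algebra_simps)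
    thus ?thesis by (rule that)
  next
    case True
    have s: "\<not> q dvd s"
    proof
      assume "q dvd s"
      hence "q dvd 1 * r^2 + - c * s^2" using True by (intro dvd_add dvd_mult_square)
      hence "q dvd -1" using cong_dvd_iff[OF rs] by blast
      thus False using assms(2) by auto
    qed
    have "q dvd - (1 * r^2 + - c * s^2 - -1)" using rs by (simp only: cong_iff_dvd_diff dvd_minus_iff)
    hence "[c * s^2 = r^2 + 1] (mod q)" by (simp add: cong_iff_dvd_diff algebra_simps)
    then obtain u where u: "[c * u^2 = r^2 + 1] (mod q^N)" using lift s assms(3) by blast
    have "q^N dvd - (c * u^2 - (r^2 + 1))" using u by (simp only: cong_iff_dvd_diff dvd_minus_iff)
    hence "[r^2 - c * u^2 = -1] (mod q^N)" by (simp add: cong_iff_dvd_diff algebra_simps)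
    thus ?thesis by (rule that)
  qed
qed

text \<open>The binary form \<open>a x\<^sup>2 - b y\<^sup>2\<close> with unit coefficients is similar to its negative, through
  multiplication by an element of norm \<open>-1\<close>; the remaining coordinate is then found by lifting.\<close>
lemma loc_sol_neg_twist_aux:
  assumes "prime q" "2 < q" "a1 + a2 + a3 = 0" "\<not> q dvd a" "\<not> q dvd b" "Legendre (- a1 * d2) q = 1"
    and sol: "\<And>N. \<exists>t u1 u2 u3. \<not> q dvd t \<and> q dvd f * u1 \<and> q dvd f * u3 \<and>
      cov_eqs (q^N) a1 a2 a3 (f * a) d2 (f * b) t u1 u2 u3"
  shows "loc_sol q a1 a2 a3 (- (f * a)) d2 (- (f * b))"
  unfolding loc_sol_def
proof
  fix N
  obtain t u1 u2 u3 where t: "\<not> q dvd t" and f: "q dvd f * u1" "q dvd f * u3"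
    and eq: "cov_eqs (q^N) a1 a2 a3 (f * a) d2 (f * b) t u1 u2 u3" using sol by blast
  have "\<not> q dvd a * b" using assms by (simp add: prime_dvd_mult_iff)
  then obtain r s where rs: "[r^2 - a * b * s^2 = -1] (mod q^N)" using norm_minus_one[OF assms(1,2)] by blast
  \<comment> \<open>These are the coefficients in \<open>(r + s sqrt(a b)) (a u1 + sqrt(a b) u3) = a
    v1 + sqrt(a b) v3\<close>, where the first factor has norm -1.\<close>
  define v1 where "v1 = r * u1 + b * s * u3"
  define v3 where "v3 = a * s * u1 + r * u3"
  have id: "a * v1^2 - b * v3^2 = (r^2 - a * b * s^2) * (a * u1^2 - b * u3^2)"
    unfolding v1_def v3_def by (simp add: power2_eq_square algebra_simps)
  have "[(r^2 - a * b * s^2) * (a * u1^2 - b * u3^2) = -1 * (a * u1^2 - b * u3^2)] (mod q^N)"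
    by (rule cong_mult[OF rs cong_refl])
  hence "[a * v1^2 - b * v3^2 = -1 * (a * u1^2 - b * u3^2)] (mod q^N)" unfolding id .
  hence "[f * (a * v1^2 - b * v3^2) = f * (-1 * (a * u1^2 - b * u3^2))] (mod q^N)" by (rule cong_mult[OF cong_refl])
  hence e1: "[f * a * v1^2 - f * b * v3^2 = f * b * u3^2 - f * a * u1^2] (mod q^N)" by (simp add: algebra_simps)
  have e2: "[f * b * u3^2 - f * a * u1^2 = - (a2 * t^2)] (mod q^N)"
    using eq unfolding cov_eqs_def cong_iff_dvd_diff by (simp add: algebra_simps)
  have e3: "q^N dvd f * a * v1^2 - f * b * v3^2 - (- (a2 * t^2))"
    using cong_trans[OF e1 e2] unfolding cong_iff_dvd_diff .
  have "f * v3 = a * s * (f * u1) + r * (f * u3)" by (simp add: v3_def algebra_simps)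
  hence fv: "q dvd f * v3" using f by (metis dvd_add dvd_mult)
  \<comment> \<open>In the applications \<open>f\<close> is \<open>q\<close> if \<open>q\<close>
    divides \<open>d1\<close> and \<open>d3\<close>, and 1 if instead \<open>u1\<close> and
    \<open>u3\<close> are divisible by \<open>q\<close>. Either way \<open>f * v3\<close> vanishes
    modulo \<open>q\<close>, so the value \<open>w\<close> required of \<open>d2 * v2^2\<close> is
    congruent to \<open>- a1 * t^2\<close> and can be lifted.\<close>
  define w where "w = - (f * b) * v3^2 - a1 * t^2"
  have "q dvd (f * v3) * (b * v3)" using fv by (rule dvd_mult2)
  moreover have "w - - a1 * t^2 = - ((f * v3) * (b * v3))" by (simp add: w_def power2_eq_square algebra_simps)
  ultimately have "[w = - a1 * t^2] (mod q)" unfolding cong_iff_dvd_diff by (simp only: dvd_minus_iff)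
  hence "[d2 * w = d2 * (- a1 * t^2)] (mod q)" by (rule cong_mult[OF cong_refl])
  hence "Legendre (d2 * w) q = Legendre (d2 * (- a1 * t^2)) q" by (rule Legendre_cong)
  also have "d2 * (- a1 * t^2) = (- a1 * d2) * t^2" by simp
  also have "Legendre ((- a1 * d2) * t^2) q = 1"
    unfolding Legendre_mult[OF assms(1,2), of _ "t^2"] assms(6) Legendre_square[OF t assms(1)] by simp
  finally have L: "Legendre (d2 * w) q = 1" .
  obtain v2 where v2: "[d2 * v2^2 = w] (mod q^N)" by (rule lift_sqrt[OF assms(1,2) L])
  have 1: "q^N dvd - (d2 * v2^2 - w)" using v2 by (simp only: cong_iff_dvd_diff dvd_minus_iff)
  have 2: "q^N dvd - (f * a * v1^2 - f * b * v3^2 - (- (a2 * t^2)))" using e3 by (simp only: dvd_minus_iff)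
  have "- (d2 * v2^2 - w) = - (f * b) * v3^2 - (a1 * t^2 + d2 * v2^2)"
    "- (f * a * v1^2 - f * b * v3^2 - (- (a2 * t^2))) = - (f * a) * v1^2 - (a2 * t^2 + - (f * b) * v3^2)"
    by (simp_all add: w_def algebra_simps)
  hence "cov_eqs (q^N) a1 a2 a3 (- (f * a)) d2 (- (f * b)) t v1 v2 v3"
    using 1 2 by (intro cov_eqsI[OF assms(3)]) (simp_all only: cong_iff_dvd_diff)
  thus "primitive_sol q (q^N) a1 a2 a3 (- (f * a)) d2 (- (f * b))" using t by blast
qed

lemma multiplicity_mult_int:
  "prime (q::int) \<Longrightarrow> a \<noteq> 0 \<Longrightarrow> b \<noteq> 0 \<Longrightarrow> multiplicity q (a * b) = multiplicity q a + multiplicity q b"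
  by (rule prime_elem_multiplicity_mult_distrib[OF prime_imp_prime_elem])

lemma multiplicity_square_int:
  "prime (q::int) \<Longrightarrow> a \<noteq> 0 \<Longrightarrow> multiplicity q (a^2) = 2 * multiplicity q a"
  by (simp add: power2_eq_square multiplicity_mult_int)

text \<open>The three valuations are 0 or 1 and have an even sum.\<close>

lemma square_product_dvd_pattern:
  fixes q :: int
  assumes "prime q" "d1 * d2 * d3 = s^2" "d1 \<noteq> 0" "d2 \<noteq> 0" "d3 \<noteq> 0"
    and "\<not> q^2 dvd d1" "\<not> q^2 dvd d2" "\<not> q^2 dvd d3"
  shows "q dvd d1 \<longleftrightarrow> (q dvd d2) \<noteq> (q dvd d3)"
proof -
  have s0: "s \<noteq> 0" using assms by auto
  have m: "multiplicity q d = (if q dvd d then 1 else 0)" if "\<not> q^2 dvd d" for d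
    using that by (auto intro!: multiplicity_eqI simp: not_dvd_imp_multiplicity_0 power2_eq_square)
  have "multiplicity q (d1 * d2 * d3) = multiplicity q d1 + multiplicity q d2 + multiplicity q d3"
    using assms(1,3-5) by (simp add: multiplicity_mult_int)
  moreover have "multiplicity q (s^2) = 2 * multiplicity q s"
    using assms(1) s0 by (rule multiplicity_square_int)
  ultimately have "multiplicity q d1 + multiplicity q d2 + multiplicity q d3 = 2 * multiplicity q s"
    using assms(2) by simp
  hence "even (multiplicity q d1 + multiplicity q d2 + multiplicity q d3)" by presburger
  thus ?thesis using m assms(6-8) by (auto split: if_splits)
qed

text \<open>Meant for the primes of \<open>e2\<close> alone, where \<open>-1\<close> may be a
  nonresidue and the condition on \<open>p*\<close> does not reach. Solubility excludes that
  \<open>q\<close> divides \<open>d2\<close>, so \<open>d1\<close> and \<open>d3\<close> are both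
  divisible by \<open>q\<close> or both units.\<close>

lemma loc_sol_neg_twist:
  assumes "prime q" "2 < q" "a1 + a2 + a3 = 0" "\<not> q dvd a1" "q dvd a2" "\<not> q dvd a3"
    and nz: "d1 \<noteq> 0" "d2 \<noteq> 0" "d3 \<noteq> 0" and sqf: "\<not> q^2 dvd d1" "\<not> q^2 dvd d2" "\<not> q^2 dvd d3"
    and s: "d1 * d2 * d3 = s^2" and sol: "loc_sol q a1 a2 a3 d1 d2 d3"
  shows "loc_sol q a1 a2 a3 (- d1) d2 (- d3)"
proof -
  note pat = square_product_dvd_pattern[OF assms(1) s nz sqf]
  have d2: "\<not> q dvd d2"
  proof
    assume h: "q dvd d2"
    show False
    proof (cases "q dvd d1")
      case True
      hence "\<not> q dvd d3" using pat h by blast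
      hence "\<not> loc_sol q a2 a3 a1 d2 d3 d1" using not_loc_sol_ramified assms h True by blast
      thus False using sol by (simp add: loc_sol_rotate_iff)
    next
      case False
      hence "q dvd d3" using pat h by blast
      hence "\<not> loc_sol q a3 a1 a2 d3 d1 d2" using not_loc_sol_ramified assms h False by blast
      thus False using sol loc_sol_rotate by blast
    qed
  qed
  have L: "Legendre (- a1 * d2) q = 1" if "q dvd d3 * u3^2" "\<not> q dvd t"
    "cov_eqs q a1 a2 a3 d1 d2 d3 t u1 u2 u3" for t u1 u2 u3
  proof -
    have "q dvd (a1 * t^2 + d2 * u2^2 - d3 * u3^2) + d3 * u3^2"
      using that unfolding cov_eqs_def by (blast intro: dvd_add)
    hence "q dvd - (a1 * t^2 + d2 * u2^2)" by (simp only: dvd_minus_iff diff_add_cancel)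
    hence c: "q dvd (- a1) * t^2 - d2 * u2^2" by simp
    show ?thesis by (rule Legendre_1_of_cong_squares[OF assms(1) c that(2)]) (use assms(4) d2 in auto)
  qed
  have tu: "q dvd u2" if "q dvd d3 * u3^2" "q dvd t" "cov_eqs q a1 a2 a3 d1 d2 d3 t u1 u2 u3" for t u1 u2 u3
  proof -
    have "q dvd (a1 * t^2 + d2 * u2^2 - d3 * u3^2) + d3 * u3^2 - a1 * t^2"
      using that unfolding cov_eqs_def by (blast intro: dvd_add dvd_diff dvd_mult_square)
    hence "q dvd d2 * u2^2" by simp
    thus ?thesis using prime_dvd_square_mult assms(1) d2 by blast
  qed
  have get: "\<exists>t u1 u2 u3. primitive q t u1 u2 u3 \<and> cov_eqs (q^N) a1 a2 a3 d1 d2 d3 t u1 u2 u3 \<and> cov_eqs (q^2) a1 a2 a3 d1 d2 d3 t u1 u2 u3 \<and>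
     cov_eqs q a1 a2 a3 d1 d2 d3 t u1 u2 u3" for N
  proof -
    obtain t u1 u2 u3 where "primitive q t u1 u2 u3"
      "cov_eqs (q^(N + 2)) a1 a2 a3 d1 d2 d3 t u1 u2 u3" using sol unfolding loc_sol_def by blast
    moreover have "q^N dvd q^(N + 2)" "q^2 dvd q^(N + 2)" "q dvd q^(N + 2)"
      by (simp_all only: le_imp_power_dvd le_add1 le_add2) (simp add: dvd_power)
    ultimately show ?thesis using cov_eqs_dvd by blast
  qed
  show ?thesis
  proof (cases "q dvd d1")
    case True
    hence d3: "q dvd d3" using pat d2 by blast
    have sol': "\<exists>t u1 u2 u3. \<not> q dvd t \<and> cov_eqs (q^N) a1 a2 a3 d1 d2 d3 t u1 u2 u3 \<and>
      cov_eqs q a1 a2 a3 d1 d2 d3 t u1 u2 u3" for N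
    proof -
      obtain t u1 u2 u3 where nd: "primitive q t u1 u2 u3"
        and eq: "cov_eqs (q^N) a1 a2 a3 d1 d2 d3 t u1 u2 u3" "cov_eqs (q^2) a1 a2 a3 d1 d2 d3 t u1 u2 u3"
        "cov_eqs q a1 a2 a3 d1 d2 d3 t u1 u2 u3" using get by blast
      have "\<not> q dvd t"
      proof
        assume t: "q dvd t"
        have u2: "q dvd u2" by (rule tu[OF _ t eq(3)]) (use d3 in simp)
        have sq: "q^2 dvd a1 * t^2" "q^2 dvd a3 * t^2" "q^2 dvd d2 * u2^2" using t u2 by (simp_all add: dvd_mult)
        note s3 = cov_eqs_dvd_terms[OF eq(2) sq]
        have "q dvd u3" "q dvd u1" using prime_square_dvd_mult[OF assms(1)] s3 sqf by blast+
        thus False using nd t u2 by blast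
      qed
      thus ?thesis using eq by blast
    qed
    obtain a b where ab: "d1 = q * a" "d3 = q * b" using True d3 by (auto elim!: dvdE)
    have nab: "\<not> q dvd a" "\<not> q dvd b" using sqf ab by (auto simp: power2_eq_square)
    have L1: "Legendre (- a1 * d2) q = 1" using sol'[of 1] L d3 by (metis dvd_mult2)
    have "loc_sol q a1 a2 a3 (- (q * a)) d2 (- (q * b))"
    proof (rule loc_sol_neg_twist_aux[OF assms(1-3) nab L1])
      fix N
      show "\<exists>t u1 u2 u3. \<not> q dvd t \<and> q dvd q * u1 \<and> q dvd q * u3 \<and>
        cov_eqs (q^N) a1 a2 a3 (q * a) d2 (q * b) t u1 u2 u3"
        using sol'[of N] unfolding ab by (meson dvd_triv_left)
    qed
    thus ?thesis by (simp add: ab)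
  next
    case False
    hence d3: "\<not> q dvd d3" using pat d2 by blast
    show ?thesis
    \<comment> \<open>A residue \<open>d1 * d3\<close> stays one when both signs change, and the
      conic argument applies. Otherwise \<open>d3 u3^2 - d1 u1^2\<close> is anisotropic modulo
      \<open>q\<close>, so \<open>q\<close> divides \<open>u1\<close> and \<open>u3\<close>.\<close>
    proof (cases "Legendre (d1 * d3) q = 1")
      case True
      show ?thesis by (rule loc_sol_conic[OF assms(1-5) d2]) (use True in simp)
    next
      case nsq: False
      have sol': "\<exists>t u1 u2 u3. \<not> q dvd t \<and> q dvd 1 * u1 \<and> q dvd 1 * u3 \<and>
        cov_eqs (q^N) a1 a2 a3 (1 * d1) d2 (1 * d3) t u1 u2 u3 \<and>
        cov_eqs q a1 a2 a3 d1 d2 d3 t u1 u2 u3" for N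
      proof -
        obtain t u1 u2 u3 where nd: "primitive q t u1 u2 u3"
          and eq: "cov_eqs (q^N) a1 a2 a3 d1 d2 d3 t u1 u2 u3" "cov_eqs (q^2) a1 a2 a3 d1 d2 d3 t u1 u2 u3"
          "cov_eqs q a1 a2 a3 d1 d2 d3 t u1 u2 u3" using get by blast
        have "q dvd (a2 * t^2 + d3 * u3^2 - d1 * u1^2) - a2 * t^2"
          using eq(3) assms(5) unfolding cov_eqs_def by (meson dvd_diff dvd_mult2)
        hence c: "q dvd d3 * u3^2 - d1 * u1^2" by simp
        have u3: "q dvd u3"
          using Legendre_1_of_cong_squares[OF assms(1) c] False d3 nsq by (auto simp: mult.commute)
        have "q dvd d1 * u1^2" using c dvd_mult_square[OF u3, of d3] by (simp add: dvd_diff_right_iff)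
        hence u1: "q dvd u1" using prime_dvd_square_mult assms(1) False by blast
        have "\<not> q dvd t" using tu[OF dvd_mult_square[OF u3] _ eq(3)] nd u1 u3 by blast
        thus ?thesis using eq u1 u3 by auto
      qed
      have L1: "Legendre (- a1 * d2) q = 1" using sol'[of 1] L dvd_mult_square by (metis mult_1)
      have "loc_sol q a1 a2 a3 (- (1 * d1)) d2 (- (1 * d3))"
        by (rule loc_sol_neg_twist_aux[OF assms(1-3) False d3 L1]) (use sol' in blast)
      thus ?thesis by simp
    qed
  qed
qed

subsection \<open>Hilbert symbols and the product formula\<close>

definition unit_part :: "int \<Rightarrow> int \<Rightarrow> int" where
  "unit_part q a = a div q ^ multiplicity q a"

text \<open>The closed formula for the Hilbert symbol at an odd prime: multiplicativity is read off
  from it, and \<open>hilbert_of_isotropic\<close> supplies the link with solubility.\<close>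

definition hilbert :: "int \<Rightarrow> int \<Rightarrow> int \<Rightarrow> int" where
  "hilbert q a b = Legendre (-1) q ^ (multiplicity q a * multiplicity q b) *
     Legendre (unit_part q a) q ^ multiplicity q b * Legendre (unit_part q b) q ^ multiplicity q a"

lemma multiplicity_power_times_unit:
  assumes "prime (q::int)" "\<not> q dvd a"
  shows "multiplicity q (q^i * a) = i"
  using assms by (intro multiplicity_eqI) (auto simp: prime_gt_0_int)

lemma unit_part_power_times_unit:
  assumes "prime (q::int)" "\<not> q dvd a"
  shows "unit_part q (q^i * a) = a"
  using assms by (auto simp: unit_part_def multiplicity_power_times_unit)

lemma hilbert_eq:
  assumes "prime q" "\<not> q dvd a" "\<not> q dvd b"
  shows "hilbert q (q^i * a) (q^j * b) = Legendre (-1) q ^ (i * j) * Legendre a q ^ j * Legendre b q ^ i"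
  using assms by (simp add: hilbert_def multiplicity_power_times_unit unit_part_power_times_unit)

lemma prime_power_decompose:
  assumes "prime (q::int)" "a \<noteq> 0"
  obtains i c where "a = q^i * c" "\<not> q dvd c"
  using assms multiplicity_decompose'[of a q] by (metis not_prime_unit)

lemma hilbert_commute: "hilbert q a b = hilbert q b a"
  by (simp add: hilbert_def mult_ac)

lemma hilbert_mult_left:
  assumes "prime q" "2 < q" "a \<noteq> 0" "a' \<noteq> 0" "b \<noteq> 0"
  shows "hilbert q (a * a') b = hilbert q a b * hilbert q a' b"
proof -
  obtain i c where c: "a = q^i * c" "\<not> q dvd c" using prime_power_decompose assms by blast
  obtain i' c' where c': "a' = q^i' * c'" "\<not> q dvd c'" using prime_power_decompose assms by blast
  obtain j d where d: "b = q^j * d" "\<not> q dvd d" using prime_power_decompose assms by blast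
  have e: "a * a' = q^(i + i') * (c * c')" using c c' by (simp add: power_add)
  have n: "\<not> q dvd c * c'" using c c' assms by (simp add: prime_dvd_mult_iff)
  show ?thesis unfolding e d(1) hilbert_eq[OF assms(1) n d(2)]
    unfolding c(1) c'(1) hilbert_eq[OF assms(1) c(2) d(2)] hilbert_eq[OF assms(1) c'(2) d(2)]
    by (simp add: Legendre_mult[OF assms(1,2)] power_add power_mult_distrib algebra_simps)
qed

lemma hilbert_mult_right:
  assumes "prime q" "2 < q" "a \<noteq> 0" "b \<noteq> 0" "b' \<noteq> 0"
  shows "hilbert q a (b * b') = hilbert q a b * hilbert q a b'"
  using hilbert_mult_left[of q b b' a] assms by (simp add: hilbert_commute[of q a])

lemma pm_one_power:
  fixes x :: int
  assumes "x = 1 \<or> x = -1"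
  shows "x ^ n = 1 \<or> x ^ n = -1"
  using assms by (cases "even n") auto

lemma Legendre_unit: "\<not> q dvd a \<Longrightarrow> Legendre a q = 1 \<or> Legendre a q = -1"
  using Legendre_values[of a q] Legendre_eq_0_iff[of a q] by auto

lemma hilbert_values:
  assumes "prime q" "a \<noteq> 0" "b \<noteq> 0"
  shows "hilbert q a b = 1 \<or> hilbert q a b = -1"
proof -
  obtain i c where c: "a = q^i * c" "\<not> q dvd c" using prime_power_decompose assms by blast
  obtain j d where d: "b = q^j * d" "\<not> q dvd d" using prime_power_decompose assms by blast
  have "\<not> q dvd -1" using assms(1) by auto
  hence "Legendre (-1) q ^ (i * j) = 1 \<or> Legendre (-1) q ^ (i * j) = -1"
    "Legendre c q ^ j = 1 \<or> Legendre c q ^ j = -1" "Legendre d q ^ i = 1 \<or> Legendre d q ^ i = -1"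
    using Legendre_unit pm_one_power c d by blast+
  thus ?thesis unfolding c(1) d(1) hilbert_eq[OF assms(1) c(2) d(2)] by auto
qed

lemma hilbert_mult_self:
  assumes "prime q" "a \<noteq> 0" "b \<noteq> 0"
  shows "hilbert q a b * hilbert q a b = 1"
  using hilbert_values[OF assms] by auto

lemma hilbert_square_right:
  assumes "prime q" "2 < q" "a \<noteq> 0" "b \<noteq> 0"
  shows "hilbert q a (b^2) = 1"
  using hilbert_mult_right[of q a b b] hilbert_mult_self[of q a b] assms by (simp add: power2_eq_square)

lemma hilbert_unit_left:
  assumes "prime q" "\<not> q dvd a" "\<not> q dvd b"
  shows "hilbert q a (q^j * b) = Legendre a q ^ j"
  using hilbert_eq[OF assms, of 0 j] by simp

lemma hilbert_units:
  assumes "prime q" "\<not> q dvd a" "\<not> q dvd b"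
  shows "hilbert q a b = 1"
  using hilbert_unit_left[OF assms, of 0] by simp

lemma hilbert_neg_self:
  assumes "prime q" "2 < q" "a \<noteq> 0"
  shows "hilbert q a (- a) = 1"
proof -
  obtain i c where c: "a = q^i * c" "\<not> q dvd c" using prime_power_decompose assms by blast
  have m: "- a = q^i * (- c)" "\<not> q dvd - c" using c by simp_all
  have n: "\<not> q dvd -1" using assms(1) by auto
  have l: "Legendre (- c) q = Legendre (-1) q * Legendre c q" using Legendre_mult[OF assms(1,2), of "-1" c] by simp
  have "hilbert q a (- a) = Legendre (-1) q ^ (i * i + i) * (Legendre c q * Legendre c q) ^ i"
    unfolding m(1) unfolding c(1) hilbert_eq[OF assms(1) c(2) m(2)] l
    by (simp add: power_add power_mult_distrib mult_ac)
  also have "\<dots> = Legendre (-1) q ^ (i * i + i)" using Legendre_mult_self[OF assms(1,2) c(2)] by simp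
  also have "\<dots> = 1" using Legendre_unit[OF n] by auto
  finally show ?thesis .
qed

text \<open>Continuity of the symbol: a summand of larger valuation changes neither the valuation of
  \<open>c\<close> nor its unit part modulo \<open>q\<close>. This lets approximate solutions
  replace exact ones over the \<open>q\<close>-adic numbers.\<close>

lemma hilbert_perturb:
  assumes "prime q" "c \<noteq> 0" "q ^ Suc (multiplicity q c) dvd k"
  shows "c + k \<noteq> 0 \<and> hilbert q a (c + k) = hilbert q a c"
proof -
  obtain i d where d: "c = q^i * d" "\<not> q dvd d" using prime_power_decompose assms by blast
  have "multiplicity q c = i" using d multiplicity_power_times_unit assms(1) by blast
  then obtain l where l: "k = q^Suc i * l" using assms(3) by (auto elim!: dvdE)
  have e: "c + k = q^i * (d + q * l)" using d l by (simp add: algebra_simps)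
  have n: "\<not> q dvd d + q * l" using d by (simp add: dvd_add_left_iff)
  have "[d + q * l = d] (mod q)" by (simp add: cong_iff_dvd_diff)
  hence L: "Legendre (d + q * l) q = Legendre d q" by (rule Legendre_cong)
  have "c + k \<noteq> 0" using e n assms(1) by auto
  thus ?thesis unfolding hilbert_def e using d assms(1) n L
    by (simp add: multiplicity_power_times_unit unit_part_power_times_unit)
qed

text \<open>If \<open>z^2\<close> and \<open>a x^2\<close> have different valuations, the dominant
  term decides, and it is a square or \<open>- a\<close> times a square. If the valuations agree,
  that of \<open>a\<close> is even, and only the symbol of its unit part \<open>c\<close>
  matters.\<close>

lemma hilbert_norm:
  assumes "prime q" "2 < q" "a \<noteq> 0" "z^2 - a * x^2 \<noteq> 0"
  shows "hilbert q a (z^2 - a * x^2) = 1"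
proof (cases "x = 0 \<or> z = 0")
  case True
  thus ?thesis
  proof
    assume "x = 0"
    thus ?thesis using assms hilbert_square_right by simp
  next
    assume z: "z = 0"
    hence "x \<noteq> 0" using assms by auto
    hence "hilbert q a (- a * x^2) = 1"
      using hilbert_mult_right[of q a "- a" "x^2"] hilbert_square_right hilbert_neg_self assms by simp
    thus ?thesis using z by simp
  qed
next
  case False
  hence xz: "x \<noteq> 0" "z \<noteq> 0" by auto
  obtain i c where c: "a = q^i * c" "\<not> q dvd c" using prime_power_decompose assms by blast
  obtain j y where y: "x = q^j * y" "\<not> q dvd y" using prime_power_decompose assms xz by blast
  obtain k w where w: "z = q^k * w" "\<not> q dvd w" using prime_power_decompose assms xz by blast
  have z2: "z^2 = q^(2 * k) * w^2" using w by (simp add: power_mult_distrib power_mult[symmetric] mult.commute)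
  have x2: "a * x^2 = q^(i + 2 * j) * (c * y^2)" using c y
    by (simp add: power_mult_distrib power_mult[symmetric] mult_ac power_add)
  have nw: "\<not> q dvd w^2" "\<not> q dvd c * y^2" using c y w assms(1) by (simp_all add: prime_dvd_mult_iff prime_dvd_power_iff)
  have mz: "multiplicity q (z^2) = 2 * k" and mx: "multiplicity q (- (a * x^2)) = i + 2 * j"
    using z2 x2 nw assms(1) multiplicity_power_times_unit by (metis, metis multiplicity_uminus_right)
  consider "2 * k < i + 2 * j" | "i + 2 * j < 2 * k" | "2 * k = i + 2 * j" by linarith
  thus ?thesis
  proof cases
    case 1
    have "q ^ Suc (multiplicity q (z^2)) dvd - (a * x^2)"
      unfolding mz x2 dvd_minus_iff using 1 by (intro dvd_mult2 le_imp_power_dvd) simp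
    from hilbert_perturb[OF assms(1) _ this] xz assms show ?thesis
      using hilbert_square_right[of q a z] by (metis diff_conv_add_uminus power_not_zero)
  next
    case 2
    have "q ^ Suc (multiplicity q (- (a * x^2))) dvd z^2"
      unfolding mx z2 using 2 by (intro dvd_mult2 le_imp_power_dvd) simp
    from hilbert_perturb[OF assms(1) _ this] xz assms
    have "hilbert q a (- (a * x^2) + z^2) = hilbert q a (- a * x^2)" by simp
    also have "\<dots> = 1"
      using hilbert_mult_right[of q a "- a" "x^2"] hilbert_square_right hilbert_neg_self assms xz by simp
    finally show ?thesis by (simp add: add.commute)
  next
    case 3
    define v where "v = w^2 - c * y^2"
    have e: "z^2 - a * x^2 = q^(2 * k) * v" unfolding z2 x2 3[symmetric] v_def by (simp add: algebra_simps)
    have "v \<noteq> 0" using assms e by auto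
    then obtain l d where d: "v = q^l * d" "\<not> q dvd d" using prime_power_decompose assms by blast
    have ev: "even i" using 3 by presburger
    have n1: "\<not> q dvd -1" using assms(1) by auto
    have one: "Legendre (-1) q ^ (i * (2 * k + l)) = 1" "Legendre d q ^ i = 1"
      using Legendre_unit[OF n1] Legendre_unit[OF d(2)] ev by auto
    have e': "z^2 - a * x^2 = q^(2 * k + l) * d" using e d(1) by (simp add: power_add)
    have "hilbert q a (z^2 - a * x^2) = Legendre c q ^ (2 * k + l)"
      unfolding e' using hilbert_eq[OF assms(1) c(2) d(2), of i "2 * k + l"] one c(1) by simp
    also have "\<dots> = Legendre c q ^ l" using Legendre_unit[OF c(2)] by (auto simp: power_add power_mult)
    also have "\<dots> = 1"
    \<comment> \<open>Cancellation, that is \<open>l > 0\<close>, means that \<open>c y^2\<close> is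
      congruent to \<open>w^2\<close>, so \<open>c\<close> is a residue.\<close>
    proof (cases "l = 0")
      case False
      hence "q dvd v" using d by simp
      hence "q dvd - v" by simp
      hence "q dvd c * y^2 - 1 * w^2" by (simp add: v_def)
      hence "Legendre (c * 1) q = 1"
        by (rule Legendre_1_of_cong_squares[OF assms(1) _ y(2) c(2)]) (use assms in auto)
      thus ?thesis by simp
    qed simp
    finally show ?thesis .
  qed
qed

lemma power_dvd_of_mult_square:
  assumes "prime (q::int)" "b \<noteq> 0" "q ^ (2 * K + multiplicity q b) dvd b * y^2"
  shows "q ^ K dvd y"
proof (cases "y = 0")
  case False
  have "multiplicity q (b * y^2) = multiplicity q b + 2 * multiplicity q y"
    using assms(1,2) False by (simp add: multiplicity_mult_int multiplicity_square_int)
  moreover have "2 * K + multiplicity q b \<le> multiplicity q (b * y^2)"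
    using assms False by (intro multiplicity_geI) (auto simp: not_prime_unit)
  ultimately have "K \<le> multiplicity q y" by simp
  thus ?thesis by (rule multiplicity_dvd')
qed simp

text \<open>The terms visible modulo \<open>q^N\<close> decide: either \<open>b y^2\<close> is a
  perturbation of the norm \<open>z^2 - a x^2\<close>, or it is negligible and \<open>a x^2\<close>
  is a perturbation of \<open>z^2\<close>.\<close>

lemma hilbert_of_isotropic:
  assumes "prime q" "2 < q" "a \<noteq> 0" "b \<noteq> 0"
    and sol: "\<And>N. \<exists>x y z. \<not> (q^K dvd x \<and> q^K dvd y \<and> q^K dvd z) \<and> q^N dvd a * x^2 + b * y^2 - z^2"
  shows "hilbert q a b = 1"
proof -
  \<comment> \<open>At this precision a term divisible by \<open>q^N\<close> has its variable
    divisible by \<open>q^K\<close>, so the three terms cannot all disappear.\<close>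
  define N where "N = 2 * K + multiplicity q a + multiplicity q b"
  obtain x y z where nd: "\<not> (q^K dvd x \<and> q^K dvd y \<and> q^K dvd z)" and eq: "q^N dvd a * x^2 + b * y^2 - z^2"
    using sol by blast
  have mult: "multiplicity q (c * u^2) < N" "c * u^2 \<noteq> 0" if "\<not> q^N dvd c * u^2" for c u
    using that multiplicity_dvd'[of N q "c * u^2"] not_le by auto
  show ?thesis
  proof (cases "q^N dvd b * y^2")
    case False
    note m = mult[OF False]
    have y: "y \<noteq> 0" using m(2) by auto
    have "q ^ Suc (multiplicity q (b * y^2)) dvd - (a * x^2 + b * y^2 - z^2)"
      unfolding dvd_minus_iff using m(1) eq by (meson Suc_leI dvd_trans le_imp_power_dvd)
    from hilbert_perturb[OF assms(1) m(2) this, of a]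
    have "z^2 - a * x^2 \<noteq> 0" "hilbert q a (z^2 - a * x^2) = hilbert q a (b * y^2)" by (simp_all add: algebra_simps)
    moreover have "hilbert q a (b * y^2) = hilbert q a b"
      using hilbert_mult_right[of q a b "y^2"] hilbert_square_right[of q a y] assms y by simp
    ultimately show ?thesis using hilbert_norm[OF assms(1-3)] by simp
  next
    case True
    have "q ^ (2 * K + multiplicity q b) dvd q^N" unfolding N_def by (intro le_imp_power_dvd) simp
    hence y: "q^K dvd y" using power_dvd_of_mult_square[OF assms(1,4)] True dvd_trans by blast
    have "q^N dvd (a * x^2 + b * y^2 - z^2) - b * y^2" using eq True by (rule dvd_diff)
    hence eq2: "q^N dvd a * x^2 - z^2" by simp
    have "\<not> q^N dvd a * x^2"
    proof
      assume h: "q^N dvd a * x^2"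
      have "q ^ (2 * K + multiplicity q a) dvd q^N" unfolding N_def by (intro le_imp_power_dvd) simp
      hence x: "q^K dvd x" using power_dvd_of_mult_square[OF assms(1,3)] h dvd_trans by blast
      have "q^N dvd 1 * z^2" using eq2 h by (simp add: dvd_diff_right_iff)
      moreover have "q ^ (2 * K + multiplicity q 1) dvd q^N" unfolding N_def by (intro le_imp_power_dvd) simp
      ultimately have "q^K dvd z" using power_dvd_of_mult_square[OF assms(1), of 1] dvd_trans by (metis zero_neq_one)
      thus False using nd x y by blast
    qed
    note m = mult[OF this]
    have x: "x \<noteq> 0" using m(2) by auto
    have "q ^ Suc (multiplicity q (a * x^2)) dvd - (a * x^2 - z^2)"
      unfolding dvd_minus_iff using m(1) eq2 by (meson Suc_leI dvd_trans le_imp_power_dvd)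
    from hilbert_perturb[OF assms(1) m(2) this, of b]
    have z: "z^2 \<noteq> 0" and "hilbert q b (z^2) = hilbert q b (a * x^2)" by simp_all
    moreover have "hilbert q b (a * x^2) = hilbert q b a"
      using hilbert_mult_right[of q b a "x^2"] hilbert_square_right[of q b x] assms x by simp
    moreover have "hilbert q b (z^2) = 1" using z assms by (intro hilbert_square_right) auto
    ultimately show ?thesis by (simp add: hilbert_commute)
  qed
qed

section \<open>Symbols at 2 and at the real place, and the supplementary laws\<close>

definition chi4 :: "int \<Rightarrow> int" where
  "chi4 u = (if u mod 4 = 1 then 1 else -1)"

definition chi8 :: "int \<Rightarrow> int" where
  "chi8 u = (if u mod 8 = 1 \<or> u mod 8 = 7 then 1 else -1)"

text \<open>The sign \<open>(-1)^(x y)\<close>: it expresses the real symbol through signs and the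
  2-adic symbol of units through their classes modulo 4.\<close>

definition neg_sym :: "bool \<Rightarrow> bool \<Rightarrow> int" where
  "neg_sym x y = (if x \<and> y then -1 else 1)"

text \<open>This is the 2-adic Hilbert symbol only for odd \<open>a\<close>.\<close>
definition hilbert_2 :: "int \<Rightarrow> int \<Rightarrow> int" where
  "hilbert_2 a b = neg_sym (chi4 a = -1) (chi4 (unit_part 2 b) = -1) * chi8 a ^ multiplicity 2 b"

definition hilbert_inf :: "int \<Rightarrow> int \<Rightarrow> int" where
  "hilbert_inf a b = neg_sym (a < 0) (b < 0)"

lemma chi4_values: "chi4 a = 1 \<or> chi4 a = -1" by (simp add: chi4_def)

lemma chi8_values: "chi8 a = 1 \<or> chi8 a = -1" by (simp add: chi8_def)

lemma odd_mod_4: "odd (a::int) \<Longrightarrow> a mod 4 = 1 \<or> a mod 4 = 3" by presburger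

lemma odd_mod_8: "odd (a::int) \<Longrightarrow> a mod 8 = 1 \<or> a mod 8 = 3 \<or> a mod 8 = 5 \<or> a mod 8 = 7" by presburger

lemma chi4_mult: "odd a \<Longrightarrow> odd b \<Longrightarrow> chi4 (a * b) = chi4 a * chi4 b"
  using odd_mod_4[of a] odd_mod_4[of b] mod_mult_eq[of a 4 b] by (auto simp: chi4_def)

lemma chi8_mult: "odd a \<Longrightarrow> odd b \<Longrightarrow> chi8 (a * b) = chi8 a * chi8 b"
  using odd_mod_8[of a] odd_mod_8[of b] mod_mult_eq[of a 8 b] by (auto simp: chi8_def)

lemma prime_int_2: "prime (2::int)" by simp

lemma odd_unit_part_2: "b \<noteq> 0 \<Longrightarrow> odd (unit_part 2 b)"
  using prime_power_decompose[OF prime_int_2, of b] unit_part_power_times_unit[OF prime_int_2] by metis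

lemma unit_part_mult:
  assumes "prime q" "a \<noteq> 0" "b \<noteq> 0"
  shows "unit_part q (a * b) = unit_part q a * unit_part q b"
proof -
  obtain i c where c: "a = q^i * c" "\<not> q dvd c" using prime_power_decompose assms by blast
  obtain j d where d: "b = q^j * d" "\<not> q dvd d" using prime_power_decompose assms by blast
  have e: "a * b = q^(i + j) * (c * d)" using c d by (simp add: power_add)
  have n: "\<not> q dvd c * d" using c d assms by (simp add: prime_dvd_mult_iff)
  show ?thesis unfolding e unfolding c(1) d(1) using c(2) d(2) n assms(1)
    by (simp only: unit_part_power_times_unit not_False_eq_True)
qed

lemma hilbert_2_mult_left:
  assumes "odd a" "odd a'"
  shows "hilbert_2 (a * a') b = hilbert_2 a b * hilbert_2 a' b"
  using chi4_mult[OF assms] chi8_mult[OF assms] chi4_values[of a] chi4_values[of a']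
  by (auto simp: hilbert_2_def neg_sym_def power_mult_distrib)

lemma hilbert_2_mult_right:
  assumes "b \<noteq> 0" "b' \<noteq> 0"
  shows "hilbert_2 a (b * b') = hilbert_2 a b * hilbert_2 a b'"
  using chi4_mult[OF odd_unit_part_2 odd_unit_part_2, OF assms] chi4_values[of "unit_part 2 b"]
    chi4_values[of "unit_part 2 b'"] multiplicity_mult_int[OF prime_int_2 assms]
    unit_part_mult[OF prime_int_2 assms]
  by (auto simp: hilbert_2_def neg_sym_def power_add)

lemma hilbert_2_odd:
  assumes "odd b"
  shows "hilbert_2 a b = neg_sym (chi4 a = -1) (chi4 b = -1)"
  using multiplicity_power_times_unit[OF prime_int_2 assms, of 0]
    unit_part_power_times_unit[OF prime_int_2 assms, of 0] by (simp add: hilbert_2_def)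

lemma hilbert_2_double_odd:
  assumes "odd b"
  shows "hilbert_2 a (2 * b) = neg_sym (chi4 a = -1) (chi4 b = -1) * chi8 a"
  using multiplicity_power_times_unit[OF prime_int_2 assms, of 1]
    unit_part_power_times_unit[OF prime_int_2 assms, of 1] by (simp add: hilbert_2_def)

lemma hilbert_inf_mult:
  "a \<noteq> 0 \<Longrightarrow> a' \<noteq> 0 \<Longrightarrow> hilbert_inf (a * a') b = hilbert_inf a b * hilbert_inf a' b"
  "b \<noteq> 0 \<Longrightarrow> b' \<noteq> 0 \<Longrightarrow> hilbert_inf a (b * b') = hilbert_inf a b * hilbert_inf a b'"
  by (auto simp: hilbert_inf_def neg_sym_def mult_less_0_iff)

lemma cong_pm_one_imp_eq:
  fixes x y :: int
  assumes "x = 1 \<or> x = -1" "y = 1 \<or> y = -1" "[x = y] (mod q)" "2 < q"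
  shows "x = y"
  using assms zdvd_imp_le[of q 2] by (auto simp: cong_iff_dvd_diff)

lemma chi4_eq_power:
  assumes "odd r"
  shows "(-1::int) ^ ((r - 1) div 2) = chi4 (int r)"
proof (cases "int r mod 4 = 1")
  case True
  hence "r mod 4 = 1" by presburger
  hence "even ((r - 1) div 2)" by presburger
  thus ?thesis using True by (simp add: chi4_def)
next
  case False
  hence "r mod 4 = 3" using assms by presburger
  hence "odd ((r - 1) div 2)" by presburger
  thus ?thesis using False by (simp add: chi4_def)
qed

lemma Legendre_minus_one:
  assumes "prime q" "2 < q"
  shows "Legendre (-1) q = chi4 q"
proof -
  obtain r where r: "q = int r" "prime r" and odd: "odd r" using odd_prime_int_natE[OF assms] .
  have pr: "prime r" "2 < r" using assms r by auto
  have n: "\<not> q dvd -1" using assms by auto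
  have "[Legendre (-1) q = chi4 q] (mod q)" using euler_criterion[OF pr, of "-1"] chi4_eq_power[OF odd] r by simp
  thus ?thesis using cong_pm_one_imp_eq Legendre_unit[OF n] chi4_values assms(2) by blast
qed

text \<open>Gauss's lemma: the numbers \<open>2 x\<close> with \<open>x\<close> up to
  \<open>h = (q - 1) / 2\<close> need no reduction modulo \<open>q\<close>, and those beyond
  \<open>h\<close> come from \<open>h div 2 < x\<close>. The parity of their number depends on
  \<open>q\<close> modulo 8.\<close>

lemma Legendre_two:
  assumes "prime q" "2 < q"
  shows "Legendre 2 q = chi8 q"
proof -
  obtain r where r: "q = int r" "prime r" using odd_prime_int_natE[OF assms] .
  have pr: "prime r" "2 < r" using assms r by auto
  have odd: "odd q" using odd_prime_int assms by blast
  have "\<not> q dvd 2" using assms zdvd_imp_le[of q 2] by auto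
  then interpret G: GAUSS r 2
    using pr r by unfold_locales (auto simp: cong_0_iff)
  define h where "h = (q - 1) div 2"
  have qh: "q = 2 * h + 1" using odd unfolding h_def by presburger
  have h0: "h \<ge> 0" using qh assms(2) by simp
  have "G.E = (\<lambda>x. x * 2) ` {h div 2 <.. h}"
  proof -
    have "G.C = (\<lambda>x. x * 2) ` {0<..h}"
      unfolding G.C_def G.B_def G.A_def image_image r(1)[symmetric] h_def[symmetric]
      by (rule image_cong) (use qh in auto)
    moreover have "x * 2 > h \<longleftrightarrow> x > h div 2" for x by linarith
    ultimately show ?thesis unfolding G.E_def r(1)[symmetric] h_def[symmetric] using h0 by (auto simp: image_iff)
  qed
  hence "card G.E = card {h div 2 <.. h}" by (simp add: card_image inj_on_def)
  hence c: "Legendre 2 q = (-1) ^ nat (h - h div 2)" using G.gauss_lemma r by simp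
  have ev: "even (nat (h - h div 2)) \<longleftrightarrow> even (h - h div 2)" using h0 by (simp add: even_nat_iff)
  have "q mod 8 = 1 \<or> q mod 8 = 7 \<longleftrightarrow> even (h - h div 2)" using qh by presburger
  thus ?thesis unfolding c chi8_def using ev by auto
qed

lemma reciprocity_neg_sym:
  assumes "prime p" "2 < p" "prime q" "2 < q" "p \<noteq> q"
  shows "Legendre p q * Legendre q p = neg_sym (chi4 p = -1) (chi4 q = -1)"
proof -
  have "Legendre p q * Legendre q p = (-1) ^ (nat ((p - 1) div 2 * ((q - 1) div 2)))"
    using assms by (intro Quadratic_Reciprocity_int) auto
  moreover have "even (nat ((p - 1) div 2 * ((q - 1) div 2))) \<longleftrightarrow> even ((p - 1) div 2) \<or> even ((q - 1) div 2)"
    using assms by (subst even_nat_iff) auto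
  moreover have "even ((p - 1) div 2) \<longleftrightarrow> chi4 p = 1" "even ((q - 1) div 2) \<longleftrightarrow> chi4 q = 1"
    using odd_prime_int[OF assms(1,2)] odd_prime_int[OF assms(3,4)] unfolding chi4_def by (auto; presburger)+
  ultimately show ?thesis using chi4_values[of p] chi4_values[of q] by (auto simp: neg_sym_def)
qed

section \<open>The product formula\<close>

lemma prod_eq_single:
  fixes f :: "int \<Rightarrow> int"
  assumes "finite S" "l \<in> S" "\<And>q. q \<in> S \<Longrightarrow> q \<noteq> l \<Longrightarrow> f q = 1"
  shows "prod f S = f l"
  using prod.remove[OF assms(1,2), of f] prod.neutral[of "S - {l}" f] assms(3) by auto

text \<open>\<open>S\<close> is meant to be a finite set of odd primes containing those that divide
  \<open>a\<close> or \<open>b\<close>; the other odd primes contribute 1. Keeping it independent of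
  \<open>a\<close> and \<open>b\<close> makes the product multiplicative in each argument.\<close>

definition hilbert_prod :: "int set \<Rightarrow> int \<Rightarrow> int \<Rightarrow> int" where
  "hilbert_prod S a b = (\<Prod>q\<in>S. hilbert q a b) * hilbert_2 a b * hilbert_inf a b"

context
  fixes S :: "int set"
  assumes fin: "finite S" and primes: "\<And>q. q \<in> S \<Longrightarrow> prime q \<and> 2 < q"
begin

lemma hilbert_prod_mult_left:
  assumes "odd a" "odd a'" "b \<noteq> 0"
  shows "hilbert_prod S (a * a') b = hilbert_prod S a b * hilbert_prod S a' b"
proof -
  have nz: "a \<noteq> 0" "a' \<noteq> 0" using assms by auto
  have "(\<Prod>q\<in>S. hilbert q (a * a') b) = (\<Prod>q\<in>S. hilbert q a b) * (\<Prod>q\<in>S. hilbert q a' b)"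
    unfolding prod.distrib[symmetric] using primes nz assms by (intro prod.cong refl hilbert_mult_left) auto
  thus ?thesis using hilbert_2_mult_left[OF assms(1,2)] hilbert_inf_mult(1)[OF nz]
    by (simp add: hilbert_prod_def mult_ac)
qed

lemma hilbert_prod_mult_right:
  assumes "a \<noteq> 0" "b \<noteq> 0" "b' \<noteq> 0"
  shows "hilbert_prod S a (b * b') = hilbert_prod S a b * hilbert_prod S a b'"
proof -
  have "(\<Prod>q\<in>S. hilbert q a (b * b')) = (\<Prod>q\<in>S. hilbert q a b) * (\<Prod>q\<in>S. hilbert q a b')"
    unfolding prod.distrib[symmetric] using primes assms by (intro prod.cong refl hilbert_mult_right) auto
  thus ?thesis using hilbert_2_mult_right[OF assms(2,3)] hilbert_inf_mult(2)[OF assms(2,3)]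
    by (simp add: hilbert_prod_def mult_ac)
qed

lemma not_dvd_distinct: "q \<in> S \<Longrightarrow> l \<in> S \<Longrightarrow> q \<noteq> l \<Longrightarrow> \<not> q dvd l"
  using primes primes_dvd_imp_eq by blast

lemma not_dvd_small: "q \<in> S \<Longrightarrow> \<not> q dvd 1 \<and> \<not> q dvd -1 \<and> \<not> q dvd 2"
  using primes[of q] zdvd_imp_le[of q 2] by auto

lemma hilbert_prod_minus_one_prime:
  assumes l: "l \<in> S"
  shows "hilbert_prod S (-1) l = 1" "hilbert_prod S l (-1) = 1"
proof -
  have p: "prime l" "2 < l" using primes l by auto
  have l0: "odd l" "l > 0" using p odd_prime_int by auto
  have 1: "hilbert q (-1) l = 1" if "q \<in> S" "q \<noteq> l" for q
    using that l not_dvd_distinct not_dvd_small primes by (intro hilbert_units) auto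
  have "hilbert l (-1) (l^1 * 1) = Legendre (-1) l ^ 1"
    using p l not_dvd_small[OF l] by (intro hilbert_unit_left) auto
  hence 2: "hilbert l (-1) l = chi4 l" using Legendre_minus_one p by simp
  have 3: "(\<Prod>q\<in>S. hilbert q (-1) l) = chi4 l" using prod_eq_single[OF fin l, of "\<lambda>q. hilbert q (-1) l"] 1 2 by auto
  have 4: "hilbert_2 (-1) l = chi4 l" "hilbert_2 l (-1) = chi4 l"
    using l0 chi4_values[of l] by (auto simp: hilbert_2_odd neg_sym_def chi4_def)
  have 5: "hilbert_inf (-1) l = 1" "hilbert_inf l (-1) = 1" using l0 by (auto simp: hilbert_inf_def neg_sym_def)
  show "hilbert_prod S (-1) l = 1" using 3 4 5 chi4_values[of l] by (auto simp: hilbert_prod_def)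
  show "hilbert_prod S l (-1) = 1" using 3 4 5 chi4_values[of l]
    by (auto simp: hilbert_prod_def hilbert_commute[of _ l])
qed

lemma hilbert_prod_minus_one_minus_one: "hilbert_prod S (-1) (-1) = 1"
proof -
  have "(\<Prod>q\<in>S. hilbert q (-1) (-1)) = 1"
    using not_dvd_small primes by (intro prod.neutral ballI hilbert_units) auto
  thus ?thesis by (simp add: hilbert_prod_def hilbert_2_odd hilbert_inf_def neg_sym_def chi4_def)
qed

lemma hilbert_prod_minus_one_two: "hilbert_prod S (-1) 2 = 1"
proof -
  have "(\<Prod>q\<in>S. hilbert q (-1) 2) = 1"
    using not_dvd_small primes by (intro prod.neutral ballI hilbert_units) auto
  thus ?thesis using hilbert_2_double_odd[of 1 "-1"]
    by (simp add: hilbert_prod_def hilbert_inf_def neg_sym_def chi4_def chi8_def)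
qed

lemma hilbert_prod_prime_two:
  assumes l: "l \<in> S"
  shows "hilbert_prod S l 2 = 1"
proof -
  have p: "prime l" "2 < l" using primes l by auto
  have 1: "hilbert q l 2 = 1" if "q \<in> S" "q \<noteq> l" for q
    using that l not_dvd_distinct not_dvd_small primes by (intro hilbert_units) auto
  have "hilbert l 2 (l^1 * 1) = Legendre 2 l ^ 1"
    using p l not_dvd_small[OF l] by (intro hilbert_unit_left) auto
  hence "hilbert l l 2 = chi8 l" using Legendre_two p by (simp add: hilbert_commute)
  hence 3: "(\<Prod>q\<in>S. hilbert q l 2) = chi8 l" using prod_eq_single[OF fin l, of "\<lambda>q. hilbert q l 2"] 1 by auto
  show ?thesis using 3 hilbert_2_double_odd[of 1 l] chi8_values[of l]
    by (auto simp: hilbert_prod_def hilbert_inf_def neg_sym_def chi4_def)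
qed

text \<open>For distinct primes only the places \<open>l\<close>, \<open>m\<close> and 2 contribute,
  and the claim is quadratic reciprocity. For equal primes it follows from the first supplement: the
  symbols at \<open>l\<close> and at 2 both equal \<open>chi4 l\<close>.\<close>

lemma hilbert_prod_prime_prime:
  assumes l: "l \<in> S" and m: "m \<in> S"
  shows "hilbert_prod S l m = 1"
proof (cases "l = m")
  case True
  have p: "prime l" "2 < l" using primes l by auto
  have l0: "odd l" "l > 0" using p odd_prime_int by auto
  have 1: "hilbert q l l = 1" if "q \<in> S" "q \<noteq> l" for q
    using that l not_dvd_distinct primes by (intro hilbert_units) auto
  have "hilbert l (l^1 * 1) (l^1 * 1) = Legendre (-1) l ^ (1 * 1) * Legendre 1 l ^ 1 * Legendre 1 l ^ 1"
    using p l not_dvd_small[OF l] by (intro hilbert_eq) auto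
  hence "hilbert l l l = chi4 l" using Legendre_minus_one p Legendre_1 by simp
  hence "(\<Prod>q\<in>S. hilbert q l l) = chi4 l" using prod_eq_single[OF fin l, of "\<lambda>q. hilbert q l l"] 1 by auto
  thus ?thesis using True l0 chi4_values[of l]
    by (auto simp: hilbert_prod_def hilbert_inf_def neg_sym_def hilbert_2_odd)
next
  case False
  have p: "prime l" "2 < l" "prime m" "2 < m" using primes l m by auto
  have l0: "odd m" "l > 0" using p odd_prime_int by auto
  have nd: "\<not> l dvd m" "\<not> m dvd l" using not_dvd_distinct l m False by auto
  have 1: "hilbert q l m = 1" if "q \<in> S" "q \<noteq> l" "q \<noteq> m" for q
    using that l m not_dvd_distinct primes by (intro hilbert_units) auto
  have "hilbert l m (l^1 * 1) = Legendre m l ^ 1" "hilbert m l (m^1 * 1) = Legendre l m ^ 1"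
    using p l m not_dvd_small[OF l] not_dvd_small[OF m] nd by (intro hilbert_unit_left; auto)+
  hence 2: "hilbert l l m = Legendre m l" "hilbert m l m = Legendre l m" by (auto simp: hilbert_commute)
  have "(\<Prod>q\<in>S. hilbert q l m) = hilbert l l m * (\<Prod>q\<in>S - {l}. hilbert q l m)"
    by (rule prod.remove[OF fin l])
  also have "(\<Prod>q\<in>S - {l}. hilbert q l m) = hilbert m l m"
    using prod_eq_single[of "S - {l}" m "\<lambda>q. hilbert q l m"] fin m False 1 by auto
  finally have "(\<Prod>q\<in>S. hilbert q l m) = neg_sym (chi4 l = -1) (chi4 m = -1)"
    using reciprocity_neg_sym[of l m] p False 2 by (simp add: mult.commute)
  thus ?thesis using l0 by (auto simp: hilbert_prod_def hilbert_inf_def neg_sym_def hilbert_2_odd)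
qed

lemma hilbert_prod_one:
  assumes "a \<noteq> 0"
  shows "hilbert_prod S 1 a = 1" "hilbert_prod S a 1 = 1"
proof -
  have "hilbert q a 1 = 1" if "q \<in> S" for q
    using hilbert_square_right[of q a 1] primes[OF that] assms by simp
  hence "(\<Prod>q\<in>S. hilbert q a 1) = 1" by (intro prod.neutral) auto
  thus "hilbert_prod S 1 a = 1" "hilbert_prod S a 1 = 1"
    by (simp_all add: hilbert_prod_def hilbert_commute[of _ 1] hilbert_2_odd hilbert_inf_def neg_sym_def)
      (simp_all add: hilbert_2_def neg_sym_def chi4_def chi8_def)
qed

lemma hilbert_prod_generator:
  assumes a: "a = -1 \<or> a \<in> S" and "b \<noteq> 0" "\<And>q. prime q \<Longrightarrow> 2 < q \<Longrightarrow> q dvd b \<Longrightarrow> q \<in> S"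
  shows "hilbert_prod S a b = 1"
  using assms(2,3)
proof (induction b rule: prime_divisors_induct)
  case zero
  thus ?case by simp
next
  case (unit x)
  have a0: "a \<noteq> 0" using a primes by force
  have "x = 1 \<or> x = -1" using unit by (auto simp: abs_if split: if_splits)
  thus ?case using hilbert_prod_one[OF a0] a hilbert_prod_minus_one_minus_one hilbert_prod_minus_one_prime by auto
next
  case (factor p x)
  have a0: "a \<noteq> 0" using a primes by force
  have x0: "x \<noteq> 0" "p \<noteq> 0" using factor by auto
  have "hilbert_prod S a x = 1" using factor x0 by auto
  moreover have "hilbert_prod S a p = 1"
  proof (cases "p = 2")
    case True
    thus ?thesis using a hilbert_prod_minus_one_two hilbert_prod_prime_two by auto
  next
    case False
    hence "2 < p" using factor(1) prime_ge_2_int[of p] by linarith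
    hence "p \<in> S" using factor by auto
    thus ?thesis using a hilbert_prod_minus_one_prime hilbert_prod_prime_prime by auto
  qed
  ultimately show ?case using hilbert_prod_mult_right[OF a0 x0(2,1)] by simp
qed

text \<open>Multiplicativity in \<open>a\<close> leaves \<open>-1\<close> and the odd primes, and
  multiplicativity in \<open>b\<close> reduces to the supplementary laws and reciprocity.
  \<open>a\<close> is odd because \<open>hilbert_2\<close> is the true symbol only then.\<close>

theorem hilbert_product_formula:
  assumes "odd a" "b \<noteq> 0" "\<And>q. prime q \<Longrightarrow> 2 < q \<Longrightarrow> q dvd a \<or> q dvd b \<Longrightarrow> q \<in> S"
  shows "hilbert_prod S a b = 1"
  using assms(1,3)
proof (induction a rule: prime_divisors_induct)
  case zero
  thus ?case by simp
next
  case (unit x)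
  have "x = 1 \<or> x = -1" using unit by (auto simp: abs_if split: if_splits)
  thus ?case using hilbert_prod_one[OF assms(2)] hilbert_prod_generator[of "-1" b] assms by auto
next
  case (factor p x)
  have o: "odd p" "odd x" using factor.prems by auto
  have "p \<noteq> 2" using o by auto
  hence "2 < p" using factor(1) prime_ge_2_int[of p] by linarith
  hence "p \<in> S" using factor by auto
  hence "hilbert_prod S p b = 1" using hilbert_prod_generator[of p b] assms by auto
  moreover have "hilbert_prod S x b = 1" using factor.IH[OF o(2)] factor.prems(2) by (meson dvd_mult)
  ultimately show ?case using hilbert_prod_mult_left[OF o assms(2)] by simp
qed

end

subsection \<open>The places 2 and infinity\<close>

text \<open>The first equation times \<open>d3\<close> reads
  \<open>d2 d3 u2^2 + a1 d3 t^2 = (d3 u3)^2\<close>, a zero of the form belonging to the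
  symbol.\<close>

lemma hilbert_of_loc_sol:
  assumes "prime q" "2 < q" "a1 \<noteq> 0" "d1 \<noteq> 0" "d2 \<noteq> 0" "d3 \<noteq> 0" "loc_sol q a1 a2 a3 d1 d2 d3"
  shows "hilbert q (d2 * d3) (a1 * d3) = 1"
proof -
  \<comment> \<open>Large enough that \<open>q^K\<close> dividing both \<open>t\<close> and
    \<open>u2\<close> would make \<open>q\<close> divide \<open>u1\<close> and \<open>u3\<close>,
    against primitivity.\<close>
  define K where "K = 2 + multiplicity q d1 + multiplicity q d3"
  show ?thesis
  proof (rule hilbert_of_isotropic[OF assms(1,2), where K = K])
    fix N
    obtain t u1 u2 u3 where nd: "primitive q t u1 u2 u3"
      and eq: "cov_eqs (q^(N + K)) a1 a2 a3 d1 d2 d3 t u1 u2 u3" using assms(7) unfolding loc_sol_def by blast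
    have eqK: "cov_eqs (q^K) a1 a2 a3 d1 d2 d3 t u1 u2 u3"
      by (rule cov_eqs_dvd[OF eq]) (simp add: le_imp_power_dvd)
    have eqN: "cov_eqs (q^N) a1 a2 a3 d1 d2 d3 t u1 u2 u3"
      by (rule cov_eqs_dvd[OF eq]) (simp add: le_imp_power_dvd)
    have "\<not> (q^K dvd u2 \<and> q^K dvd t)"
    proof
      assume h: "q^K dvd u2 \<and> q^K dvd t"
      have qK: "q dvd q^K" by (simp add: K_def)
      have sq: "q^K dvd a1 * t^2" "q^K dvd a3 * t^2" "q^K dvd d2 * u2^2"
        using h by (auto intro: dvd_mult_square)
      note c = cov_eqs_dvd_terms[OF eqK sq]
      have "q^(2 * 1 + multiplicity q d3) dvd q^K" "q^(2 * 1 + multiplicity q d1) dvd q^K"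
        by (auto intro: le_imp_power_dvd simp: K_def)
      hence "q^1 dvd u3" "q^1 dvd u1"
        using power_dvd_of_mult_square[OF assms(1)] c assms(4,6) dvd_trans by blast+
      thus False using nd h qK dvd_trans by (metis power_one_right)
    qed
    moreover have "d2 * d3 * u2^2 + a1 * d3 * t^2 - (d3 * u3)^2 = d3 * (a1 * t^2 + d2 * u2^2 - d3 * u3^2)"
      by (simp add: power2_eq_square algebra_simps)
    hence "q^N dvd d2 * d3 * u2^2 + a1 * d3 * t^2 - (d3 * u3)^2"
      using eqN unfolding cov_eqs_def by (simp only: dvd_mult)
    ultimately show "\<exists>x y z. \<not> (q^K dvd x \<and> q^K dvd y \<and> q^K dvd z) \<and>
      q^N dvd d2 * d3 * x^2 + a1 * d3 * y^2 - z^2" by blast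
  qed (use assms in auto)
qed

text \<open>Solubility makes the symbols at odd primes trivial and the sign condition the real one,
  so the product formula isolates the place 2.\<close>

lemma hilbert_2_of_loc_sol:
  assumes "\<And>q. prime q \<Longrightarrow> 2 < q \<Longrightarrow> loc_sol q a1 a2 a3 d1 d2 d3"
    and "a1 \<noteq> 0" "odd d1" "odd d2" "odd d3" "d2 * d3 > 0 \<or> a1 * d3 > 0"
  shows "hilbert_2 (d2 * d3) (a1 * d3) = 1"
proof -
  define S where "S = {q. prime q \<and> 2 < q \<and> q dvd (d2 * d3) * (a1 * d3)}"
  have nz: "d1 \<noteq> 0" "d2 \<noteq> 0" "d3 \<noteq> 0" using assms by auto
  have "S \<subseteq> {q. q dvd (d2 * d3) * (a1 * d3)}" by (auto simp: S_def)
  moreover have "finite {q. q dvd (d2 * d3) * (a1 * d3)}" using nz assms(2) by (intro finite_divisors_int) simp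
  ultimately have fin: "finite S" by (rule finite_subset)
  have "hilbert_prod S (d2 * d3) (a1 * d3) = 1"
  proof (rule hilbert_product_formula[OF fin])
    show "q \<in> S" if "prime q" "2 < q" "q dvd d2 * d3 \<or> q dvd a1 * d3" for q
      using that unfolding S_def by (auto intro: dvd_mult dvd_mult2)
  qed (use assms nz in \<open>auto simp: S_def\<close>)
  moreover have "(\<Prod>q\<in>S. hilbert q (d2 * d3) (a1 * d3)) = 1"
  proof (intro prod.neutral ballI)
    fix q assume "q \<in> S"
    hence "prime q" "2 < q" by (auto simp: S_def)
    thus "hilbert q (d2 * d3) (a1 * d3) = 1" using hilbert_of_loc_sol assms(1,2) nz by blast
  qed
  moreover have "hilbert_inf (d2 * d3) (a1 * d3) = 1"
    using assms(6) by (auto simp: hilbert_inf_def neg_sym_def)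
  ultimately show ?thesis by (simp add: hilbert_prod_def)
qed

lemma mod_mult3_eq: "((x mod m) * (y mod m) * (z mod m)) mod m = (x * y * z) mod (m::int)"
  unfolding cong_def[symmetric] by (intro cong_mult) (simp_all add: cong_def)

lemma odd_square_mod_8: "odd (s::int) \<Longrightarrow> s^2 mod 8 = 1"
  using odd_mod_8[of s] power_mod[of s 8 2] by auto

lemma loc_sol_2_trivial:
  assumes "a1 + a2 + a3 = 0" "odd d1" "odd d2" "8 dvd d3 - d2" "8 dvd d3 - d1"
  shows "loc_sol 2 a1 a2 a3 d1 d2 d3"
  unfolding loc_sol_def
proof
  fix N
  obtain u2 where u2: "[d2 * u2^2 = d3] (mod 2^N)" using lift_sqrt_2[OF assms(3,4)] by blast
  obtain u1 where u1: "[d1 * u1^2 = d3] (mod 2^N)" using lift_sqrt_2[OF assms(2,5)] by blast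
  have "cov_eqs (2^N) a1 a2 a3 d1 d2 d3 0 u1 u2 1"
    by (rule cov_eqsI[OF assms(1)]) (use u1 u2 cong_sym in auto)
  thus "primitive_sol 2 (2^N) a1 a2 a3 d1 d2 d3" by (metis odd_one)
qed

lemma loc_sol_2_nontrivial:
  assumes "a1 + a2 + a3 = 0" "odd d1" "odd d2" "8 dvd (d3 - a1) - d2" "8 dvd (d3 + a2) - d1"
  shows "loc_sol 2 a1 a2 a3 d1 d2 d3"
  unfolding loc_sol_def
proof
  fix N
  obtain u2 where u2: "[d2 * u2^2 = d3 - a1] (mod 2^N)" using lift_sqrt_2[OF assms(3,4)] by blast
  obtain u1 where u1: "[d1 * u1^2 = d3 + a2] (mod 2^N)" using lift_sqrt_2[OF assms(2,5)] by blast
  have "[a1 + d2 * u2^2 = a1 + (d3 - a1)] (mod 2^N)" by (rule cong_add[OF cong_refl u2])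
  hence "[d3 = a1 + d2 * u2^2] (mod 2^N)" by (simp add: cong_sym)
  hence "cov_eqs (2^N) a1 a2 a3 d1 d2 d3 1 u1 u2 1"
    using u1 by (intro cov_eqsI[OF assms(1)]) (auto simp: add.commute)
  thus "primitive_sol 2 (2^N) a1 a2 a3 d1 d2 d3" by (metis odd_one)
qed

text \<open>Reciprocity replaces the 2-adic condition: the conics \<open>a1 t\<^sup>2 + d2 u2\<^sup>2 = d3 u3\<^sup>2\<close> and
  \<open>a2 t\<^sup>2 + d3 u3\<^sup>2 = d1 u1\<^sup>2\<close> are isotropic at every other place, hence also at 2, and this pins
  the residues modulo 8 down to one of the two soluble patterns.\<close>
lemma loc_sol_2_of_others:
  assumes "a1 + a2 + a3 = 0" "2 dvd a1" "\<not> 4 dvd a1" "2 dvd a2" "\<not> 4 dvd a2"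
    and od: "odd d1" "odd d2" "odd d3" and s: "d1 * d2 * d3 = s^2" and d3: "d3 mod 4 = 1"
    and sgn: "a1 < 0" "d2 > 0" "d1 * d3 > 0"
    and sol: "\<And>q. prime q \<Longrightarrow> 2 < q \<Longrightarrow> loc_sol q a1 a2 a3 d1 d2 d3"
  shows "loc_sol 2 a1 a2 a3 d1 d2 d3"
proof -
  obtain b1 where b1: "a1 = 2 * b1" using assms(2) by (rule dvdE)
  obtain b2 where b2: "a2 = 2 * b2" using assms(4) by (rule dvdE)
  have ob: "odd b1" "odd b2" using assms(3,5) b1 b2 by auto
  \<comment> \<open>One of the two is positive whatever the sign of \<open>d3\<close>, so the real
    symbol of the first conic is trivial; for the second conic \<open>d1 * d3 > 0\<close> does the
    same.\<close>
  have "a1 * d3 > 0 \<or> d2 * d3 > 0" proof (cases "d3 > 0")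
    case False
    moreover have "d3 \<noteq> 0" using od by auto
    ultimately have "a1 * d3 > 0" using sgn(1) by (intro mult_neg_neg) auto
    thus ?thesis ..
  qed (use sgn in auto)
  hence "hilbert_2 (d2 * d3) (a1 * d3) = 1"
    using hilbert_2_of_loc_sol[OF sol] od sgn by blast
  hence h1: "neg_sym (chi4 (d2 * d3) = -1) (chi4 (b1 * d3) = -1) * chi8 (d2 * d3) = 1"
    using hilbert_2_double_odd[of "b1 * d3"] ob od by (simp add: b1 mult.assoc)
  have "hilbert_2 (d3 * d1) (a2 * d1) = 1"
    using hilbert_2_of_loc_sol[of a2 a3 a1 d2 d3 d1] sol loc_sol_rotate od sgn ob b2 by (auto simp: mult.commute)
  hence h2: "neg_sym (chi4 (d3 * d1) = -1) (chi4 (b2 * d1) = -1) * chi8 (d3 * d1) = 1"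
    using hilbert_2_double_odd[of "b2 * d1"] ob od by (simp add: b2 mult.assoc)
  have "odd s" using s od by (metis even_mult_iff even_power zero_less_numeral)
  hence "(d1 * d2 * d3) mod 8 = 1" using s odd_square_mod_8 by simp
  hence p8: "((d1 mod 8) * (d2 mod 8) * (d3 mod 8)) mod 8 = 1" by (simp only: mod_mult3_eq)
  have c1: "d1 mod 8 = 1 \<or> d1 mod 8 = 3 \<or> d1 mod 8 = 5 \<or> d1 mod 8 = 7"
    "d2 mod 8 = 1 \<or> d2 mod 8 = 3 \<or> d2 mod 8 = 5 \<or> d2 mod 8 = 7"
    using odd_mod_8 od by auto
  have c3: "d3 mod 8 = 1 \<or> d3 mod 8 = 5" using d3 by presburger
  have cb: "b1 mod 4 = 1 \<or> b1 mod 4 = 3" "b2 mod 4 = 1 \<or> b2 mod 4 = 3" using odd_mod_4 ob by auto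
  have chi: "chi4 x = (if x mod 8 = 1 \<or> x mod 8 = 5 then 1 else -1)" if "odd x" for x
    using odd_mod_8[OF that] unfolding chi4_def by (auto; presburger)
  have h1': "neg_sym (chi4 d2 * chi4 d3 = -1) (chi4 b1 * chi4 d3 = -1) * (chi8 d2 * chi8 d3) = 1"
    using h1 ob od by (simp add: chi4_mult chi8_mult)
  have h2': "neg_sym (chi4 d3 * chi4 d1 = -1) (chi4 b2 * chi4 d1 = -1) * (chi8 d3 * chi8 d1) = 1"
    using h2 ob od by (simp add: chi4_mult chi8_mult)
  \<comment> \<open>A finite check: besides the trivial pattern at most one remains for each class
    of \<open>(b1, b2)\<close> modulo 4, and it is the one with \<open>d2 = d3 - a1\<close> and
    \<open>d1 = d3 + a2\<close> modulo 8.\<close>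
  have res: "(d1 mod 8 = 1 \<and> d2 mod 8 = 1 \<and> d3 mod 8 = 1) \<or>
    (d1 mod 8 = 7 \<and> d2 mod 8 = 3 \<and> d3 mod 8 = 5 \<and> b1 mod 4 = 1 \<and> b2 mod 4 = 1) \<or>
    (d1 mod 8 = 7 \<and> d2 mod 8 = 7 \<and> d3 mod 8 = 1 \<and> b1 mod 4 = 1 \<and> b2 mod 4 = 3) \<or>
    (d1 mod 8 = 3 \<and> d2 mod 8 = 3 \<and> d3 mod 8 = 1 \<and> b1 mod 4 = 3 \<and> b2 mod 4 = 1) \<or>
    (d1 mod 8 = 3 \<and> d2 mod 8 = 7 \<and> d3 mod 8 = 5 \<and> b1 mod 4 = 3 \<and> b2 mod 4 = 3)"
    using h1' h2' c1 c3 cb p8 unfolding chi[OF od(1)] chi[OF od(2)] chi[OF od(3)]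
    unfolding chi4_def chi8_def neg_sym_def
    by (elim disjE) simp_all
  have lin: "8 dvd (d3 - 2 * b1) - d2" "8 dvd (d3 + 2 * b2) - d1" if h: "d1 mod 8 = x" "d2 mod 8 = y" "d3 mod 8 = z"
    "b1 mod 4 = v" "b2 mod 4 = w" "8 dvd z - 2 * v - y" "8 dvd z + 2 * w - x" for x y z v w
  proof -
    obtain k1 k2 k3 l1 l2 where "d1 = 8 * k1 + x" "d2 = 8 * k2 + y" "d3 = 8 * k3 + z"
      "b1 = 4 * l1 + v" "b2 = 4 * l2 + w" using h by (metis mult_div_mod_eq)
    hence "(d3 - 2 * b1) - d2 = 8 * (k3 - l1 - k2) + (z - 2 * v - y)"
      "(d3 + 2 * b2) - d1 = 8 * (k3 + l2 - k1) + (z + 2 * w - x)" by simp_all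
    thus "8 dvd (d3 - 2 * b1) - d2" "8 dvd (d3 + 2 * b2) - d1" using h(6,7) by (metis dvd_add dvd_triv_left)+
  qed
  from res have "(8 dvd d3 - d2 \<and> 8 dvd d3 - d1) \<or> (8 dvd (d3 - a1) - d2 \<and> 8 dvd (d3 + a2) - d1)"
  proof (elim disjE conjE)
    assume "d1 mod 8 = 1" "d2 mod 8 = 1" "d3 mod 8 = 1"
    hence "8 dvd d3 - d2 \<and> 8 dvd d3 - d1" by (simp add: mod_eq_dvd_iff[symmetric])
    thus ?thesis ..
  qed (rule disjI2, use lin b1 b2 in force)+
  thus ?thesis using loc_sol_2_trivial loc_sol_2_nontrivial assms(1) od by blast
qed

text \<open>As 2 divides \<open>a1\<close> exactly once, a primitive solution has all
  \<open>ui\<close> odd. The equation with \<open>a3\<close>, a multiple of 4, then gives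
  \<open>d1 = d2\<close> modulo 4, and the square product gives \<open>d3 = 1\<close> modulo
  4.\<close>

lemma loc_sol_2_imp_mod_4:
  assumes "2 dvd a1" "\<not> 4 dvd a1" "2 dvd a2" "4 dvd a3"
    and od: "odd d1" "odd d2" "odd d3" and s: "d1 * d2 * d3 = s^2"
    and sol: "loc_sol 2 a1 a2 a3 d1 d2 d3"
  shows "d3 mod 4 = 1"
proof -
  obtain t u1 u2 u3 where nd: "primitive 2 t u1 u2 u3"
    and eq: "cov_eqs (2^2) a1 a2 a3 d1 d2 d3 t u1 u2 u3" using sol unfolding loc_sol_def by blast
  have eq2: "cov_eqs 2 a1 a2 a3 d1 d2 d3 t u1 u2 u3" by (rule cov_eqs_dvd[OF eq]) simp
  have par: "even u2 \<longleftrightarrow> even u3" "even u3 \<longleftrightarrow> even u1"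
    using eq2 assms(1,3) od unfolding cov_eqs_def by auto
  have u: "odd u3"
  proof
    assume h: "even u3"
    hence "even u1" "even u2" "odd t" using par nd by auto
    hence "4 dvd d2 * u2^2" "4 dvd d3 * u3^2" using h by (auto elim!: evenE simp: power2_eq_square)
    moreover have "4 dvd a1 * t^2 + d2 * u2^2 - d3 * u3^2" using eq unfolding cov_eqs_def by simp
    ultimately have "4 dvd (a1 * t^2 + d2 * u2^2 - d3 * u3^2) - d2 * u2^2 + d3 * u3^2"
      by (metis dvd_diff dvd_add)
    hence "4 dvd a1 * t^2" by simp
    moreover have "t^2 mod 8 = 1" using odd_square_mod_8 \<open>odd t\<close> by blast
    hence "coprime 4 (t^2)" using \<open>odd t\<close> by (metis coprime_power_left_iff coprime_power_right_iff
      coprime_left_2_iff_odd power2_eq_square mult_2 numeral_Bit0 one_add_one)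
    ultimately have "4 dvd a1" using coprime_dvd_mult_left_iff by blast
    thus False using assms(2) by blast
  qed
  have o: "odd u1" "odd u2" using u par by auto
  have q: "u1^2 mod 4 = 1" "u2^2 mod 4 = 1" using odd_square_mod_8[OF o(1)] odd_square_mod_8[OF o(2)] by presburger+
  have "4 dvd a3 * t^2 + d1 * u1^2 - d2 * u2^2" using eq unfolding cov_eqs_def by simp
  moreover have "4 dvd a3 * t^2" using assms(4) by simp
  ultimately have "4 dvd (a3 * t^2 + d1 * u1^2 - d2 * u2^2) - a3 * t^2" by (rule dvd_diff)
  hence "(d1 * u1^2) mod 4 = (d2 * u2^2) mod 4" by (simp add: mod_eq_dvd_iff)
  hence d12: "d1 mod 4 = d2 mod 4" using q by (metis mod_mult_right_eq mult.right_neutral)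
  have "odd s" using s od by (metis even_mult_iff even_power zero_less_numeral)
  hence "(d1 * d2 * d3) mod 4 = 1" using s odd_square_mod_8[of s] by presburger
  hence "((d1 mod 4) * (d2 mod 4) * (d3 mod 4)) mod 4 = 1" by (simp only: mod_mult3_eq)
  thus ?thesis using d12 odd_mod_4[OF od(2)] odd_mod_4[OF od(3)] by auto
qed

text \<open>If \<open>d2 < 0\<close>, the square product makes \<open>d1\<close> or
  \<open>d3\<close> positive, and the equation pairing that one with \<open>d2\<close> equates a
  positive definite form with a nonpositive term.\<close>

lemma real_cov_imp_pos:
  assumes "a1 < 0" "a3 > 0" "d1 * d2 * d3 = s^2" "d1 \<noteq> 0" "d2 \<noteq> 0" "d3 \<noteq> 0" "real_cov a1 a2 a3 d1 d2 d3"
  shows "d2 > 0"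
proof (rule ccontr)
  assume "\<not> d2 > 0"
  hence n: "d2 < 0" using assms by simp
  obtain t u1 u2 u3 :: real where nd: "\<not> (t = 0 \<and> u1 = 0 \<and> u2 = 0 \<and> u3 = 0)"
    and e: "a1 * t^2 + d2 * u2^2 - d3 * u3^2 = 0" "a2 * t^2 + d3 * u3^2 - d1 * u1^2 = 0"
    "a3 * t^2 + d1 * u1^2 - d2 * u2^2 = 0" using assms(7) unfolding real_cov_def by blast
  have "s \<noteq> 0" using assms by auto
  hence "d1 * d2 * d3 > 0" using assms(3) by simp
  moreover have "d1 * d2 * d3 < 0" if "d1 < 0" "d3 < 0"
    using mult_pos_neg[OF mult_neg_neg[OF that(1) n] that(2)] .
  ultimately have "d1 > 0 \<or> d3 > 0" using assms(4,6) by force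
  moreover have "u2^2 \<ge> 0" "t^2 \<ge> 0" "u1^2 \<ge> 0" "u3^2 \<ge> 0" by simp_all
  moreover have z: "x = 0 \<and> y = 0 \<and> w = 0"
    if "real_of_int a * x^2 + real_of_int b * y^2 = real_of_int c * w^2" "a > 0" "b > 0" "c < 0" for a b c x y w
  proof -
    have "a * x^2 \<ge> 0" "b * y^2 \<ge> 0" "c * w^2 \<le> 0"
      using that by (auto intro: mult_nonpos_nonneg)
    hence "a * x^2 = 0 \<and> b * y^2 = 0 \<and> c * w^2 = 0" using that(1) by linarith
    thus ?thesis using that by simp
  qed
  ultimately show False
  proof (elim disjE)
    assume d1: "d1 > 0"
    have "t = 0 \<and> u1 = 0 \<and> u2 = 0" by (rule z[of a3 t d1 u1 d2 u2]) (use e(3) assms d1 n in auto)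
    thus False using e nd assms(6) by auto
  next
    assume d3: "d3 > 0"
    have "t = 0 \<and> u3 = 0 \<and> u2 = 0" by (rule z[of "- a1" t d3 u3 d2 u2]) (use e(1) assms d3 n in auto)
    thus False using e nd assms(4) by auto
  qed
qed

text \<open>If \<open>d1\<close> and \<open>d3\<close> are positive, the point at infinity is real;
  if both are negative, the point with \<open>u2 = 0\<close> is, since \<open>a1 / d3\<close> and
  \<open>a3 / - d1\<close> are positive.\<close>

lemma real_cov_of_pos:
  assumes "a1 + a2 + a3 = 0" "a1 < 0" "a3 > 0" "d2 > 0" "d1 * d3 > 0"
  shows "real_cov a1 a2 a3 d1 d2 d3"
proof (cases "d1 > 0")
  case True
  hence "d3 > 0" using assms(5) by (simp add: zero_less_mult_iff)
  thus ?thesis unfolding real_cov_def using True assms(4)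
    by (intro exI[of _ 0] exI[of _ "1 / sqrt d1"] exI[of _ "1 / sqrt d2"] exI[of _ "1 / sqrt d3"])
      (simp add: power_divide)
next
  case False
  hence n: "d1 < 0" "d3 < 0" using assms(5) by (auto simp: zero_less_mult_iff)
  have "d1 * (sqrt (a3 / (- d1)))^2 = - a3" "d3 * (sqrt (a1 / d3))^2 = a1"
    using n assms by (simp_all add: divide_nonneg_pos divide_nonpos_neg less_imp_le field_simps)
  moreover have "real_of_int a1 + a2 + a3 = 0" using assms(1) by (metis of_int_0 of_int_add)
  ultimately show ?thesis unfolding real_cov_def
    by (intro exI[of _ 1] exI[of _ "sqrt (a3 / (- d1))"] exI[of _ 0] exI[of _ "sqrt (a1 / d3)"]) simp
qed

subsection \<open>Square-free representatives and translation by 2-torsion\<close>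

lemma squarefree_not_dvd: "squarefree (d::int) \<Longrightarrow> prime q \<Longrightarrow> \<not> q^2 dvd d"
  using squarefreeD not_prime_unit by blast

lemma squarefree_multiplicity:
  assumes "squarefree (d::int)" "prime q"
  shows "multiplicity q d = (if q dvd d then 1 else 0)"
  using squarefree_not_dvd[OF assms]
  by (auto intro!: multiplicity_eqI simp: not_dvd_imp_multiplicity_0 power2_eq_square)

lemma squarefree_dvdI:
  fixes d d' :: int
  assumes "squarefree d" "d' \<noteq> 0" "\<And>q. prime q \<Longrightarrow> q dvd d \<Longrightarrow> q dvd d'"
  shows "d dvd d'"
proof -
  have d0: "d \<noteq> 0" using assms by auto
  have "multiplicity q d \<le> multiplicity q d'" if q: "prime q" for q
  proof -
  have "q dvd d \<Longrightarrow> multiplicity q d' \<ge> 1"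
    using assms(2,3) q multiplicity_geI[of d' q 1] by (auto simp: not_prime_unit)
  thus ?thesis using squarefree_multiplicity[OF assms(1) q] by simp
  qed
  thus ?thesis using prime_multiplicity_le_imp_dvd[OF d0 assms(2)] by blast
qed

lemma squarefree_eqI:
  fixes d d' :: int
  assumes "squarefree d" "squarefree d'" "d * d' = r^2"
  shows "d = d'"
proof -
  have nz: "d \<noteq> 0" "d' \<noteq> 0" using assms by auto
  have pr: "q dvd d \<longleftrightarrow> q dvd d'" if q: "prime q" for q
  proof -
    have u: "\<not> q^2 dvd 1" "\<not> q dvd 1" using q by (auto simp: not_prime_unit)
    have "q dvd 1 \<longleftrightarrow> (q dvd d) \<noteq> (q dvd d')"
      by (rule square_product_dvd_pattern[OF q]) (use assms nz u squarefree_not_dvd q in auto)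
    thus ?thesis using u by blast
  qed
  have "d dvd d'" "d' dvd d" using squarefree_dvdI assms nz pr by blast+
  hence "\<bar>d\<bar> = \<bar>d'\<bar>" by (rule zdvd_antisym_abs)
  moreover have "r \<noteq> 0" using assms(3) nz by auto
  hence "d * d' > 0" using assms(3) by simp
  ultimately show ?thesis by (auto simp: zero_less_mult_iff abs_if split: if_splits)
qed

lemma int_square_quotient:
  fixes x :: int
  assumes "x * a^2 = b^2" "a \<noteq> 0"
  obtains r where "x = r^2"
proof -
  have "a^2 dvd b^2" using assms(1) by (metis dvd_triv_right)
  hence "a dvd b" by simp
  then obtain r where "b = a * r" by (rule dvdE)
  hence "x = r^2" using assms by (simp add: power_mult_distrib)
  thus ?thesis by (rule that)
qed

lemma sqf_eqI:
  assumes "squarefree d" "x = d * s^2" "x \<noteq> 0"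
  shows "sqf x = d"
  unfolding sqf_def
proof (rule the_equality)
  show "squarefree d \<and> (\<exists>s. x = d * s^2)" using assms by blast
  fix d' assume "squarefree d' \<and> (\<exists>s. x = d' * s^2)"
  then obtain s' where d': "squarefree d'" "x = d' * s'^2" by blast
  have "(d' * d) * (s * s')^2 = x^2" unfolding power2_eq_square using assms(2) d'(2)
    by (simp add: power2_eq_square mult_ac)
  moreover have "s * s' \<noteq> 0" using assms d' by auto
  ultimately obtain r where "d' * d = r^2" using int_square_quotient by blast
  thus "d' = d" using squarefree_eqI d' assms by blast
qed

lemma sqf_decompose:
  assumes "x \<noteq> 0"
  obtains s where "squarefree (sqf x)" "x = sqf x * s^2" "s \<noteq> 0" "sqf x \<noteq> 0"
proof -
  have e: "x = squarefree_part x * square_part x ^ 2" by (rule squarefree_decompose)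
  have "sqf x = squarefree_part x" by (rule sqf_eqI[OF _ e assms]) simp
  moreover have "square_part x \<noteq> 0" "squarefree_part x \<noteq> 0" using assms by auto
  ultimately show ?thesis using that[of "square_part x"] e by simp
qed

lemma sqf_of_squarefree: "squarefree d \<Longrightarrow> sqf d = d"
  by (rule sqf_eqI[of d d 1]) auto

lemma sqf_1: "sqf 1 = 1" by (rule sqf_of_squarefree) simp

lemma sqf_cong:
  assumes "x * y = r^2" "x \<noteq> 0" "y \<noteq> 0"
  shows "sqf x = sqf y"
proof -
  obtain s where s: "squarefree (sqf x)" "x = sqf x * s^2" "s \<noteq> 0" using sqf_decompose assms by blast
  obtain t where t: "squarefree (sqf y)" "y = sqf y * t^2" "t \<noteq> 0" using sqf_decompose assms by blast
  have "(sqf x * sqf y) * (s * t)^2 = (sqf x * s^2) * (sqf y * t^2)" by (simp add: power_mult_distrib mult_ac)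
  also have "\<dots> = r^2" using s(2) t(2) assms(1) by simp
  finally have "(sqf x * sqf y) * (s * t)^2 = r^2" .
  moreover have "s * t \<noteq> 0" using s t by simp
  ultimately obtain v where "sqf x * sqf y = v^2" using int_square_quotient by blast
  thus ?thesis using squarefree_eqI s t by blast
qed

text \<open>The factors are swapped on the right so that rewriting \<open>tmul\<close> yields
  literally the terms of \<open>Sel2_translate\<close>.\<close>

lemma sqf_mult_sqf:
  assumes "x \<noteq> 0" "y \<noteq> 0"
  shows "sqf (x * sqf y) = sqf (y * x)"
proof -
  obtain t where t: "y = sqf y * t^2" "sqf y \<noteq> 0" using sqf_decompose assms by blast
  have "(x * sqf y) * (y * x) = (x * sqf y)^2 * t^2"
    by (subst t(1)) (simp add: power2_eq_square mult_ac)
  hence "(x * sqf y) * (y * x) = (x * sqf y * t)^2" by (simp add: power_mult_distrib)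
  thus ?thesis using assms t by (intro sqf_cong) auto
qed

lemma prime_dvd_sqf_iff:
  assumes "prime q" "x \<noteq> 0"
  shows "q dvd sqf x \<longleftrightarrow> odd (multiplicity q x)"
proof -
  obtain t where t: "squarefree (sqf x)" "x = sqf x * t^2" "t \<noteq> 0" "sqf x \<noteq> 0" using sqf_decompose assms by blast
  have "multiplicity q (sqf x * t^2) = multiplicity q (sqf x) + 2 * multiplicity q t"
    using assms(1) t(3,4) by (simp add: multiplicity_mult_int multiplicity_square_int)
  hence "multiplicity q x = multiplicity q (sqf x) + 2 * multiplicity q t" using t(2) by simp
  thus ?thesis using squarefree_multiplicity[OF t(1) assms(1)] by simp
qed

section \<open>Selmer triples and their torsion translates\<close>

lemma Sel2_iff:
  "(d1, d2, d3) \<in> Sel2 e1 e2 e3 m \<longleftrightarrow> d1 \<noteq> 0 \<and> d2 \<noteq> 0 \<and> d3 \<noteq> 0 \<and>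
     squarefree d1 \<and> squarefree d2 \<and> squarefree d3 \<and> (\<exists>s. d1 * d2 * d3 = s^2) \<and>
     real_cov (e1 * m) (e2 * m) (e3 * m) d1 d2 d3 \<and>
     (\<forall>q. prime q \<longrightarrow> loc_sol q (e1 * m) (e2 * m) (e3 * m) d1 d2 d3)"
proof -
  have eqv: "(\<forall>p. prime p \<longrightarrow> loc_sol (int p) a1 a2 a3 d1 d2 d3) \<longleftrightarrow> (\<forall>q. prime q \<longrightarrow> loc_sol q a1 a2 a3 d1 d2 d3)"
    for a1 a2 a3
  proof
    assume h: "\<forall>p. prime p \<longrightarrow> loc_sol (int p) a1 a2 a3 d1 d2 d3"
    show "\<forall>q. prime q \<longrightarrow> loc_sol q a1 a2 a3 d1 d2 d3"
    proof (intro allI impI)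
      fix q :: int assume q: "prime q"
      hence "q = int (nat q)" using prime_ge_0_int by simp
      thus "loc_sol q a1 a2 a3 d1 d2 d3" using h q by (metis prime_int_nat_transfer)
    qed
  next
    assume h: "\<forall>q. prime q \<longrightarrow> loc_sol q a1 a2 a3 d1 d2 d3"
    show "\<forall>p. prime p \<longrightarrow> loc_sol (int p) a1 a2 a3 d1 d2 d3"
    proof (intro allI impI)
      fix p :: nat assume "prime p"
      hence "prime (int p)" by simp
      thus "loc_sol (int p) a1 a2 a3 d1 d2 d3" using h by blast
    qed
  qed
  have "(d1, d2, d3) \<in> Sel2 e1 e2 e3 m \<longleftrightarrow> d1 \<noteq> 0 \<and> d2 \<noteq> 0 \<and> d3 \<noteq> 0 \<and>
     squarefree d1 \<and> squarefree d2 \<and> squarefree d3 \<and> (\<exists>s. d1 * d2 * d3 = s^2) \<and>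
     real_cov (e1 * m) (e2 * m) (e3 * m) d1 d2 d3 \<and>
     (\<forall>p. prime p \<longrightarrow> loc_sol (int p) (e1 * m) (e2 * m) (e3 * m) d1 d2 d3)"
    by (simp only: Sel2_def D_adelic_def padic_sol_D_eqs real_sol_D_eqs mem_Collect_eq prod.case)
  thus ?thesis by (simp only: eqv)
qed

text \<open>The coverings are symmetric under cyclic permutation of the indices, so the translation
  by one torsion point yields those by the other two.\<close>

lemma Sel2_rotate: "(d1, d2, d3) \<in> Sel2 e1 e2 e3 m \<Longrightarrow> (d2, d3, d1) \<in> Sel2 e2 e3 e1 m"
proof -
  assume h: "(d1, d2, d3) \<in> Sel2 e1 e2 e3 m"
  have "d2 * d3 * d1 = d1 * d2 * d3" by simp
  hence "\<exists>s. d2 * d3 * d1 = s^2" using h unfolding Sel2_iff by (simp only:)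
  moreover have "real_cov (e2 * m) (e3 * m) (e1 * m) d2 d3 d1"
    using h real_cov_rotate unfolding Sel2_iff by blast
  moreover have "\<forall>q. prime q \<longrightarrow> loc_sol q (e2 * m) (e3 * m) (e1 * m) d2 d3 d1"
    using h loc_sol_rotate unfolding Sel2_iff by blast
  ultimately show ?thesis using h unfolding Sel2_iff by simp
qed

text \<open>The new first equation is a multiple of the old second one, and the new second of the
  old first. A general commutative ring is allowed because the identities serve both the congruences
  and the real place.\<close>

lemma translate_identities:
  fixes d1 d2 d3 :: "'a::comm_ring_1"
  assumes "d1 * d2 * d3 = r^2" "a2 * d1 = l1 * s1^2" "- a1 * d2 = l2 * s2^2" "- a1 * a2 * d3 = l3 * s3^2"
  shows "a1 * (d1 * d2 * d3 * u3)^2 + l2 * (s2 * r * d1 * u1)^2 - l3 * (s3 * d1 * d2 * t)^2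
      = a1 * d1^2 * d2^2 * d3 * (a2 * t^2 + d3 * u3^2 - d1 * u1^2)"
    "a2 * (d1 * d2 * d3 * u3)^2 + l3 * (s3 * d1 * d2 * t)^2 - l1 * (s1 * r * d2 * u2)^2
      = - a2 * d1^2 * d2^2 * d3 * (a1 * t^2 + d2 * u2^2 - d3 * u3^2)"
proof -
  have 1: "l2 * (s2 * r * d1 * u1)^2 = (l2 * s2^2) * (r^2) * d1^2 * u1^2"
    "l3 * (s3 * d1 * d2 * t)^2 = (l3 * s3^2) * d1^2 * d2^2 * t^2"
    "l1 * (s1 * r * d2 * u2)^2 = (l1 * s1^2) * (r^2) * d2^2 * u2^2"
    by (simp_all add: power_mult_distrib mult_ac)
  show "a1 * (d1 * d2 * d3 * u3)^2 + l2 * (s2 * r * d1 * u1)^2 - l3 * (s3 * d1 * d2 * t)^2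
      = a1 * d1^2 * d2^2 * d3 * (a2 * t^2 + d3 * u3^2 - d1 * u1^2)"
    unfolding 1 assms[symmetric] by (simp add: algebra_simps power2_eq_square)
  show "a2 * (d1 * d2 * d3 * u3)^2 + l3 * (s3 * d1 * d2 * t)^2 - l1 * (s1 * r * d2 * u2)^2
      = - a2 * d1^2 * d2^2 * d3 * (a1 * t^2 + d2 * u2^2 - d3 * u3^2)"
    unfolding 1 assms[symmetric] by (simp add: algebra_simps power2_eq_square)
qed

lemma prime_dvd_of_power_dvd_mult:
  assumes "prime (q::int)" "c \<noteq> 0" "q ^ K dvd c * u" "multiplicity q c < K"
  shows "q dvd u"
proof (rule ccontr)
  assume "\<not> q dvd u"
  hence "coprime (q^K) u" using assms(1) by (simp add: prime_imp_coprime)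
  hence "q^K dvd c" using assms(3) coprime_dvd_mult_left_iff by blast
  hence "K \<le> multiplicity q c" using assms by (intro multiplicity_geI) (auto simp: not_prime_unit)
  thus False using assms(4) by simp
qed

text \<open>On the 2-coverings, translation by the 2-torsion point \<open>(0, 0)\<close> permutes the coordinates by
  \<open>(t u3)(u1 u2)\<close>, up to scaling.\<close>
lemma loc_sol_translate:
  assumes "prime q" "a1 + a2 + a3 = 0" "d1 \<noteq> 0" "d2 \<noteq> 0" "d3 \<noteq> 0" "s1 \<noteq> 0" "s2 \<noteq> 0" "s3 \<noteq> 0" "r \<noteq> 0"
    and id: "d1 * d2 * d3 = r^2" "a2 * d1 = l1 * s1^2" "- a1 * d2 = l2 * s2^2" "- a1 * a2 * d3 = l3 * s3^2"
    and sol: "loc_sol q a1 a2 a3 d1 d2 d3"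
  shows "loc_sol q a1 a2 a3 l1 l2 l3"
proof -
  \<comment> \<open>The image coordinates are the old ones times these four constants, and
    \<open>K\<close> exceeds the valuation of each.\<close>
  define K where "K = 1 + multiplicity q (d1 * d2 * d3) + multiplicity q (s1 * r * d2) +
    multiplicity q (s2 * r * d1) + multiplicity q (s3 * d1 * d2)"
  show ?thesis
  proof (rule loc_sol_weaken_primitive[OF assms(1), where K = K])
    fix N
    obtain t u1 u2 u3 where nd: "primitive q t u1 u2 u3"
      and eq: "cov_eqs (q^N) a1 a2 a3 d1 d2 d3 t u1 u2 u3" using sol unfolding loc_sol_def by blast
    define T U1 U2 U3 where "T = d1 * d2 * d3 * u3" "U1 = s1 * r * d2 * u2" "U2 = s2 * r * d1 * u1"
      "U3 = s3 * d1 * d2 * t"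
    note TU = T_U1_U2_U3_def
    have d: "q^N dvd a1 * T^2 + l2 * U2^2 - l3 * U3^2" "q^N dvd a2 * T^2 + l3 * U3^2 - l1 * U1^2"
      unfolding TU translate_identities[OF id] using eq unfolding cov_eqs_def by (simp_all only: dvd_mult)
    have "cov_eqs (q^N) a1 a2 a3 l1 l2 l3 T U1 U2 U3"
      using d by (intro cov_eqsI[OF assms(2)]) (metis cong_iff_dvd_diff cong_sym)+
    moreover have "\<not> (q^K dvd T \<and> q^K dvd U1 \<and> q^K dvd U2 \<and> q^K dvd U3)"
    proof
      assume h: "q^K dvd T \<and> q^K dvd U1 \<and> q^K dvd U2 \<and> q^K dvd U3"
      have "q dvd u3" "q dvd u2" "q dvd u1" "q dvd t"
        using h assms(1,3-9) unfolding TU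
        by (auto intro!: prime_dvd_of_power_dvd_mult[OF assms(1), of "d1 * d2 * d3" K u3]
          prime_dvd_of_power_dvd_mult[OF assms(1), of "s1 * r * d2" K u2]
          prime_dvd_of_power_dvd_mult[OF assms(1), of "s2 * r * d1" K u1]
          prime_dvd_of_power_dvd_mult[OF assms(1), of "s3 * d1 * d2" K t] simp: K_def)
      thus False using nd by blast
    qed
    ultimately show "primitive_sol (q^K) (q^N) a1 a2 a3 l1 l2 l3" by blast
  qed
qed

lemma real_cov_translate:
  assumes "a1 + a2 + a3 = 0" "d1 \<noteq> 0" "d2 \<noteq> 0" "d3 \<noteq> 0" "s1 \<noteq> 0" "s2 \<noteq> 0" "s3 \<noteq> 0" "r \<noteq> 0"
    and id: "d1 * d2 * d3 = r^2" "a2 * d1 = l1 * s1^2" "- a1 * d2 = l2 * s2^2" "- a1 * a2 * d3 = l3 * s3^2"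
    and sol: "real_cov a1 a2 a3 d1 d2 d3"
  shows "real_cov a1 a2 a3 l1 l2 l3"
proof -
  obtain t u1 u2 u3 :: real where nd: "\<not> (t = 0 \<and> u1 = 0 \<and> u2 = 0 \<and> u3 = 0)"
    and e: "a1 * t^2 + d2 * u2^2 - d3 * u3^2 = 0" "a2 * t^2 + d3 * u3^2 - d1 * u1^2 = 0"
    using sol unfolding real_cov_def by blast
  have id': "real_of_int d1 * d2 * d3 = (real_of_int r)^2" "real_of_int a2 * d1 = l1 * (real_of_int s1)^2"
    "- real_of_int a1 * d2 = l2 * (real_of_int s2)^2" "- real_of_int a1 * a2 * d3 = l3 * (real_of_int s3)^2"
    using id[THEN arg_cong[of _ _ real_of_int]] by simp_all
  define T U1 U2 U3 where "T = real_of_int d1 * d2 * d3 * u3" "U1 = real_of_int s1 * r * d2 * u2"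
    "U2 = real_of_int s2 * r * d1 * u1" "U3 = real_of_int s3 * d1 * d2 * t"
  note TU = T_U1_U2_U3_def
  have d: "a1 * T^2 + l2 * U2^2 - l3 * U3^2 = 0" "a2 * T^2 + l3 * U3^2 - l1 * U1^2 = 0"
    unfolding TU translate_identities[OF id'] e by simp_all
  have "real_of_int a3 = - a1 - a2" using assms(1) by (simp add: eq_diff_eq' flip: of_int_add of_int_diff of_int_minus)
  hence "a3 * T^2 = - (a1 * T^2) - a2 * T^2" by (simp add: left_diff_distrib)
  hence "a3 * T^2 + l1 * U1^2 - l2 * U2^2 = 0" using d by linarith
  moreover have "\<not> (T = 0 \<and> U1 = 0 \<and> U2 = 0 \<and> U3 = 0)" using nd assms(2-8) unfolding TU by auto
  ultimately show ?thesis using d unfolding real_cov_def by blast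
qed

lemma Sel2_translate:
  assumes "e1 + e2 + e3 = 0" "e1 \<noteq> 0" "e2 \<noteq> 0" "m \<noteq> 0" "(d1, d2, d3) \<in> Sel2 e1 e2 e3 m"
  shows "(sqf (e2 * m * d1), sqf (- e1 * m * d2), sqf (- e1 * e2 * d3)) \<in> Sel2 e1 e2 e3 m"
proof -
  note S = assms(5)[unfolded Sel2_iff]
  obtain r where r: "d1 * d2 * d3 = r^2" using S by blast
  have nz: "e2 * m * d1 \<noteq> 0" "- e1 * m * d2 \<noteq> 0" "- e1 * e2 * d3 \<noteq> 0" "r \<noteq> 0" using S assms r by auto
  define l1 l2 l3 where "l1 = sqf (e2 * m * d1)" "l2 = sqf (- e1 * m * d2)" "l3 = sqf (- e1 * e2 * d3)"
  note l = l1_l2_l3_def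
  obtain s1 where s1: "squarefree l1" "e2 * m * d1 = l1 * s1^2" "s1 \<noteq> 0" "l1 \<noteq> 0" unfolding l using sqf_decompose nz(1) by blast
  obtain s2 where s2: "squarefree l2" "- e1 * m * d2 = l2 * s2^2" "s2 \<noteq> 0" "l2 \<noteq> 0" unfolding l using sqf_decompose nz(2) by blast
  obtain s3 where s3: "squarefree l3" "- e1 * e2 * d3 = l3 * s3^2" "s3 \<noteq> 0" "l3 \<noteq> 0" unfolding l using sqf_decompose nz(3) by blast
  \<comment> \<open>The torsion entry \<open>- e1 * e2\<close> lacks the factor \<open>m^2\<close>
    of the product of the twisted coefficients; it is moved into the square.\<close>
  have s3': "- (e1 * m) * (e2 * m) * d3 = l3 * (m * s3)^2" 
  proof -
    have "l3 * (m * s3)^2 = m^2 * (l3 * s3^2)" by (simp add: power_mult_distrib mult_ac)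
    also have "\<dots> = m^2 * (- e1 * e2 * d3)" by (simp only: s3(2))
    finally show ?thesis by (simp add: power2_eq_square mult_ac)
  qed
  have s2': "- (e1 * m) * d2 = l2 * s2^2" using s2(2) by simp
  have sum: "e1 * m + e2 * m + e3 * m = 0" using assms(1) by (metis distrib_right mult_zero_left)
  have ms: "m * s3 \<noteq> 0" using assms s3 by simp
  have "(l1 * l2 * l3) * (s1 * s2 * s3)^2 = (l1 * s1^2) * (l2 * s2^2) * (l3 * s3^2)"
    by (simp add: power_mult_distrib mult_ac)
  also have "\<dots> = (e1 * e2 * m)^2 * (d1 * d2 * d3)"
    unfolding s1(2)[symmetric] s2(2)[symmetric] s3(2)[symmetric] by (simp add: power2_eq_square mult_ac)
  also have "\<dots> = (e1 * e2 * m * r)^2" unfolding r by (simp add: power_mult_distrib)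
  finally obtain v where v: "l1 * l2 * l3 = v^2" using int_square_quotient s1 s2 s3 by (metis mult_eq_0_iff)
  have "real_cov (e1 * m) (e2 * m) (e3 * m) l1 l2 l3"
    using real_cov_translate[OF sum _ _ _ s1(3) s2(3) ms nz(4) r s1(2) s2' s3'] S by blast
  moreover have "loc_sol q (e1 * m) (e2 * m) (e3 * m) l1 l2 l3" if "prime q" for q
    using loc_sol_translate[OF that sum _ _ _ s1(3) s2(3) ms nz(4) r s1(2) s2' s3'] S that by blast
  ultimately show ?thesis unfolding l[symmetric] Sel2_iff using s1 s2 s3 v by blast
qed

lemma sel_class_subset_Sel2:
  assumes "e1 + e2 + e3 = 0" "e1 \<noteq> 0" "e2 \<noteq> 0" "e3 \<noteq> 0" "m \<noteq> 0" "L \<in> Sel2 e1 e2 e3 m"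
  shows "sel_class e1 e2 e3 m L \<subseteq> Sel2 e1 e2 e3 m"
proof -
  obtain d1 d2 d3 where L: "L = (d1, d2, d3)" by (cases L)
  have S: "(d1, d2, d3) \<in> Sel2 e1 e2 e3 m" using assms L by simp
  have nz: "d1 \<noteq> 0" "d2 \<noteq> 0" "d3 \<noteq> 0" "squarefree d1" "squarefree d2" "squarefree d3" using S unfolding Sel2_iff by auto
  have t0: "tmul L (1, 1, 1) = L" using L nz by (simp add: tmul_def sqf_of_squarefree)
  have t3: "tmul L (tsqf (e2 * m, -e1 * m, -e1 * e2)) \<in> Sel2 e1 e2 e3 m"
    using Sel2_translate[OF assms(1-3,5) S] assms nz by (simp add: L tmul_def tsqf_def sqf_mult_sqf)
  have "(d2, d3, d1) \<in> Sel2 e2 e3 e1 m" by (rule Sel2_rotate[OF S])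
  hence "(sqf (e3 * m * d2), sqf (- e2 * m * d3), sqf (- e2 * e3 * d1)) \<in> Sel2 e2 e3 e1 m"
    using assms by (intro Sel2_translate) auto
  hence t2: "tmul L (tsqf (-e2 * e3, e3 * m, -e2 * m)) \<in> Sel2 e1 e2 e3 m"
    using assms nz Sel2_rotate[OF Sel2_rotate] by (simp add: L tmul_def tsqf_def sqf_mult_sqf)
  have "(d3, d1, d2) \<in> Sel2 e3 e1 e2 m" by (rule Sel2_rotate[OF Sel2_rotate[OF S]])
  hence "(sqf (e1 * m * d3), sqf (- e3 * m * d1), sqf (- e3 * e1 * d2)) \<in> Sel2 e3 e1 e2 m"
    using assms by (intro Sel2_translate) auto
  hence t1: "tmul L (tsqf (-e3 * m, -e1 * e3, e1 * m)) \<in> Sel2 e1 e2 e3 m"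
    using assms nz Sel2_rotate by (simp add: L tmul_def tsqf_def sqf_mult_sqf mult.commute[of e1 e3])
  show ?thesis unfolding sel_class_def Tors_def using t0 t1 t2 t3 assms(6) by auto
qed

lemma one_in_Sel2: "(1, 1, 1) \<in> Sel2 e1 e2 e3 m"
proof -
  have "loc_sol q a1 a2 a3 1 1 1" if "prime q" for q a1 a2 a3
    unfolding loc_sol_def cov_eqs_def using that
    by (intro allI exI[of _ 0] exI[of _ 1]) (auto simp: not_prime_unit)
  moreover have "real_cov a1 a2 a3 1 1 1" for a1 a2 a3
    unfolding real_cov_def by (intro exI[of _ 0] exI[of _ 1]) auto
  moreover have "1 * 1 * 1 = (1::int)^2" by simp
  ultimately show ?thesis unfolding Sel2_iff by (metis squarefree_1 zero_neq_one)
qed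

lemma even_iff_odd_multiplicity: "squarefree (d::int) \<Longrightarrow> even d \<longleftrightarrow> odd (multiplicity 2 d)"
  using squarefree_multiplicity[OF _ prime_int_2, of d] by simp

lemma even_sqf_mult_sqf:
  assumes "squarefree d" "x \<noteq> 0"
  shows "even (sqf (d * sqf x)) \<longleftrightarrow> even d \<noteq> odd (multiplicity 2 x)"
proof -
  have "d \<noteq> 0" using assms by auto
  thus ?thesis using assms even_iff_odd_multiplicity[of d]
    by (simp add: sqf_mult_sqf prime_dvd_sqf_iff[OF prime_int_2] multiplicity_mult_int[OF prime_int_2]) blast
qed

text \<open>A converse to \<open>square_product_dvd_pattern\<close>: the divisibility pattern
  identifies \<open>x\<close> up to sign with the square-free part of \<open>y * z\<close>, and
  positivity fixes the sign.\<close>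

lemma square_productI:
  fixes x y z :: int
  assumes "squarefree x" "squarefree y" "squarefree z" "x * y * z > 0"
    and "\<And>q. prime q \<Longrightarrow> q dvd x \<longleftrightarrow> (q dvd y) \<noteq> (q dvd z)"
  obtains s where "x * y * z = s^2"
proof -
  have nz: "x \<noteq> 0" "y \<noteq> 0" "z \<noteq> 0" using assms by auto
  obtain t where t: "squarefree (sqf (y * z))" "y * z = sqf (y * z) * t^2" "t \<noteq> 0" "sqf (y * z) \<noteq> 0"
    using sqf_decompose[of "y * z"] nz by auto
  have "q dvd sqf (y * z) \<longleftrightarrow> q dvd x" if q: "prime q" for q
    using assms(5)[OF q] squarefree_multiplicity[OF assms(2) q] squarefree_multiplicity[OF assms(3) q] nz
    by (simp add: prime_dvd_sqf_iff[OF q] multiplicity_mult_int[OF q])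
  hence "x dvd sqf (y * z)" "sqf (y * z) dvd x" using squarefree_dvdI assms(1) t nz by blast+
  hence "\<bar>x\<bar> = \<bar>sqf (y * z)\<bar>" by (rule zdvd_antisym_abs)
  moreover have "(x * sqf (y * z)) * t^2 > 0" using assms(4) t(2) by (metis mult.assoc)
  hence "x * sqf (y * z) > 0" using t(3) by (intro zero_less_mult_pos2[of "x * sqf (y * z)" "t^2"]) auto
  ultimately have "x = sqf (y * z)" by (auto simp: zero_less_mult_iff abs_if split: if_splits)
  hence "x * y * z = (x * t)^2" using t(2) by (simp add: mult.assoc power2_eq_square mult_ac)
  thus ?thesis by (rule that)
qed

text \<open>To be read with \<open>x\<close>, \<open>y\<close> the parities of \<open>d2\<close>,
  \<open>d3\<close> and \<open>v\<close> that of the valuation of \<open>e3\<close> at 2, which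
  decides which of the middle two translates becomes odd.\<close>

lemma ex1_of_four:
  assumes "S = {a, b, c, d}" "P a \<longleftrightarrow> \<not> x \<and> \<not> y" "P b \<longleftrightarrow> x = v \<and> y" "P c \<longleftrightarrow> x = (\<not> v) \<and> y" "P d \<longleftrightarrow> x \<and> \<not> y"
  shows "\<exists>!L. L \<in> S \<and> P L"
  unfolding assms(1) using assms(2-5) by (cases x; cases y; cases v) auto

lemma mod_4_abs_eq:
  fixes x y :: int
  assumes "\<bar>x\<bar> = \<bar>y\<bar>" "x mod 4 = 1" "y mod 4 = 1"
  shows "x = y"
  using assms by (auto simp: abs_if split: if_splits) presburger+

lemma prod_split_index:
  fixes f :: "nat \<Rightarrow> int"
  assumes "finite J"
  shows "(\<Prod>j\<in>J. f j) = (if i \<in> J then f i else 1) * (\<Prod>j\<in>J - {i}. f j)"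
  using prod.remove[OF assms, of i f] by (cases "i \<in> J") auto

text \<open>A prime dividing exactly two of the \<open>di\<close> must divide the coefficient in the
  equation that contains both.\<close>

lemma Sel2_unramified:
  assumes "(d1, d2, d3) \<in> Sel2 e1 e2 e3 m" "prime q" "\<not> q dvd e1 * m" "\<not> q dvd e2 * m" "\<not> q dvd e3 * m"
  shows "\<not> q dvd d1 \<and> \<not> q dvd d2 \<and> \<not> q dvd d3"
proof -
  note S = assms(1)[unfolded Sel2_iff]
  obtain s where s: "d1 * d2 * d3 = s^2" using S by blast
  have sf: "\<not> q^2 dvd d1" "\<not> q^2 dvd d2" "\<not> q^2 dvd d3" using S squarefree_not_dvd assms(2) by blast+
  have pat: "q dvd d1 \<longleftrightarrow> (q dvd d2) \<noteq> (q dvd d3)"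
    by (rule square_product_dvd_pattern[OF assms(2) s _ _ _ sf]) (use S in auto)
  have sol: "loc_sol q (e1 * m) (e2 * m) (e3 * m) d1 d2 d3" using S assms(2) by blast
  have "\<not> (q dvd d1 \<and> q dvd d3 \<and> \<not> q dvd d2)"
    using not_loc_sol_ramified[OF assms(2) assms(4), of d1 d3 d2] sf sol by blast
  moreover have "\<not> (q dvd d2 \<and> q dvd d1 \<and> \<not> q dvd d3)"
    using not_loc_sol_ramified[OF assms(2) assms(5), of d2 d1 d3] sf loc_sol_rotate[OF sol] by blast
  moreover have "\<not> (q dvd d3 \<and> q dvd d2 \<and> \<not> q dvd d1)"
    using not_loc_sol_ramified[OF assms(2) assms(3), of d3 d2 d1] sf loc_sol_rotate[OF loc_sol_rotate[OF sol]] by blast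
  ultimately show ?thesis using pat by blast
qed

lemma not_dvd_twisted:
  assumes "prime q" "\<not> q dvd e1 * e2 * e3" "\<not> q dvd m"
  shows "\<not> q dvd e1 * m" "\<not> q dvd e2 * m" "\<not> q dvd e3 * m"
  using assms by (auto simp: prime_dvd_mult_iff)

text \<open>For Selmer triples \<open>d1\<close> is then odd as well, by the square product.\<close>

definition odd_rep :: "triple \<Rightarrow> bool" where
  "odd_rep L = (case L of (d1, d2, d3) \<Rightarrow> odd d2 \<and> odd d3)"

subsection \<open>Conditions at a prime dividing the twist\<close>

lemma ex_less_3: "(\<exists>i<3::nat. P i) \<longleftrightarrow> P 0 \<or> P 1 \<or> P 2"
  by (auto simp: numeral_eq_Suc less_Suc_eq)

lemma padic_sol_conic_iff:
  "padic_sol q 3 (\<lambda>x. [a * (x 0)^2 + b * (x 1)^2 - (x 2)^2]) \<longleftrightarrow>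
   (\<forall>N. \<exists>x y z. \<not> (int q dvd x \<and> int q dvd y \<and> int q dvd z) \<and> int q ^ N dvd a * x^2 + b * y^2 - z^2)"
proof -
  have "(\<exists>x::nat \<Rightarrow> int. (\<exists>i<3. \<not> int q dvd x i) \<and> (\<forall>v\<in>set [a * (x 0)^2 + b * (x 1)^2 - (x 2)^2]. int q ^ N dvd v)) \<longleftrightarrow>
    (\<exists>x y z. \<not> (int q dvd x \<and> int q dvd y \<and> int q dvd z) \<and> int q ^ N dvd a * x^2 + b * y^2 - z^2)" (is "?L = ?R") for N
  proof
    assume ?L
    then obtain x :: "nat \<Rightarrow> int" where "\<exists>i<3. \<not> int q dvd x i" "int q ^ N dvd a * (x 0)^2 + b * (x 1)^2 - (x 2)^2" by auto
    thus ?R unfolding ex_less_3 by blast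
  next
    assume ?R
    then obtain x y z where "\<not> (int q dvd x \<and> int q dvd y \<and> int q dvd z)" "int q ^ N dvd a * x^2 + b * y^2 - z^2" by blast
    thus ?L unfolding ex_less_3
      by (intro exI[of _ "\<lambda>i. if i = 0 then x else if i = 1 then y else z"]) auto
  qed
  thus ?thesis unfolding padic_sol_def by blast
qed

text \<open>Evaluates the off-diagonal entries of \<open>A\<close>, where \<open>b\<close> is
  \<open>- n\<close>.\<close>

lemma hilb_add_unit:
  assumes "prime (int q)" "2 < int q" "\<not> int q dvd a" "int q dvd b" "\<not> (int q)^2 dvd b"
  shows "hilb_add q a b = 0 \<longleftrightarrow> Legendre a (int q) = 1"
proof -
  obtain b' where b: "b = int q * b'" "\<not> int q dvd b'"
    using assms(4,5) by (auto simp: power2_eq_square elim!: dvdE)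
  have "padic_sol q 3 (\<lambda>x. [a * (x 0)^2 + b * (x 1)^2 - (x 2)^2]) \<longleftrightarrow> Legendre a (int q) = 1"
    unfolding padic_sol_conic_iff
  proof
    assume L: "Legendre a (int q) = 1"
    show "\<forall>N. \<exists>x y z. \<not> (int q dvd x \<and> int q dvd y \<and> int q dvd z) \<and> int q ^ N dvd a * x^2 + b * y^2 - z^2"
    proof
      fix N
      obtain z where z: "[1 * z^2 = a] (mod int q ^ N)" using lift_sqrt[OF assms(1,2), of 1 a N] L by auto
      hence "int q ^ N dvd a * 1^2 + b * 0^2 - z^2" by (simp add: cong_iff_dvd_diff dvd_diff_commute)
      moreover have "\<not> int q dvd 1" using assms(1) not_prime_unit by blast
      ultimately show "\<exists>x y z. \<not> (int q dvd x \<and> int q dvd y \<and> int q dvd z) \<and> int q ^ N dvd a * x^2 + b * y^2 - z^2"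
        by blast
    qed
  next
    assume "\<forall>N. \<exists>x y z. \<not> (int q dvd x \<and> int q dvd y \<and> int q dvd z) \<and> int q ^ N dvd a * x^2 + b * y^2 - z^2"
    hence "hilbert (int q) a b = 1" using assms(2,3) b by (intro hilbert_of_isotropic[OF assms(1,2), where K = 1]) auto
    thus "Legendre a (int q) = 1" using hilbert_unit_left[OF assms(1,3) b(2), of 1] by (simp add: b)
  qed
  thus ?thesis by (simp add: hilb_add_def)
qed

text \<open>Evaluates the diagonal entries of \<open>A\<close>: the symbol of \<open>q\<close> and
  \<open>- q\<close> is trivial, so that of \<open>q\<close> and \<open>- q c\<close> is the residue
  symbol of \<open>c\<close>.\<close>

lemma hilb_add_ramified:
  assumes "prime (int q)" "2 < int q" "\<not> int q dvd c"
  shows "hilb_add q (int q) (- (int q * c)) = 0 \<longleftrightarrow> Legendre c (int q) = 1"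
proof -
  have q0: "int q \<noteq> 0" using assms(2) by auto
  have "padic_sol q 3 (\<lambda>x. [int q * (x 0)^2 + (- (int q * c)) * (x 1)^2 - (x 2)^2]) \<longleftrightarrow> Legendre c (int q) = 1"
    unfolding padic_sol_conic_iff
  proof
    assume L: "Legendre c (int q) = 1"
    show "\<forall>N. \<exists>x y z. \<not> (int q dvd x \<and> int q dvd y \<and> int q dvd z) \<and>
      int q ^ N dvd int q * x^2 + (- (int q * c)) * y^2 - z^2"
    proof
      fix N
      obtain x where x: "[1 * x^2 = c] (mod int q ^ N)" using lift_sqrt[OF assms(1,2), of 1 c N] L by auto
      hence "int q ^ N dvd x^2 - c" by (simp add: cong_iff_dvd_diff)
      hence "int q ^ N dvd int q * (x^2 - c)" by (rule dvd_mult)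
      hence "int q ^ N dvd int q * x^2 + (- (int q * c)) * 1^2 - 0^2" by (simp add: algebra_simps)
      moreover have "\<not> int q dvd 1" using assms(1) not_prime_unit by blast
      ultimately show "\<exists>x y z. \<not> (int q dvd x \<and> int q dvd y \<and> int q dvd z) \<and>
        int q ^ N dvd int q * x^2 + (- (int q * c)) * y^2 - z^2" by blast
    qed
  next
    assume "\<forall>N. \<exists>x y z. \<not> (int q dvd x \<and> int q dvd y \<and> int q dvd z) \<and>
      int q ^ N dvd int q * x^2 + (- (int q * c)) * y^2 - z^2"
    hence "hilbert (int q) (int q) (- (int q * c)) = 1"
      using assms(3) q0 by (intro hilbert_of_isotropic[OF assms(1,2), where K = 1]) auto
    moreover have "hilbert (int q) (int q ^ 1 * 1) (int q ^ 1 * - c) =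
        Legendre (-1) (int q) ^ (1 * 1) * Legendre 1 (int q) ^ 1 * Legendre (- c) (int q) ^ 1"
      using assms(1,3) not_prime_unit by (intro hilbert_eq) auto
    moreover have "Legendre (-1 * - c) (int q) = Legendre (-1) (int q) * Legendre (- c) (int q)"
      by (rule Legendre_mult[OF assms(1,2)])
    ultimately show "Legendre c (int q) = 1" using Legendre_1[OF assms(1)] by simp
  qed
  thus ?thesis by (simp add: hilb_add_def)
qed

text \<open>Turns sums of bits into products of signs, so that rows of the matrix can be compared
  with products of Legendre symbols.\<close>

definition pm :: "bit \<Rightarrow> int" where "pm b = (if b = 0 then 1 else -1)"

lemma pm_eq_1_iff: "pm b = 1 \<longleftrightarrow> b = 0" by (simp add: pm_def)

lemma pm_add: "pm (a + b) = pm a * pm b"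
  by (cases a; cases b) (simp_all add: pm_def)

lemma pm_mult: "pm (a * b) = (if b = 0 then 1 else pm a)"
  by (cases a; cases b) (simp_all add: pm_def)

lemma pm_sum: "finite A \<Longrightarrow> pm (\<Sum>j\<in>A. f j) = (\<Prod>j\<in>A. pm (f j))"
proof (induction A rule: finite_induct)
  case empty
  thus ?case by (simp add: pm_def)
next
  case (insert x F)
  thus ?case by (simp only: sum.insert prod.insert pm_add not_False_eq_True)
qed

lemma pm_of_iff: "(b = 0 \<longleftrightarrow> Legendre a q = 1) \<Longrightarrow> \<not> q dvd a \<Longrightarrow> pm b = Legendre a q"
  using Legendre_unit[of q a] by (auto simp: pm_def)

lemma pm_lsym: "\<not> int q dvd u \<Longrightarrow> pm (lsym u q) = Legendre u (int q)"
  by (rule pm_of_iff) (auto simp: lsym_def Legendre_eq_1_iff)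

lemma Legendre_prod:
  assumes "prime q" "2 < q" "finite A"
  shows "Legendre (\<Prod>j\<in>A. f j) q = (\<Prod>j\<in>A. Legendre (f j) q)"
  using assms(3) by (induction A rule: finite_induct) (simp_all add: Legendre_1[OF assms(1)] Legendre_mult[OF assms(1,2)])

lemma Legendre_chi4_self:
  assumes "prime q" "2 < q"
  shows "Legendre (chi4 q) q = Legendre (-1) q"
  using Legendre_minus_one[OF assms] Legendre_1[OF assms(1)] chi4_values[of q] by auto

text \<open>The factor \<open>chi4 r\<close> absorbs the sign in quadratic reciprocity.\<close>

lemma Legendre_star_reciprocity:
  assumes "prime q" "2 < q" "prime r" "2 < r" "q \<noteq> r"
  shows "Legendre (chi4 r * r) q = Legendre q r"
proof -
  have nd: "\<not> q dvd r" "\<not> r dvd q" using assms primes_dvd_imp_eq by blast+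
  have "Legendre (chi4 r) q = neg_sym (chi4 r = -1) (chi4 q = -1)"
    using chi4_values[of r] Legendre_1[OF assms(1)] Legendre_minus_one[OF assms(1,2)] chi4_values[of q]
    by (auto simp: neg_sym_def)
  also have "\<dots> = Legendre r q * Legendre q r" using reciprocity_neg_sym[OF assms(3,4,1,2)] assms(5) by auto
  finally have "Legendre (chi4 r * r) q = Legendre r q * Legendre q r * Legendre r q"
    using Legendre_mult[OF assms(1,2)] by simp
  thus ?thesis using Legendre_unit[OF nd(1)] by auto
qed

text \<open>\<open>Y\<close> and \<open>Z\<close> record whether \<open>q\<close> divides
  \<open>d2\<close> and \<open>d3\<close>, and \<open>D2\<close>, \<open>D3\<close> collect the
  other primes, with the sign \<open>chi4 q\<close> kept apart so that \<open>D3\<close> can be a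
  product of \<open>p*\<close>. Either no \<open>di\<close> is divisible by \<open>q\<close> or
  exactly two are, and then a rotation gives the shape of
  \<open>loc_sol_twisted_ramified\<close>.\<close>

lemma loc_sol_iff_rows:
  fixes q n' :: int
  assumes q: "prime q" "2 < q" and sum: "e1 + e2 + e3 = 0"
    and ne: "\<not> q dvd e1" "\<not> q dvd e2" "\<not> q dvd e3" and nn: "\<not> q dvd n'" and nD: "\<not> q dvd D2" "\<not> q dvd D3"
    and d2: "d2 = (if Y then q else 1) * D2" and d3: "d3 = (if Z then chi4 q * q else 1) * D3"
    and d1: "d1 \<noteq> 0" "\<not> q^2 dvd d1" and s: "d1 * d2 * d3 = s^2"
  shows "loc_sol q (e1 * (q * n')) (e2 * (q * n')) (e3 * (q * n')) d1 d2 d3 \<longleftrightarrow>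
    (if Y then Legendre n' q else 1) * Legendre D2 q * (if Y then Legendre (- e1) q else 1) *
      (if Z then Legendre (- e1 * e3) q else 1) = 1 \<and>
    (if Y then Legendre (- e1 * e2) q else 1) * ((if Z then Legendre n' q else 1) * Legendre D3 q) *
      (if Z then Legendre (- e1) q else 1) = 1"
proof -
  note mul = Legendre_mult[OF q]
  define h where "h = chi4 q * D3"
  have q0: "q \<noteq> 0" using q by auto
  have n1: "\<not> q dvd -1" using q by auto
  have nh: "\<not> q dvd h" unfolding h_def using nD chi4_values[of q] by auto
  have Lh: "Legendre h q = Legendre (-1) q * Legendre D3 q"
    unfolding h_def mul Legendre_chi4_self[OF q] by simp
  have neg: "Legendre (- x) q = Legendre (-1) q * Legendre x q" for x using mul[of "-1" x] by simp
  note negs = neg[of e1] neg[of "e1 * n'"] neg[of "e2 * n'"] neg[of "e3 * n'"] mul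
  have pm: "Legendre (-1) q = 1 \<or> Legendre (-1) q = -1" "Legendre e1 q = 1 \<or> Legendre e1 q = -1"
    "Legendre e2 q = 1 \<or> Legendre e2 q = -1" "Legendre e3 q = 1 \<or> Legendre e3 q = -1"
    "Legendre n' q = 1 \<or> Legendre n' q = -1" "Legendre D2 q = 1 \<or> Legendre D2 q = -1"
    "Legendre D3 q = 1 \<or> Legendre D3 q = -1"
    using Legendre_unit n1 ne nn nD by auto
  have b: "e1 * n' + e2 * n' + e3 * n' = 0" using sum by (metis distrib_right mult_zero_left)
  have nb: "\<not> q dvd e1 * n'" "\<not> q dvd e2 * n'" "\<not> q dvd e3 * n'" using ne nn q(1) by (auto simp: prime_dvd_mult_iff)
  have a: "e * (q * n') = q * (e * n')" for e by simp
  have d3': "d3 = (if Z then q * h else D3)" using d3 by (simp add: h_def)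
  have d2': "d2 = (if Y then q * D2 else D2)" using d2 by simp
  have nsq: "\<not> q^2 dvd q * x" if "\<not> q dvd x" for x using that q0 by (simp add: power2_eq_square)
  have nsq1: "\<not> q^2 dvd x" if "\<not> q dvd x" for x using that by (metis dvd_trans dvd_power zero_less_numeral)
  have "q dvd d1 \<longleftrightarrow> (q dvd d2) \<noteq> (q dvd d3)"
    by (rule square_product_dvd_pattern[OF q(1) s d1(1) _ _ d1(2)])
      (use nsq nsq1 nD nh q0 in \<open>auto simp: d2' d3'\<close>)
  hence pat: "q dvd d1 \<longleftrightarrow> Y \<noteq> Z" using nD nh by (auto simp: d2' d3')
  consider "\<not> Y" "\<not> Z" | "\<not> Y" "Z" | "Y" "\<not> Z" | "Y" "Z" by blast
  thus ?thesis
  proof cases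
    case 1
    have "loc_sol q (e1 * (q * n')) (e2 * (q * n')) (e3 * (q * n')) d1 d2 d3 \<longleftrightarrow> Legendre d2 q = 1 \<and> Legendre d3 q = 1"
    proof (rule loc_sol_twisted_units[OF q _ _ _ _ _ _ _ s])
      show "e1 * (q * n') + e2 * (q * n') + e3 * (q * n') = 0" using sum by (metis distrib_right mult_zero_left)
      show "\<not> q^2 dvd e1 * (q * n')" unfolding a using nsq nb by blast
    qed (use 1 pat nD in \<open>auto simp: d2' d3'\<close>)
    thus ?thesis using 1 by (simp add: d2' d3')
  next
    case 2
    then obtain c where c: "d1 = q * c" using pat by (auto elim: dvdE)
    have nc: "\<not> q dvd c" using d1(2) c q0 by (auto simp: power2_eq_square)
    have "(c * D2 * h) * q^2 = s^2" using s 2 by (simp add: c d2' d3' power2_eq_square mult_ac)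
    then obtain r where "c * D2 * h = r^2" using int_square_quotient q0 by blast
    hence pr: "Legendre c q * Legendre D2 q * Legendre h q = 1" using Legendre_of_square_product[OF q nc nD(1) nh] by blast
    have "loc_sol q (e1 * (q * n')) (e2 * (q * n')) (e3 * (q * n')) d1 d2 d3 \<longleftrightarrow>
      Legendre ((e1 * n') * h) q = 1 \<and> Legendre (- (e3 * n') * c) q = 1"
      using loc_sol_twisted_ramified[OF q b nb(1,3) nc nD(1) nh] 2 by (simp add: a c d2' d3')
    also have "\<dots> \<longleftrightarrow> Legendre D2 q * Legendre (- e1 * e3) q = 1 \<and>
        Legendre n' q * Legendre D3 q * Legendre (- e1) q = 1"
      \<comment> \<open>The square product \<open>pr\<close> eliminates the symbol of the cofactor
        \<open>c\<close> of \<open>d1\<close>; what remains is a check over the possible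
        signs.\<close>
      using pm pr Legendre_unit[OF nc] unfolding mul negs Lh by (elim disjE) simp_all
    finally show ?thesis using 2 by simp
  next
    case 3
    then obtain c where c: "d1 = q * c" using pat by (auto elim: dvdE)
    have nc: "\<not> q dvd c" using d1(2) c q0 by (auto simp: power2_eq_square)
    have "(c * D2 * D3) * q^2 = s^2" using s 3 by (simp add: c d2' d3' power2_eq_square mult_ac)
    then obtain r where "c * D2 * D3 = r^2" using int_square_quotient q0 by blast
    hence pr: "Legendre c q * Legendre D2 q * Legendre D3 q = 1" using Legendre_of_square_product[OF q nc nD] by blast
    have b': "e2 * n' + e3 * n' + e1 * n' = 0" using b by simp
    have "loc_sol q (e1 * (q * n')) (e2 * (q * n')) (e3 * (q * n')) d1 d2 d3 \<longleftrightarrow>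
      loc_sol q (q * (e2 * n')) (q * (e3 * n')) (q * (e1 * n')) (q * D2) D3 (q * c)"
      using 3 loc_sol_rotate_iff by (simp add: a c d2' d3')
    also have "\<dots> \<longleftrightarrow> Legendre ((e2 * n') * c) q = 1 \<and> Legendre (- (e1 * n') * D2) q = 1"
      by (rule loc_sol_twisted_ramified[OF q b' nb(2,1) nD nc])
    also have "\<dots> \<longleftrightarrow> Legendre n' q * Legendre D2 q * Legendre (- e1) q = 1 \<and>
        Legendre (- e1 * e2) q * Legendre D3 q = 1"
      using pm pr Legendre_unit[OF nc] unfolding mul negs by (elim disjE) simp_all
    finally show ?thesis using 3 by simp
  next
    case 4
    have nc: "\<not> q dvd d1" using pat 4 by blast
    have "(d1 * D2 * h) * q^2 = s^2" using s 4 by (simp add: d2' d3' power2_eq_square mult_ac)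
    then obtain r where "d1 * D2 * h = r^2" using int_square_quotient q0 by blast
    hence pr: "Legendre d1 q * Legendre D2 q * Legendre h q = 1" using Legendre_of_square_product[OF q nc nD(1) nh] by blast
    have b': "e3 * n' + e1 * n' + e2 * n' = 0" using b by simp
    have "loc_sol q (e1 * (q * n')) (e2 * (q * n')) (e3 * (q * n')) d1 d2 d3 \<longleftrightarrow>
      loc_sol q (q * (e3 * n')) (q * (e1 * n')) (q * (e2 * n')) (q * h) d1 (q * D2)"
      using 4 loc_sol_rotate_iff[of q "q * (e3 * n')" "q * (e1 * n')" "q * (e2 * n')" "q * h" d1 "q * D2"]
      by (simp add: a d2' d3' loc_sol_rotate_iff)
    also have "\<dots> \<longleftrightarrow> Legendre ((e3 * n') * D2) q = 1 \<and> Legendre (- (e2 * n') * h) q = 1"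
      by (rule loc_sol_twisted_ramified[OF q b' nb(3,2) nh nc nD(1)])
    also have "\<dots> \<longleftrightarrow> Legendre n' q * Legendre D2 q * Legendre (- e1) q * Legendre (- e1 * e3) q = 1 \<and>
        Legendre (- e1 * e2) q * (Legendre n' q * Legendre D3 q) * Legendre (- e1) q = 1"
      using pm unfolding mul negs Lh by (elim disjE) simp_all
    finally show ?thesis using 4 by simp
  qed
qed

subsection \<open>Normalised representatives of Selmer classes\<close>

text \<open>\<open>card_Sel\<close> expresses that the Selmer group of \<open>E\<close> is
  \<open>(Z/2)^2\<close>: it has exponent 2, so its order determines it.\<close>

locale twist =
  fixes e1 e2 e3 :: int and n k :: nat and p :: "nat \<Rightarrow> nat"
  assumes e_nz: "e1 \<noteq> 0" "e2 \<noteq> 0" "e3 \<noteq> 0" and e_sum: "e1 + e2 + e3 = 0"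
    and e1_2: "2 dvd e1" "\<not> 4 dvd e1" and e2_2: "2 dvd e2" "\<not> 4 dvd e2" and e3_4: "4 dvd e3"
    and prime_p: "\<forall>i<k. prime (p i)" and inj_p: "inj_on p {..<k}"
    and n_def: "n = (\<Prod>i<k. p i)" and odd_n: "odd n"
    and cop: "coprime (int n) (e1 * e2 * e3)"
    and res: "\<forall>i<k. \<forall>q::nat. prime q \<and> odd q \<and> int q dvd e1 * e2 * e3 \<longrightarrow> QuadRes (int q) (int (p i))"
    and sgn: "e3 > 0" "e1 < 0"
    and star: "\<forall>i<k. \<forall>q::nat. prime q \<and> odd q \<and> int q dvd e1 * e3 \<longrightarrow> Legendre (pstar (p i)) (int q) = 1"
    and card_Sel: "card (Sel2 e1 e2 e3 1) = 4"
begin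

abbreviation "loc_n q \<equiv> loc_sol q (e1 * int n) (e2 * int n) (e3 * int n)"

abbreviation "Sel_n \<equiv> Sel2 e1 e2 e3 (int n)"

abbreviation "class_n \<equiv> sel_class e1 e2 e3 (int n)"

lemma multiplicity_2_e: "multiplicity 2 e1 = 1" "multiplicity 2 e2 = 1"
  using e1_2 e2_2 by (auto intro!: multiplicity_eqI)

text \<open>With \<open>w\<close> the valuation of \<open>e3\<close> at 2, and those of
  \<open>e1\<close>, \<open>e2\<close> and \<open>m\<close> being 1, 1 and 0, the nontrivial torsion
  entries have valuations of parity \<open>(1 + w, 1)\<close>, \<open>(w, 1)\<close> and
  \<open>(1, 0)\<close> in the last two places. With \<open>(0, 0)\<close> these are four distinct
  vectors.\<close>

lemma tmul_tors_parity:
  assumes "odd m" "squarefree d1" "squarefree d2" "squarefree d3"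
  shows "\<exists>a b c. tmul (d1, d2, d3) (1, 1, 1) = (a, b, c) \<and> (even b \<longleftrightarrow> even d2) \<and> (even c \<longleftrightarrow> even d3)" (is ?P1)
    "\<exists>a b c. tmul (d1, d2, d3) (tsqf (-e3 * m, -e1 * e3, e1 * m)) = (a, b, c) \<and>
       (even b \<longleftrightarrow> even d2 \<noteq> even (multiplicity 2 e3)) \<and> (even c \<longleftrightarrow> odd d3)" (is ?P2)
    "\<exists>a b c. tmul (d1, d2, d3) (tsqf (-e2 * e3, e3 * m, -e2 * m)) = (a, b, c) \<and>
       (even b \<longleftrightarrow> even d2 \<noteq> odd (multiplicity 2 e3)) \<and> (even c \<longleftrightarrow> odd d3)" (is ?P3)
    "\<exists>a b c. tmul (d1, d2, d3) (tsqf (e2 * m, -e1 * m, -e1 * e2)) = (a, b, c) \<and>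
       (even b \<longleftrightarrow> odd d2) \<and> (even c \<longleftrightarrow> even d3)" (is ?P4)
proof -
  have m: "m \<noteq> 0" "multiplicity 2 m = 0" using assms(1) by (auto simp: not_dvd_imp_multiplicity_0)
  note mm = multiplicity_mult_int[OF prime_int_2]
  show ?P1
    using assms by (simp add: tmul_def sqf_of_squarefree)
  show ?P2
    using assms e_nz m multiplicity_2_e by (simp add: tmul_def tsqf_def even_sqf_mult_sqf mm)
  show ?P3
    using assms e_nz m multiplicity_2_e by (simp add: tmul_def tsqf_def even_sqf_mult_sqf mm)
  show ?P4
    using assms e_nz m multiplicity_2_e by (simp add: tmul_def tsqf_def even_sqf_mult_sqf mm)
qed

lemma unique_odd_rep:
  assumes "odd m" "squarefree d1" "squarefree d2" "squarefree d3"
  shows "\<exists>!L'. L' \<in> sel_class e1 e2 e3 m (d1, d2, d3) \<and> odd_rep L'"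
proof -
  note P = tmul_tors_parity[OF assms]
  have "sel_class e1 e2 e3 m (d1, d2, d3) = {tmul (d1, d2, d3) (1, 1, 1),
    tmul (d1, d2, d3) (tsqf (-e3 * m, -e1 * e3, e1 * m)), tmul (d1, d2, d3) (tsqf (-e2 * e3, e3 * m, -e2 * m)),
    tmul (d1, d2, d3) (tsqf (e2 * m, -e1 * m, -e1 * e2))}"
    by (simp add: sel_class_def Tors_def)
  thus ?thesis
  proof (rule ex1_of_four[where x = "even d2" and y = "even d3" and v = "even (multiplicity 2 e3)"])
    show "odd_rep (tmul (d1, d2, d3) (1, 1, 1)) \<longleftrightarrow> \<not> even d2 \<and> \<not> even d3"
      using P(1) by (auto simp: odd_rep_def)
    show "odd_rep (tmul (d1, d2, d3) (tsqf (-e3 * m, -e1 * e3, e1 * m))) \<longleftrightarrow>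
      even d2 = even (multiplicity 2 e3) \<and> even d3" using P(2) by (auto simp: odd_rep_def)
    show "odd_rep (tmul (d1, d2, d3) (tsqf (-e2 * e3, e3 * m, -e2 * m))) \<longleftrightarrow>
      even d2 = odd (multiplicity 2 e3) \<and> even d3" using P(3) by (auto simp: odd_rep_def)
    show "odd_rep (tmul (d1, d2, d3) (tsqf (e2 * m, -e1 * m, -e1 * e2))) \<longleftrightarrow>
      even d2 \<and> \<not> even d3" using P(4) by (auto simp: odd_rep_def)
  qed
qed

lemma odd_Sel2_1:
  assumes "(d1, d2, d3) \<in> Sel2 e1 e2 e3 1" "odd d2" "odd d3"
  shows "d1 = 1 \<and> d2 = 1 \<and> d3 = 1"
proof -
  define C where "C = sel_class e1 e2 e3 1 (1, 1, 1)"
  have sf: "squarefree (1::int)" by simp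
  note P = tmul_tors_parity[OF odd_one sf sf sf]
  obtain t0 t1 t2 t3 where t: "tmul (1, 1, 1) (1, 1, 1) = t0"
     "tmul (1, 1, 1) (tsqf (-e3 * 1, -e1 * e3, e1 * 1)) = t1" "tmul (1, 1, 1) (tsqf (-e2 * e3, e3 * 1, -e2 * 1)) = t2"
     "tmul (1, 1, 1) (tsqf (e2 * 1, -e1 * 1, -e1 * e2)) = t3" by blast
  have C: "C = {t0, t1, t2, t3}" unfolding t[symmetric] by (simp add: C_def sel_class_def Tors_def)
  define par :: "triple \<Rightarrow> bool \<times> bool" where "par L = (case L of (d1, d2, d3) \<Rightarrow> (even d2, even d3))" for L
  have "par t0 = (False, False)" using P(1) t(1) by (auto simp: par_def)
  moreover have "par t1 = (even (multiplicity 2 e3), True)" unfolding t(2)[symmetric] using P(2) by (auto simp: par_def)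
  moreover have "par t2 = (odd (multiplicity 2 e3), True)" unfolding t(3)[symmetric] using P(3) by (auto simp: par_def)
  moreover have "par t3 = (True, False)" unfolding t(4)[symmetric] using P(4) by (auto simp: par_def)
  ultimately have "t0 \<noteq> t1" "t0 \<noteq> t2" "t0 \<noteq> t3" "t1 \<noteq> t2" "t1 \<noteq> t3" "t2 \<noteq> t3" by auto
  hence "card C = 4" unfolding C by simp
  moreover have "C \<subseteq> Sel2 e1 e2 e3 1" unfolding C_def
    by (rule sel_class_subset_Sel2) (use e_sum e_nz one_in_Sel2 in auto)
  moreover have "finite (Sel2 e1 e2 e3 1)" using card_Sel by (metis card.infinite zero_neq_numeral)
  ultimately have "C = Sel2 e1 e2 e3 1" using card_Sel by (intro card_subset_eq) auto
  hence "(d1, d2, d3) \<in> C" using assms by simp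
  moreover have "(1, 1, 1) \<in> C" unfolding C t(1)[symmetric] by (simp add: tmul_def sqf_1)
  ultimately have "(d1, d2, d3) = (1, 1, 1)"
    using unique_odd_rep[OF odd_one sf sf sf] assms(2,3) unfolding C_def[symmetric]
    by (metis (no_types, lifting) odd_one odd_rep_def prod.case)
  thus ?thesis by simp
qed

section \<open>Residue symbols of divisors of the twist\<close>

lemma n_pos: "n > 0" using odd_n by (cases n) auto

lemma prime_dvd_n_iff: "prime q \<Longrightarrow> q dvd int n \<longleftrightarrow> (\<exists>i<k. q = int (p i))"
proof -
  assume q: "prime q"
  have "q dvd int n \<longleftrightarrow> (\<exists>i<k. q dvd int (p i))"
    unfolding n_def using q by (simp add: prime_dvd_prod_iff Bex_def)
  also have "\<dots> \<longleftrightarrow> (\<exists>i<k. q = int (p i))"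
    using q prime_p primes_dvd_imp_eq[OF q] by (metis dvd_refl prime_nat_int_transfer)
  finally show ?thesis .
qed

lemma p_gt_2: "i < k \<Longrightarrow> 2 < p i"
proof -
  assume i: "i < k"
  have "p i dvd n" unfolding n_def using i by (intro dvd_prodI) auto
  hence "odd (p i)" using odd_n by auto
  thus ?thesis using prime_p i prime_ge_2_nat[of "p i"] by (cases "p i = 2") auto
qed

lemma squarefree_n: "squarefree (int n)"
proof -
  have "squarefree (\<Prod>i<k. int (p i))"
  proof (rule squarefree_prod_coprime)
    show "coprime (int (p i)) (int (p j))" if "i \<in> {..<k}" "j \<in> {..<k}" "i \<noteq> j" for i j
      using that prime_p inj_p by (auto simp: inj_on_def intro!: primes_coprime)
    show "squarefree (int (p i))" if "i \<in> {..<k}" for i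
      using that prime_p by (auto intro: squarefree_prime)
  qed
  thus ?thesis by (simp add: n_def)
qed

lemma not_dvd_n: "prime q \<Longrightarrow> q dvd e1 * e2 * e3 \<Longrightarrow> \<not> q dvd int n"
  using cop by (metis coprime_common_divisor not_prime_unit)

lemma Legendre_p:
  assumes "prime q" "2 < q" "q dvd e1 * e2 * e3" "i < k"
  shows "Legendre (int (p i)) q = 1"
proof -
  obtain r where q: "q = int r" "prime r" "odd r" using odd_prime_int_natE[OF assms(1,2)] .
  have "QuadRes q (int (p i))" using res q assms(3,4) by blast
  moreover have "\<not> q dvd int (p i)"
    using not_dvd_n[OF assms(1,3)] prime_dvd_n_iff[OF assms(1)] prime_p assms primes_dvd_imp_eq[OF assms(1)]
    by (metis prime_nat_int_transfer)
  ultimately show ?thesis by (simp add: Legendre_eq_1_iff)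
qed

lemma pos_divisor_induct:
  assumes "d > 0" "d dvd int n" "P 1" "\<And>i x. i < k \<Longrightarrow> P x \<Longrightarrow> P (int (p i) * x)"
  shows "P d"
  using assms(1,2)
proof (induction d rule: prime_divisors_induct)
  case zero
  thus ?case by simp
next
  case (unit x)
  thus ?case using assms(3) by simp
next
  case (factor r x)
  have "r > 0" using factor by (simp add: prime_gt_0_int)
  hence x: "x > 0" "x dvd int n" using factor.prems by (auto simp: zero_less_mult_iff dest: dvd_mult_right)
  have "r dvd int n" using factor.prems by (auto dest: dvd_mult_left)
  then obtain i where "i < k" "r = int (p i)" using prime_dvd_n_iff factor by blast
  thus ?case using factor.IH[OF x] assms(4) by simp
qed

lemma Legendre_pos_divisor:
  assumes "prime q" "2 < q" "q dvd e1 * e2 * e3" "d > 0" "d dvd int n"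
  shows "Legendre d q = 1"
  using assms(4,5)
  by (rule pos_divisor_induct)
    (simp_all add: Legendre_1[OF assms(1)] Legendre_mult[OF assms(1,2)] Legendre_p[OF assms(1-3)])

lemma mod_4_pos_divisor:
  assumes "\<And>i. i < k \<Longrightarrow> int (p i) mod 4 = 1" "d > 0" "d dvd int n"
  shows "d mod 4 = 1"
  using assms(2,3)
proof (rule pos_divisor_induct)
  fix i and x :: int assume "i < k" "x mod 4 = 1"
  thus "(int (p i) * x) mod 4 = 1" using assms(1) mod_mult_eq[of "int (p i)" 4 x] by simp
qed simp

lemma pstar_eq: "i < k \<Longrightarrow> pstar (p i) = chi4 (int (p i)) * int (p i)"
  using chi4_eq_power[of "p i"] p_gt_2 prime_p prime_odd_nat by (simp add: pstar_def)

text \<open>Either \<open>-1\<close> is a square modulo \<open>q\<close>, or the hypothesis on the \<open>p*\<close> forces every prime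
  factor of \<open>n\<close> to be 1 modulo 4.\<close>
lemma Legendre_divisor_1_mod_4:
  assumes "prime q" "2 < q" "q dvd e1 * e3" "d mod 4 = 1" "d dvd int n"
  shows "Legendre d q = 1"
proof -
  have q3: "q dvd e1 * e2 * e3" using assms(3) by (metis dvd_mult mult.assoc mult.commute)
  have d0: "d \<noteq> 0" using assms(4) by auto
  have abs: "Legendre \<bar>d\<bar> q = 1" using Legendre_pos_divisor[OF assms(1,2) q3] d0 assms(5) by simp
  show ?thesis
  proof (cases "d > 0")
    case True
    thus ?thesis using abs by simp
  next
    case False
    hence d: "d = -1 * \<bar>d\<bar>" by simp
    have n1: "\<not> q dvd -1" using assms(1) by auto
    have "Legendre (-1) q = 1"
    proof (rule ccontr)
      assume "Legendre (-1) q \<noteq> 1"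
      hence m: "Legendre (-1) q = -1" using Legendre_unit[OF n1] by auto
      have "int (p i) mod 4 = 1" if i: "i < k" for i
      proof (rule ccontr)
        assume h: "int (p i) mod 4 \<noteq> 1"
        obtain r where q: "q = int r" "prime r" "odd r" using odd_prime_int_natE[OF assms(1,2)] .
        have "Legendre (pstar (p i)) q = 1" using star i assms(3) q by blast
        moreover have "pstar (p i) = -1 * int (p i)" using pstar_eq[OF i] h by (simp add: chi4_def)
        ultimately have "Legendre (-1) q * Legendre (int (p i)) q = 1" using Legendre_mult[OF assms(1,2)] by metis
        thus False using m Legendre_p[OF assms(1,2) q3 i] by simp
      qed
      \<comment> \<open>Otherwise both \<open>d\<close> and \<open>- d\<close> would be 1 modulo
        4.\<close>
      hence "\<bar>d\<bar> mod 4 = 1" using mod_4_pos_divisor[of "\<bar>d\<bar>"] d0 assms(5) by simp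
      thus False using assms(4) False by (simp add: abs_if split: if_splits) presburger
    qed
    hence "Legendre (-1 * \<bar>d\<bar>) q = 1" using abs Legendre_mult[OF assms(1,2), of "-1" "\<bar>d\<bar>"] by simp
    thus ?thesis using d by simp
  qed
qed

section \<open>Odd Selmer triples consist of divisors of \<open>n\<close>\<close>

lemma twisted_2_adic: "2 dvd e1 * int n" "\<not> 4 dvd e1 * int n" "2 dvd e2 * int n" "\<not> 4 dvd e2 * int n" "4 dvd e3 * int n"
proof -
  have c: "coprime (4::int) (int n)" using odd_n coprime_power_left_iff[of 2 2 "int n"] by simp
  show "2 dvd e1 * int n" "2 dvd e2 * int n" "4 dvd e3 * int n" using e1_2 e2_2 e3_4 by auto
  show "\<not> 4 dvd e1 * int n" "\<not> 4 dvd e2 * int n" using e1_2 e2_2 c coprime_dvd_mult_left_iff by blast+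
qed

lemma twisted_sum: "e1 * int n + e2 * int n + e3 * int n = 0"
  using e_sum by (metis distrib_right mult_zero_left)

lemma odd_Sel2_good_rep:
  assumes L: "(d1, d2, d3) \<in> Sel_n" and od: "odd d2" "odd d3"
  shows "good_rep n (d1, d2, d3)"
proof -
  note S = L[unfolded Sel2_iff]
  obtain s where s: "d1 * d2 * d3 = s^2" using S by blast
  have nz: "d1 \<noteq> 0" "d2 \<noteq> 0" "d3 \<noteq> 0" and sq: "squarefree d1" "squarefree d2" "squarefree d3" using S by auto
  have sf: "\<not> q^2 dvd d1" "\<not> q^2 dvd d2" "\<not> q^2 dvd d3" if "prime q" for q
    using squarefree_not_dvd sq that by blast+
  have pat: "q dvd d1 \<longleftrightarrow> (q dvd d2) \<noteq> (q dvd d3)" if "prime q" for q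
    by (rule square_product_dvd_pattern[OF that s nz sf[OF that]])
  have od1: "odd d1" using pat[OF prime_int_2] od by simp
  have d3: "d3 mod 4 = 1"
    by (rule loc_sol_2_imp_mod_4[OF twisted_2_adic(1-3,5) od1 od s]) (use S in simp)
  have np: "int n > 0" using n_pos by simp
  have asgn: "e1 * int n < 0" "e3 * int n > 0" using sgn np by (auto simp: mult_neg_pos)
  have d2: "d2 > 0" using real_cov_imp_pos[OF asgn s nz] S by blast
  have "s \<noteq> 0" using s nz by auto
  hence "d1 * d2 * d3 > 0" using s by simp
  hence "d2 * (d1 * d3) > 0" by (simp add: mult_ac)
  hence d13: "d1 * d3 > 0" using d2 zero_less_mult_pos by blast

  \<comment> \<open>The same sign goes to \<open>g1\<close> and \<open>g3\<close>: then
    \<open>g1 g2 g3 > 0\<close>, so the quotients \<open>ci\<close> have a positive product, which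
    is therefore a square.\<close>
  define \<sigma> :: int where "\<sigma> = chi4 (gcd d3 (int n))"
  define g1 g2 g3 where g_def: "g1 = \<sigma> * gcd d1 (int n)" "g2 = gcd d2 (int n)" "g3 = \<sigma> * gcd d3 (int n)"
  have \<sigma>: "\<sigma> = 1 \<or> \<sigma> = -1" unfolding \<sigma>_def by (rule chi4_values)
  have gpos: "gcd d (int n) > 0" for d using np by (simp add: gcd_pos_int)
  have gdvd: "g1 dvd d1" "g2 dvd d2" "g3 dvd d3" unfolding g_def using \<sigma> by auto
  obtain c1 where c1: "d1 = g1 * c1" using gdvd(1) by (rule dvdE)
  obtain c2 where c2: "d2 = g2 * c2" using gdvd(2) by (rule dvdE)
  obtain c3 where c3: "d3 = g3 * c3" using gdvd(3) by (rule dvdE)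
  have cnz: "c1 \<noteq> 0" "c2 \<noteq> 0" "c3 \<noteq> 0" using nz c1 c2 c3 by auto
  have csq: "squarefree c1" "squarefree c2" "squarefree c3"
    using sq c1 c2 c3 squarefree_mono by (metis dvd_triv_right)+
  have cdvd: "q dvd c \<longleftrightarrow> q dvd d \<and> \<not> q dvd int n"
    if q: "prime q" and d: "squarefree d" "d = \<tau> * gcd d (int n) * c" "\<tau> = 1 \<or> \<tau> = -1" for q d c \<tau>
  proof
    assume h: "q dvd c"
    hence qd: "q dvd d" using d(2) by (metis dvd_mult)
    have "\<not> q dvd int n"
    proof
      assume "q dvd int n"
      hence "q dvd gcd d (int n)" using qd by simp
      hence "q * q dvd (\<tau> * gcd d (int n)) * c" using h by (intro mult_dvd_mono dvd_mult)
      hence "q^2 dvd d" using d(2) by (simp add: power2_eq_square)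
      thus False using squarefree_not_dvd[OF d(1) q] by blast
    qed
    thus "q dvd d \<and> \<not> q dvd int n" using qd by blast
  next
    assume h: "q dvd d \<and> \<not> q dvd int n"
    hence "q dvd \<tau> * gcd d (int n) * c" using d(2) by metis
    moreover have "\<not> q dvd \<tau> * gcd d (int n)" using h d(3) by auto
    ultimately show "q dvd c" using q prime_dvd_mult_iff by blast
  qed
  have cd: "q dvd c1 \<longleftrightarrow> q dvd d1 \<and> \<not> q dvd int n" "q dvd c2 \<longleftrightarrow> q dvd d2 \<and> \<not> q dvd int n"
    "q dvd c3 \<longleftrightarrow> q dvd d3 \<and> \<not> q dvd int n" if q: "prime q" for q
    using cdvd[OF q sq(1), of \<sigma> c1] cdvd[OF q sq(2), of 1 c2] cdvd[OF q sq(3), of \<sigma> c3] \<sigma> c1 c2 c3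
    unfolding g_def by auto
  have "g2 > 0" using gpos unfolding g_def by blast
  hence c2pos: "c2 > 0" using d2 c2 zero_less_mult_pos by blast
  have "g1 * g3 > 0" using \<sigma> gpos[of d1] gpos[of d3] unfolding g_def by auto
  moreover have "(g1 * g3) * (c1 * c3) > 0" using d13 c1 c3 by (simp add: mult_ac)
  ultimately have c13: "c1 * c3 > 0" using zero_less_mult_pos by blast
  hence "c2 * (c1 * c3) > 0" using c2pos by simp
  hence cpos: "c1 * c2 * c3 > 0" by (simp add: mult_ac)
  obtain v where v: "c1 * c2 * c3 = v^2"
  proof (rule square_productI[OF csq cpos])
    show "q dvd c1 \<longleftrightarrow> (q dvd c2) \<noteq> (q dvd c3)" if "prime q" for q using cd[OF that] pat[OF that] by blast
  qed
  have codd: "odd c1" "odd c2" "odd c3" using od1 od c1 c2 c3 by auto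
  have "odd (gcd d3 (int n))" using odd_n by simp
  hence "g3 mod 4 = 1" unfolding g_def \<sigma>_def chi4_def using odd_mod_4[of "gcd d3 (int n)"] by (auto simp: zmod_zminus1_eq_if)
  hence c3mod: "c3 mod 4 = 1" using d3 c3 mod_mult_eq[of g3 4 c3] by simp

  have odd_q: "loc_sol q e1 e2 e3 c1 c2 c3" if q: "prime q" "2 < q" for q
  proof (cases "q dvd e1 * e2 * e3")
    case False
    have ne: "\<not> q dvd e1" "\<not> q dvd e2" "\<not> q dvd e3" using not_dvd_twisted[OF q(1) False, of 1] q by auto
    \<comment> \<open>This covers the primes of \<open>n\<close>: they do not divide
      \<open>e1 e2 e3\<close>, and they have been removed from the \<open>ci\<close>.\<close>
    have "\<not> q dvd c1 \<and> \<not> q dvd c2 \<and> \<not> q dvd c3"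
      using cd[OF q(1)] Sel2_unramified[OF L q(1) not_dvd_twisted[OF q(1) False]] by blast
    thus ?thesis using loc_sol_good_reduction[OF q e_sum ne _ _ _ v] by blast
  next
    case True
    have Ln: "Legendre (int n) q = 1" using Legendre_pos_divisor[OF q True np] by simp
    have Lg: "Legendre (gcd d (int n)) q = 1" for d using Legendre_pos_divisor[OF q True gpos] by simp
    have sol: "loc_n q d1 d2 d3" using S q by blast
    \<comment> \<open>The residue symbols dispose of \<open>n\<close> and of the divisors
      \<open>gcd di n\<close>, but not of the sign \<open>\<sigma>\<close>, which stays with
      \<open>c1\<close> and \<open>c3\<close>.\<close>
    have twist: "loc_sol q e1 e2 e3 (\<sigma> * c1) c2 (\<sigma> * c3)"
    proof (rule loc_sol_square_twist[OF q Ln Lg[of d1] Lg[of d2] Lg[of d3]])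
      have "gcd d1 (int n) * (\<sigma> * c1) = d1" "gcd d2 (int n) * c2 = d2" "gcd d3 (int n) * (\<sigma> * c3) = d3"
        using c1 c2 c3 unfolding g_def by (simp_all add: mult_ac)
      thus "loc_n q (gcd d1 (int n) * (\<sigma> * c1)) (gcd d2 (int n) * c2)
        (gcd d3 (int n) * (\<sigma> * c3))" using sol by simp
    qed
    show ?thesis
    proof (cases "\<sigma> = 1")
      case True
      thus ?thesis using twist by simp
    next
      case False
      hence \<sigma>1: "\<sigma> = -1" using \<sigma> by simp
      show ?thesis
      \<comment> \<open>At a prime of \<open>e1 e3\<close> the divisor \<open>g3\<close>, being 1
        modulo 4, is a residue, so \<open>\<sigma> = -1\<close> is one too. At a prime of
        \<open>e2\<close> alone \<open>loc_sol_neg_twist\<close> changes both signs.\<close>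
      proof (cases "q dvd e1 * e3")
        case True13: True
        have "g3 dvd int n" unfolding g_def using \<sigma> by auto
        hence "Legendre g3 q = 1" using Legendre_divisor_1_mod_4[OF q True13 \<open>g3 mod 4 = 1\<close>] by blast
        hence "Legendre \<sigma> q = 1" using Lg[of d3] Legendre_mult[OF q, of \<sigma> "gcd d3 (int n)"] unfolding g_def by simp
        hence L1: "Legendre (-1) q = 1" using \<sigma>1 by simp
        note Lone = Legendre_1[OF q(1)]
        show ?thesis
          by (rule loc_sol_square_twist[OF q Lone L1 Lone L1]) (use twist \<sigma>1 in simp)
      next
        case False13: False
        have ne: "\<not> q dvd e1" "q dvd e2" "\<not> q dvd e3"
          using False13 True q(1) by (auto simp: prime_dvd_mult_iff)
        have "loc_sol q e1 e2 e3 (- (- c1)) c2 (- (- c3))"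
        proof (rule loc_sol_neg_twist[OF q e_sum ne])
          show "- c1 * c2 * - c3 = v^2" using v by simp
          show "loc_sol q e1 e2 e3 (- c1) c2 (- c3)" using twist \<sigma>1 by simp
          show "\<not> q^2 dvd - c1" "\<not> q^2 dvd c2" "\<not> q^2 dvd - c3" using csq squarefree_not_dvd q(1) by auto
        qed (use cnz in auto)
        thus ?thesis by simp
      qed
    qed
  qed
  have "loc_sol 2 e1 e2 e3 c1 c2 c3"
    by (rule loc_sol_2_of_others[OF e_sum e1_2 e2_2 codd v c3mod sgn(2) c2pos c13 odd_q])
  hence "loc_sol q e1 e2 e3 c1 c2 c3" if "prime q" for q
    using odd_q that prime_ge_2_int[OF that] by (cases "q = 2") auto
  moreover have "real_cov e1 e2 e3 c1 c2 c3" by (rule real_cov_of_pos[OF e_sum sgn(2,1) c2pos c13])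
  ultimately have "(c1, c2, c3) \<in> Sel2 e1 e2 e3 1" unfolding Sel2_iff using csq cnz v by auto
  hence "c1 = 1 \<and> c2 = 1 \<and> c3 = 1" using odd_Sel2_1 codd by blast
  hence "d1 = g1" "d2 = g2" "d3 = g3" using c1 c2 c3 by auto
  moreover have "g1 dvd int n" "g2 dvd int n" "g3 dvd int n" unfolding g_def using \<sigma> by auto
  ultimately show ?thesis using d2 d3 by (simp add: good_rep_def)
qed

lemma divisor_squarefree: "d dvd int n \<Longrightarrow> squarefree d"
  using squarefree_mono squarefree_n by blast

lemma divisor_odd: "d dvd int n \<Longrightarrow> odd d"
  using odd_n by (metis dvd_trans even_of_nat)

text \<open>Away from \<open>n\<close> the conditions hold by themselves. At a prime of
  \<open>e1 e3\<close> all \<open>di\<close> are residues; at a prime of \<open>e2\<close> alone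
  \<open>d3\<close> may fail to be one, but the conic only asks this of \<open>d1 * d3\<close>,
  which has the class of the positive \<open>d2\<close>.\<close>

lemma Sel2_of_local_at_p:
  assumes dv: "d1 dvd int n" "d2 dvd int n" "d3 dvd int n" and d2: "d2 > 0" and d3: "d3 mod 4 = 1"
    and s: "d1 * d2 * d3 = s^2"
    and loc: "\<And>i. i < k \<Longrightarrow> loc_n (int (p i)) d1 d2 d3"
  shows "(d1, d2, d3) \<in> Sel_n"
proof -
  have sq: "squarefree d1" "squarefree d2" "squarefree d3" using divisor_squarefree dv by auto
  have od: "odd d1" "odd d2" "odd d3" using divisor_odd dv by auto
  have nz: "d1 \<noteq> 0" "d2 \<noteq> 0" "d3 \<noteq> 0" using od by auto
  have np: "int n > 0" using n_pos by simp
  have asgn: "e1 * int n < 0" "e3 * int n > 0" using sgn np by (auto simp: mult_neg_pos)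
  have "s \<noteq> 0" using s nz by auto
  hence "d1 * d2 * d3 > 0" using s by simp
  hence "d2 * (d1 * d3) > 0" by (simp add: mult_ac)
  hence d13: "d1 * d3 > 0" using d2 zero_less_mult_pos by blast
  have odd_q: "loc_n q d1 d2 d3" if q: "prime q" "2 < q" for q
  proof (cases "q dvd int n")
    case True
    thus ?thesis using prime_dvd_n_iff[OF q(1)] loc by blast
  next
    case False
    have nd: "\<not> q dvd d1" "\<not> q dvd d2" "\<not> q dvd d3" using False dv dvd_trans by blast+
    show ?thesis
    proof (cases "q dvd e1 * e2 * e3")
      case F: False
      show ?thesis
        by (rule loc_sol_good_reduction[OF q twisted_sum not_dvd_twisted[OF q(1) F False] nd s])
    next
      case True
      have L2: "Legendre d2 q = 1" using Legendre_pos_divisor[OF q True d2 dv(2)] .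
      have pr: "Legendre d1 q * Legendre d2 q * Legendre d3 q = 1"
        using Legendre_of_square_product[OF q nd s] .
      show ?thesis
      proof (cases "q dvd e1 * e3")
        case True13: True
        have L3: "Legendre d3 q = 1" using Legendre_divisor_1_mod_4[OF q True13 d3 dv(3)] .
        show ?thesis
          by (rule loc_sol_squares[OF q twisted_sum]) (use pr L2 L3 in \<open>simp_all add: Legendre_mult[OF q]\<close>)
      next
        case False13: False
        have ne: "\<not> q dvd e1 * int n" "q dvd e2 * int n"
          using False13 True q(1) False by (auto simp: prime_dvd_mult_iff)
        show ?thesis
          by (rule loc_sol_conic[OF q twisted_sum ne nd(2)]) (use pr L2 in \<open>simp_all add: Legendre_mult[OF q]\<close>)
      qed
    qed
  qed
  have "loc_n 2 d1 d2 d3"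
    by (rule loc_sol_2_of_others[OF twisted_sum twisted_2_adic(1-4) od s d3 asgn(1) d2 d13 odd_q])
  hence "loc_n q d1 d2 d3" if "prime q" for q
    using odd_q that prime_ge_2_int[OF that] by (cases "q = 2") auto
  moreover have "real_cov (e1 * int n) (e2 * int n) (e3 * int n) d1 d2 d3"
    by (rule real_cov_of_pos[OF twisted_sum asgn d2 d13])
  ultimately show ?thesis unfolding Sel2_iff using sq nz s by auto
qed

subsection \<open>The Selmer group as a kernel\<close>

definition support :: "int \<Rightarrow> nat set" where
  "support d = {j. j < k \<and> int (p j) dvd d}"

lemma finite_support: "finite (support d)" by (simp add: support_def)

lemma support_lt: "j \<in> support d \<Longrightarrow> j < k" by (simp add: support_def)

lemma prime_int_p: "i < k \<Longrightarrow> prime (int (p i))" "i < k \<Longrightarrow> 2 < int (p i)"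
  using prime_p p_gt_2 by auto

lemma p_distinct: "i < k \<Longrightarrow> j < k \<Longrightarrow> i \<noteq> j \<Longrightarrow> int (p i) \<noteq> int (p j) \<and> \<not> int (p i) dvd int (p j)"
  using prime_int_p primes_dvd_imp_eq inj_p by (metis inj_on_eq_iff lessThan_iff of_nat_eq_iff)

lemma prod_p_dvd_n: "J \<subseteq> {..<k} \<Longrightarrow> (\<Prod>j\<in>J. int (p j)) dvd int n"
  unfolding n_def of_nat_prod by (intro prod_dvd_prod_subset) auto

lemma prime_dvd_prod_p:
  assumes "J \<subseteq> {..<k}" "i < k"
  shows "int (p i) dvd (\<Prod>j\<in>J. int (p j)) \<longleftrightarrow> i \<in> J"
proof -
  have fin: "finite J" using assms(1) finite_subset by blast
  have "int (p i) dvd (\<Prod>j\<in>J. int (p j)) \<longleftrightarrow> (\<exists>j\<in>J. int (p i) dvd int (p j))"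
    using prime_dvd_prod_iff[OF fin, of "int (p i)" "\<lambda>j. int (p j)"] prime_int_p assms by blast
  also have "\<dots> \<longleftrightarrow> i \<in> J" using p_distinct assms by (metis dvd_refl lessThan_iff subsetD)
  finally show ?thesis .
qed

lemma pos_divisor_eq_prod:
  assumes "d > 0" "d dvd int n"
  shows "d = (\<Prod>j\<in>support d. int (p j))"
proof -
  have sub: "support d \<subseteq> {..<k}" by (auto simp: support_def)
  have pos: "(\<Prod>j\<in>support d. int (p j)) > 0"
    using prime_int_p(2) support_lt by (intro prod_pos) force
  have iff: "q dvd d \<longleftrightarrow> q dvd (\<Prod>j\<in>support d. int (p j))" if q: "prime q" for q
  proof -
    have "q dvd d \<Longrightarrow> q dvd int n" "q dvd (\<Prod>j\<in>support d. int (p j)) \<Longrightarrow> q dvd int n"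
      using assms(2) prod_p_dvd_n[OF sub] dvd_trans by blast+
    moreover have "q dvd d \<longleftrightarrow> q dvd (\<Prod>j\<in>support d. int (p j))" if "q dvd int n"
      using that prime_dvd_n_iff[OF q] prime_dvd_prod_p[OF sub] by (auto simp: support_def)
    ultimately show ?thesis by blast
  qed
  have "d dvd (\<Prod>j\<in>support d. int (p j))" "(\<Prod>j\<in>support d. int (p j)) dvd d"
    using squarefree_dvdI divisor_squarefree assms prod_p_dvd_n[OF sub] pos iff by (metis less_irrefl)+
  thus ?thesis using assms(1) pos by (simp add: zdvd_antisym_nonneg)
qed

lemma prod_pstar:
  assumes "J \<subseteq> {..<k}"
  shows "\<bar>\<Prod>j\<in>J. pstar (p j)\<bar> = (\<Prod>j\<in>J. int (p j))" "(\<Prod>j\<in>J. pstar (p j)) mod 4 = 1"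
proof -
  have "\<bar>pstar (p j)\<bar> = int (p j)" if "j \<in> J" for j
    using pstar_eq[of j] chi4_values[of "int (p j)"] assms that by (auto simp: abs_mult)
  thus "\<bar>\<Prod>j\<in>J. pstar (p j)\<bar> = (\<Prod>j\<in>J. int (p j))" by (simp add: abs_prod)
  have one: "pstar (p j) mod 4 = 1" if "j < k" for j
  proof -
    have "odd (int (p j))" using odd_prime_int prime_int_p that by blast
    hence "int (p j) mod 4 = 1 \<or> int (p j) mod 4 = 3" by (rule odd_mod_4)
    thus ?thesis unfolding pstar_eq[OF that] chi4_def by (auto simp: zmod_zminus1_eq_if)
  qed
  have "finite J" using assms finite_subset by blast
  thus "(\<Prod>j\<in>J. pstar (p j)) mod 4 = 1" using assms
  proof (induction J rule: finite_induct)
    case (insert x F)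
    thus ?case using one[of x] mod_mult_eq[of "pstar (p x)" 4 "\<Prod>j\<in>F. pstar (p j)"] by simp
  qed simp
qed

text \<open>The \<open>p*\<close> are 1 modulo 4, so the congruence on \<open>d\<close> selects the
  sign with which \<open>d\<close> is their product.\<close>

lemma divisor_eq_prod_pstar:
  assumes "d mod 4 = 1" "d dvd int n"
  shows "d = (\<Prod>j\<in>support d. pstar (p j))"
proof (rule mod_4_abs_eq)
  have sub: "support d \<subseteq> {..<k}" by (auto simp: support_def)
  have "d \<noteq> 0" using assms(1) by auto
  hence "\<bar>d\<bar> = (\<Prod>j\<in>support \<bar>d\<bar>. int (p j))" using assms(2) by (intro pos_divisor_eq_prod) auto
  also have "support \<bar>d\<bar> = support d" by (simp add: support_def)
  finally show "\<bar>d\<bar> = \<bar>\<Prod>j\<in>support d. pstar (p j)\<bar>" using prod_pstar(1)[OF sub] by simp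
  show "(\<Prod>j\<in>support d. pstar (p j)) mod 4 = 1" by (rule prod_pstar(2)[OF sub])
qed (rule assms)

lemma not_p_dvd_e: "i < k \<Longrightarrow> \<not> int (p i) dvd e1 \<and> \<not> int (p i) dvd e2 \<and> \<not> int (p i) dvd e3"
proof -
  assume i: "i < k"
  have pr: "prime (int (p i))" using prime_int_p i by blast
  have "int (p i) dvd int n" using prime_dvd_n_iff[OF pr] i by blast
  hence "\<not> int (p i) dvd e1 * e2 * e3" using not_dvd_n pr by blast
  thus ?thesis by auto
qed

definition cofactor :: "nat \<Rightarrow> int" where
  "cofactor i = (\<Prod>j\<in>{..<k} - {i}. int (p j))"

lemma n_eq_cofactor: "i < k \<Longrightarrow> int n = int (p i) * cofactor i"
  unfolding n_def cofactor_def of_nat_prod by (intro prod.remove) auto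

lemma not_p_dvd_cofactor: "i < k \<Longrightarrow> \<not> int (p i) dvd cofactor i"
  unfolding cofactor_def by (subst prime_dvd_prod_p) auto

lemma pm_matA_off:
  assumes "i < k" "j < k" "i \<noteq> j"
  shows "pm (matA n p i j) = Legendre (int (p j)) (int (p i))"
proof (rule pm_of_iff)
  note pi = prime_int_p[OF assms(1)]
  show nd: "\<not> int (p i) dvd int (p j)" using p_distinct assms by blast
  have "\<not> (int (p i))^2 dvd int n" using squarefree_not_dvd[OF squarefree_n pi(1)] .
  moreover have "int (p i) dvd int n" using prime_dvd_n_iff[OF pi(1)] assms(1) by blast
  ultimately show "matA n p i j = 0 \<longleftrightarrow> Legendre (int (p j)) (int (p i)) = 1"
    unfolding matA_def using hilb_add_unit[OF pi nd, of "- int n"] by simp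
qed

lemma pm_matA_diag:
  assumes "i < k"
  shows "pm (matA n p i i) = Legendre (cofactor i) (int (p i))"
proof (rule pm_of_iff)
  note pi = prime_int_p[OF assms(1)]
  show nd: "\<not> int (p i) dvd cofactor i" by (rule not_p_dvd_cofactor[OF assms])
  show "matA n p i i = 0 \<longleftrightarrow> Legendre (cofactor i) (int (p i)) = 1"
    unfolding matA_def n_eq_cofactor[OF assms] by (rule hilb_add_ramified[OF pi nd])
qed

lemma pm_sum_support:
  assumes "\<And>j. j < k \<Longrightarrow> y j = (if j \<in> J then 1 else 0)" "J \<subseteq> {..<k}"
  shows "pm (\<Sum>j<k. f j * y j) = (\<Prod>j\<in>J. pm (f j))"
proof -
  have "pm (\<Sum>j<k. f j * y j) = (\<Prod>j<k. pm (f j * y j))" by (rule pm_sum) simp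
  also have "\<dots> = (\<Prod>j<k. if j \<in> J then pm (f j) else 1)"
  proof (rule prod.cong[OF refl])
    fix j assume "j \<in> {..<k}"
    hence "y j = (if j \<in> J then 1 else 0)" using assms(1) by simp
    thus "pm (f j * y j) = (if j \<in> J then pm (f j) else 1)" unfolding pm_mult by simp
  qed
  also have "\<dots> = (\<Prod>j\<in>{..<k} \<inter> J. pm (f j))" by (simp add: prod.If_cases)
  also have "{..<k} \<inter> J = J" using assms(2) by blast
  finally show ?thesis .
qed

lemma local_at_p_iff_rows:
  assumes dv: "d1 dvd int n" "d2 dvd int n" "d3 dvd int n" and d2: "d2 > 0" and d3: "d3 mod 4 = 1"
    and s: "d1 * d2 * d3 = s^2" and i: "i < k"
    and y: "\<And>j. j < k \<Longrightarrow> y j = (if j \<in> support d2 then 1 else 0)"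
    and z: "\<And>j. j < k \<Longrightarrow> z j = (if j \<in> support d3 then 1 else 0)"
  shows "loc_n (int (p i)) d1 d2 d3 \<longleftrightarrow>
    (\<Sum>j<k. matA n p i j * y j) + lsym (- e1) (p i) * y i + lsym (- e1 * e3) (p i) * z i = 0 \<and>
    lsym (- e1 * e2) (p i) * y i + (\<Sum>j<k. matA n p j i * z j) + lsym (- e1) (p i) * z i = 0"
proof -
  define q where "q = int (p i)"
  note pi = prime_int_p[OF i, folded q_def]
  define Y where "Y \<longleftrightarrow> i \<in> support d2"
  define Z where "Z \<longleftrightarrow> i \<in> support d3"
  define D2 where "D2 = (\<Prod>j\<in>support d2 - {i}. int (p j))"
  define D3 where "D3 = (\<Prod>j\<in>support d3 - {i}. pstar (p j))"
  have sub: "support d \<subseteq> {..<k}" for d by (auto simp: support_def)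
  have sub': "support d - {i} \<subseteq> {..<k}" for d by (auto simp: support_def)
  have e2': "d2 = (if Y then q else 1) * D2"
    unfolding Y_def q_def D2_def
    by (rule trans[OF pos_divisor_eq_prod[OF d2 dv(2)] prod_split_index[OF finite_support]])
  have e3': "d3 = (if Z then chi4 q * q else 1) * D3"
    unfolding Z_def q_def D3_def pstar_eq[OF i, symmetric]
    by (rule trans[OF divisor_eq_prod_pstar[OF d3 dv(3)] prod_split_index[OF finite_support]])
  have nD2: "\<not> q dvd D2" unfolding q_def D2_def using prime_dvd_prod_p[OF sub' i] by blast
  have "q dvd D3 \<longleftrightarrow> q dvd \<bar>D3\<bar>" by simp
  also have "\<bar>D3\<bar> = (\<Prod>j\<in>support d3 - {i}. int (p j))" unfolding D3_def by (rule prod_pstar(1)[OF sub'])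
  finally have nD3: "\<not> q dvd D3" unfolding q_def using prime_dvd_prod_p[OF sub' i] by blast
  have ne: "\<not> q dvd e1" "\<not> q dvd e2" "\<not> q dvd e3" using not_p_dvd_e[OF i] q_def by auto
  have nes: "\<not> q dvd - e1" "\<not> q dvd - e1 * e3" "\<not> q dvd - e1 * e2"
    using ne pi(1) by (auto simp: prime_dvd_mult_iff)
  have d1: "d1 \<noteq> 0" "\<not> q^2 dvd d1"
    using divisor_odd[OF dv(1)] squarefree_not_dvd[OF divisor_squarefree[OF dv(1)] pi(1)] by auto
  have r1: "pm (\<Sum>j<k. matA n p i j * y j) = (if Y then Legendre (cofactor i) q else 1) * Legendre D2 q"
  proof -
    have "pm (\<Sum>j<k. matA n p i j * y j) = (\<Prod>j\<in>support d2. pm (matA n p i j))"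
      by (rule pm_sum_support[OF y sub])
    also have "\<dots> = (if Y then pm (matA n p i i) else 1) * (\<Prod>j\<in>support d2 - {i}. pm (matA n p i j))"
      unfolding Y_def by (rule prod_split_index[OF finite_support])
    also have "(\<Prod>j\<in>support d2 - {i}. pm (matA n p i j)) = (\<Prod>j\<in>support d2 - {i}. Legendre (int (p j)) q)"
      unfolding q_def by (intro prod.cong refl pm_matA_off i) (auto simp: support_def)
    also have "\<dots> = Legendre D2 q" unfolding D2_def by (rule Legendre_prod[OF pi, symmetric]) (simp add: finite_support)
    finally show ?thesis by (simp add: pm_matA_diag[OF i] q_def)
  qed
  have r2: "pm (\<Sum>j<k. matA n p j i * z j) = (if Z then Legendre (cofactor i) q else 1) * Legendre D3 q"
  proof -
    have "pm (\<Sum>j<k. matA n p j i * z j) = (\<Prod>j\<in>support d3. pm (matA n p j i))"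
      by (rule pm_sum_support[OF z sub])
    also have "\<dots> = (if Z then pm (matA n p i i) else 1) * (\<Prod>j\<in>support d3 - {i}. pm (matA n p j i))"
      unfolding Z_def by (rule prod_split_index[OF finite_support])
    \<comment> \<open>Entry \<open>(j, i)\<close> is the symbol of \<open>p i\<close> modulo
      \<open>p j\<close>, whose modulus varies within the product; reciprocity turns it into the
      symbol of \<open>pstar (p j)\<close> modulo the fixed \<open>p i\<close>.\<close>
    also have "(\<Prod>j\<in>support d3 - {i}. pm (matA n p j i)) = (\<Prod>j\<in>support d3 - {i}. Legendre (pstar (p j)) q)"
    proof (rule prod.cong[OF refl])
      fix j assume "j \<in> support d3 - {i}"
      hence j: "j < k" "j \<noteq> i" by (auto simp: support_def)
      note pj = prime_int_p[OF j(1)]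
      have "q \<noteq> int (p j)" using p_distinct[OF i j(1)] j(2) q_def by auto
      thus "pm (matA n p j i) = Legendre (pstar (p j)) q"
        unfolding pm_matA_off[OF j(1) i j(2)] pstar_eq[OF j(1)] q_def[symmetric]
        by (rule Legendre_star_reciprocity[OF pi pj, symmetric])
    qed
    also have "\<dots> = Legendre D3 q" unfolding D3_def by (rule Legendre_prod[OF pi, symmetric]) (simp add: finite_support)
    finally show ?thesis by (simp add: pm_matA_diag[OF i] q_def)
  qed
  have l: "pm (lsym u (p i) * y i) = (if Y then Legendre u q else 1)" "pm (lsym u (p i) * z i) = (if Z then Legendre u q else 1)"
    if "\<not> q dvd u" for u
    unfolding pm_mult using y[OF i] z[OF i] pm_lsym[of "p i" u] that by (simp_all add: Y_def Z_def q_def)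
  have "loc_sol q (e1 * (q * cofactor i)) (e2 * (q * cofactor i)) (e3 * (q * cofactor i)) d1 d2 d3 \<longleftrightarrow>
    pm ((\<Sum>j<k. matA n p i j * y j) + lsym (- e1) (p i) * y i + lsym (- e1 * e3) (p i) * z i) = 1 \<and>
    pm (lsym (- e1 * e2) (p i) * y i + (\<Sum>j<k. matA n p j i * z j) + lsym (- e1) (p i) * z i) = 1"
    unfolding pm_add r1 r2 l[OF nes(1)] l[OF nes(2)] l[OF nes(3)]
    by (rule loc_sol_iff_rows[OF pi e_sum ne _ nD2 nD3 e2' e3' d1 s]) (simp add: q_def not_p_dvd_cofactor[OF i])
  thus ?thesis unfolding pm_eq_1_iff q_def n_eq_cofactor[OF i, symmetric] .
qed

lemma Phi_divisors:
  assumes "d2 dvd int n" "d3 dvd int n"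
  shows "Phi k p (d1, d2, d3) = ((\<lambda>i. if i \<in> support d2 then 1 else 0), (\<lambda>i. if i \<in> support d3 then 1 else 0))"
proof -
  have "(if i < k then of_nat (multiplicity (int (p i)) d) else 0) = (if i \<in> support d then 1 else (0::bit))"
    if "d dvd int n" for d i
    using squarefree_multiplicity[OF divisor_squarefree[OF that], of "int (p i)"] prime_int_p(1)[of i]
    by (auto simp: support_def)
  thus ?thesis using assms by (simp add: Phi_def)
qed

lemma Phi_in_Ker_iff:
  assumes dv: "d1 dvd int n" "d2 dvd int n" "d3 dvd int n" and d2: "d2 > 0" and d3: "d3 mod 4 = 1"
    and s: "d1 * d2 * d3 = s^2"
  shows "Phi k p (d1, d2, d3) \<in> Ker e1 e2 e3 n k p \<longleftrightarrow>
    (\<forall>i<k. loc_n (int (p i)) d1 d2 d3)"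
proof -
  define y where "y i = (if i \<in> support d2 then 1 else (0::bit))" for i
  define z where "z i = (if i \<in> support d3 then 1 else (0::bit))" for i
  have "\<forall>i\<ge>k. y i = 0 \<and> z i = 0" by (auto simp: y_def z_def support_def)
  moreover have "Phi k p (d1, d2, d3) = (y, z)" using Phi_divisors[OF dv(2,3)] by (simp add: y_def z_def fun_eq_iff)
  ultimately show ?thesis
    using local_at_p_iff_rows[OF dv d2 d3 s, of _ y z] by (simp add: Ker_def y_def z_def)
qed

section \<open>Bijectivity and additivity of the valuation map\<close>

lemma Phi_inj: "inj_on (Phi k p) {L \<in> Sel_n. good_rep n L}"
proof (rule inj_onI)
  fix L M assume L: "L \<in> {L \<in> Sel_n. good_rep n L}"
    and M: "M \<in> {L \<in> Sel_n. good_rep n L}" and eq: "Phi k p L = Phi k p M"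
  obtain d1 d2 d3 where Ld: "L = (d1, d2, d3)" by (cases L)
  obtain c1 c2 c3 where Mc: "M = (c1, c2, c3)" by (cases M)
  have d: "d2 dvd int n" "d3 dvd int n" "d2 > 0" "d3 mod 4 = 1" using L Ld by (auto simp: good_rep_def)
  have c: "c2 dvd int n" "c3 dvd int n" "c2 > 0" "c3 mod 4 = 1" using M Mc by (auto simp: good_rep_def)
  have "support d2 = support c2" "support d3 = support c3"
    using eq unfolding Ld Mc Phi_divisors[OF d(1,2)] Phi_divisors[OF c(1,2)]
    by (auto simp: fun_eq_iff split: if_splits)
  hence e: "d2 = c2" "d3 = c3"
    using pos_divisor_eq_prod[OF d(3,1)] pos_divisor_eq_prod[OF c(3,1)]
      divisor_eq_prod_pstar[OF d(4,2)] divisor_eq_prod_pstar[OF c(4,2)] by simp_all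
  have S: "(d1, d2, d3) \<in> Sel_n" "(c1, c2, c3) \<in> Sel_n"
    using L M Ld Mc by auto
  \<comment> \<open>\<open>d1\<close> carries no information of its own: it is the square-free part
    of \<open>d2 * d3\<close>.\<close>
  have sq: "x1 = sqf (x2 * x3)" if mem: "(x1, x2, x3) \<in> Sel_n" for x1 x2 x3
  proof -
    obtain s where s: "x1 * x2 * x3 = s^2" using mem unfolding Sel2_iff by blast
    have x: "x1 \<noteq> 0" "x2 \<noteq> 0" "x3 \<noteq> 0" "squarefree x1" using mem unfolding Sel2_iff by blast+
    have "sqf x1 = sqf (x2 * x3)" by (rule sqf_cong[of _ _ s]) (use s x in \<open>simp_all add: mult.assoc\<close>)
    thus ?thesis using sqf_of_squarefree[OF x(4)] by simp
  qed
  show "L = M" using sq[OF S(1)] sq[OF S(2)] e Ld Mc by simp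
qed

lemma Phi_surj:
  assumes yz: "(y, z) \<in> Ker e1 e2 e3 n k p"
  shows "\<exists>L\<in>{L \<in> Sel_n. good_rep n L}. Phi k p L = (y, z)"
proof -
  define J2 where "J2 = {j. j < k \<and> y j = 1}"
  define J3 where "J3 = {j. j < k \<and> z j = 1}"
  define d2 where "d2 = (\<Prod>j\<in>J2. int (p j))"
  \<comment> \<open>The \<open>p*\<close> give \<open>d3\<close> the sign for which it is 1 modulo
    4, and \<open>d1\<close> is then forced by the square product.\<close>
  define d3 where "d3 = (\<Prod>j\<in>J3. pstar (p j))"
  define d1 where "d1 = sqf (d2 * d3)"
  have sub: "J2 \<subseteq> {..<k}" "J3 \<subseteq> {..<k}" by (auto simp: J2_def J3_def)
  have a3: "\<bar>d3\<bar> = (\<Prod>j\<in>J3. int (p j))" "d3 mod 4 = 1" unfolding d3_def using prod_pstar[OF sub(2)] by auto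
  have d2: "d2 > 0" unfolding d2_def using prime_int_p(2) sub(1) by (intro prod_pos) force
  have d2n: "d2 dvd int n" unfolding d2_def by (rule prod_p_dvd_n[OF sub(1)])
  have "\<bar>d3\<bar> dvd int n" unfolding a3(1) by (rule prod_p_dvd_n[OF sub(2)])
  hence d3n: "d3 dvd int n" by simp
  have nz: "d2 \<noteq> 0" "d3 \<noteq> 0" using d2 a3(2) by auto
  obtain t where t: "squarefree d1" "d2 * d3 = d1 * t^2" unfolding d1_def using sqf_decompose[of "d2 * d3"] nz by auto
  have s: "d1 * d2 * d3 = (d1 * t)^2" using t(2) by (simp add: mult.assoc power2_eq_square mult_ac)
  have d1n: "d1 dvd int n"
  proof (rule squarefree_dvdI[OF t(1)])
    show "int n \<noteq> 0" using n_pos by simp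
    show "q dvd int n" if q: "prime q" "q dvd d1" for q
    proof -
      have "q dvd d2 * d3" unfolding t(2) using q(2) by simp
      hence "q dvd d2 \<or> q dvd d3" using q(1) by (simp add: prime_dvd_mult_iff)
      thus ?thesis using d2n d3n dvd_trans by blast
    qed
  qed
  have s2: "support d2 = J2"
    using prime_dvd_prod_p[OF sub(1)] sub(1) by (auto simp: support_def d2_def)
  have "int (p j) dvd d3 \<longleftrightarrow> j \<in> J3" if "j < k" for j
    using prime_dvd_prod_p[OF sub(2) that] unfolding a3(1)[symmetric] by simp
  hence s3: "support d3 = J3" using sub(2) by (auto simp: support_def)
  have "\<forall>i\<ge>k. y i = 0 \<and> z i = 0" using yz by (simp add: Ker_def)
  hence "(if i \<in> J2 then 1 else 0) = y i" "(if i \<in> J3 then 1 else 0) = z i" for i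
    using bit_not_one_iff[of "y i"] bit_not_one_iff[of "z i"] by (cases "i < k"; auto simp: J2_def J3_def)+
  hence Phi: "Phi k p (d1, d2, d3) = (y, z)" using Phi_divisors[OF d2n d3n] s2 s3 by simp
  hence "\<forall>i<k. loc_n (int (p i)) d1 d2 d3"
    using Phi_in_Ker_iff[OF d1n d2n d3n d2 a3(2) s] yz by simp
  hence "(d1, d2, d3) \<in> Sel_n"
    using Sel2_of_local_at_p[OF d1n d2n d3n d2 a3(2) s] by blast
  moreover have "good_rep n (d1, d2, d3)" using d1n d2n d3n d2 a3(2) by (simp add: good_rep_def)
  ultimately show ?thesis using Phi by blast
qed

lemma Phi_bij: "bij_betw (Phi k p) {L \<in> Sel_n. good_rep n L} (Ker e1 e2 e3 n k p)"
  unfolding bij_betw_def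
proof (intro conjI Phi_inj subset_antisym subsetI)
  fix w assume "w \<in> Phi k p ` {L \<in> Sel_n. good_rep n L}"
  then obtain d1 d2 d3 where w: "w = Phi k p (d1, d2, d3)" and L: "(d1, d2, d3) \<in> Sel_n"
    and g: "good_rep n (d1, d2, d3)" by auto
  have d: "d1 dvd int n" "d2 dvd int n" "d3 dvd int n" "d2 > 0" "d3 mod 4 = 1" using g by (auto simp: good_rep_def)
  obtain s where s: "d1 * d2 * d3 = s^2" using L unfolding Sel2_iff by blast
  have "\<forall>i<k. loc_n (int (p i)) d1 d2 d3"
    using L prime_int_p(1) unfolding Sel2_iff by blast
  thus "w \<in> Ker e1 e2 e3 n k p" using Phi_in_Ker_iff[OF d s] w by blast
next
  fix w assume "w \<in> Ker e1 e2 e3 n k p"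
  thus "w \<in> Phi k p ` {L \<in> Sel_n. good_rep n L}" using Phi_surj by (cases w) force
qed

lemma good_rep_imp_odd_rep: "good_rep n L \<Longrightarrow> odd_rep L"
  using divisor_odd by (auto simp: good_rep_def odd_rep_def split: prod.splits)

lemma odd_int_n: "odd (int n)" using odd_n by simp

text \<open>Within a class of Selmer triples good and odd mean the same, by
  \<open>odd_Sel2_good_rep\<close>, and each class has exactly one odd member.\<close>

lemma unique_good_rep:
  assumes L: "L \<in> Sel_n"
  shows "\<exists>!L'. L' \<in> class_n L \<and> good_rep n L'"
proof -
  obtain d1 d2 d3 where Ld: "L = (d1, d2, d3)" by (cases L)
  have sq: "squarefree d1" "squarefree d2" "squarefree d3" using L unfolding Ld Sel2_iff by auto
  have "int n \<noteq> 0" using n_pos by simp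
  hence sub: "class_n L \<subseteq> Sel_n"
    using sel_class_subset_Sel2[OF e_sum e_nz _ L] by blast
  have "good_rep n M \<longleftrightarrow> odd_rep M" if M: "M \<in> class_n L" for M
  proof
    assume h: "odd_rep M"
    obtain c1 c2 c3 where Mc: "M = (c1, c2, c3)" by (cases M)
    show "good_rep n M" using odd_Sel2_good_rep[of c1 c2 c3] h sub M unfolding Mc odd_rep_def by auto
  qed (rule good_rep_imp_odd_rep)
  thus ?thesis using unique_odd_rep[OF odd_int_n sq] unfolding Ld by (metis (no_types, lifting))
qed

text \<open>The product of two good representatives has odd entries, hence it is the odd member of
  its class and equals \<open>c\<close>. Valuations then add modulo 2 entry by entry.\<close>

lemma Phi_hom:
  assumes a: "good_rep n a" and b: "good_rep n b" and c: "good_rep n c"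
    and cl: "c \<in> class_n (tmul a b)"
  shows "Phi k p c = ((\<lambda>i. fst (Phi k p a) i + fst (Phi k p b) i), (\<lambda>i. snd (Phi k p a) i + snd (Phi k p b) i))"
proof -
  obtain a1 a2 a3 where aa: "a = (a1, a2, a3)" by (cases a)
  obtain b1 b2 b3 where bb: "b = (b1, b2, b3)" by (cases b)
  have ad: "a1 dvd int n" "a2 dvd int n" "a3 dvd int n" using a aa by (auto simp: good_rep_def)
  have bd: "b1 dvd int n" "b2 dvd int n" "b3 dvd int n" using b bb by (auto simp: good_rep_def)
  have nz: "x \<noteq> 0" if "x dvd int n" for x using divisor_odd[OF that] by auto
  have pnz: "a1 * b1 \<noteq> 0" "a2 * b2 \<noteq> 0" "a3 * b3 \<noteq> 0" using nz ad bd by auto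
  have ab: "tmul a b = (sqf (a1 * b1), sqf (a2 * b2), sqf (a3 * b3))" by (simp add: tmul_def aa bb)
  have sq: "squarefree (sqf (a1 * b1))" "squarefree (sqf (a2 * b2))" "squarefree (sqf (a3 * b3))"
    using sqf_decompose pnz by metis+
  have odd_sqf: "odd (sqf (x * y))" if "x dvd int n" "y dvd int n" for x y
    using that divisor_odd nz prime_dvd_sqf_iff[OF prime_int_2, of "x * y"]
    by (simp add: not_dvd_imp_multiplicity_0)
  have "tmul (tmul a b) (1, 1, 1) = tmul a b" unfolding ab using sq by (simp add: tmul_def sqf_of_squarefree)
  hence "tmul a b \<in> class_n (tmul a b)" unfolding sel_class_def Tors_def by (metis image_eqI insertI1)
  moreover have "odd_rep (tmul a b)" using odd_sqf ad bd by (simp add: ab odd_rep_def)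
  ultimately have cab: "c = (sqf (a1 * b1), sqf (a2 * b2), sqf (a3 * b3))"
    using unique_odd_rep[OF odd_int_n sq] cl good_rep_imp_odd_rep[OF c] unfolding ab by (metis (no_types, lifting))
  have cd: "sqf (a2 * b2) dvd int n" "sqf (a3 * b3) dvd int n" using c cab by (auto simp: good_rep_def)
  have supp: "(if i \<in> support (sqf (x * y)) then 1 else 0) = (if i \<in> support x then 1 else 0) + (if i \<in> support y then 1 else (0::bit))"
    if "x dvd int n" "y dvd int n" for x y i
  proof (cases "i < k")
    case True
    note pi = prime_int_p(1)[OF True]
    show ?thesis using True that nz divisor_squarefree
      by (simp add: support_def prime_dvd_sqf_iff[OF pi] multiplicity_mult_int[OF pi] squarefree_multiplicity[OF _ pi])
  qed (simp add: support_def)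
  show ?thesis unfolding cab Phi_divisors[OF cd] unfolding aa bb Phi_divisors[OF ad(2,3)] Phi_divisors[OF bd(2,3)]
    using supp ad bd by simp
qed

end

text \<open>Without rational points of order 4, torsion modulo doubles is the 2-torsion, so the
  elements of the quotient are the orbits \<open>sel_class\<close>. The isomorphism is expressed
  through their representatives: one in each orbit, a bijection onto the kernel, and additivity for
  the representative of a product.\<close>

theorem theorem4p5:
  fixes e1 e2 e3 :: int and n k :: nat and p :: "nat \<Rightarrow> nat"
  assumes "e1 \<noteq> 0" "e2 \<noteq> 0" "e3 \<noteq> 0" "e1 + e2 + e3 = 0"
    and "2 dvd e1" "\<not> 4 dvd e1" "2 dvd e2" "\<not> 4 dvd e2" "4 dvd e3"
    and "\<forall>i<k. prime (p i)" "inj_on p {..<k}" "n = (\<Prod>i<k. p i)" "odd n"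
    and "coprime (int n) (e1 * e2 * e3)"
    and "\<forall>i<k. \<forall>q::nat. prime q \<and> odd q \<and> int q dvd e1 * e2 * e3 \<longrightarrow> QuadRes (int q) (int (p i))"
    and "\<not> has_order4_point e1 e2 1" "\<not> has_order4_point e1 e2 (int n)"
    and "e3 > 0" "e1 < 0"
    and "\<forall>i<k. \<forall>q::nat. prime q \<and> odd q \<and> int q dvd e1 * e3 \<longrightarrow> Legendre (pstar (p i)) (int q) = 1"
    and "card (Sel2 e1 e2 e3 1) = 4"
  shows "(\<forall>L\<in>Sel2 e1 e2 e3 (int n). \<exists>!L'. L' \<in> sel_class e1 e2 e3 (int n) L \<and> good_rep n L')
     \<and> bij_betw (Phi k p) {L \<in> Sel2 e1 e2 e3 (int n). good_rep n L} (Ker e1 e2 e3 n k p)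
     \<and> (\<forall>a\<in>{L \<in> Sel2 e1 e2 e3 (int n). good_rep n L}. \<forall>b\<in>{L \<in> Sel2 e1 e2 e3 (int n). good_rep n L}.
          \<forall>c\<in>{L \<in> Sel2 e1 e2 e3 (int n). good_rep n L}.
            c \<in> sel_class e1 e2 e3 (int n) (tmul a b) \<longrightarrow>
            Phi k p c = ((\<lambda>i. fst (Phi k p a) i + fst (Phi k p b) i), (\<lambda>i. snd (Phi k p a) i + snd (Phi k p b) i)))"
proof -
  interpret twist e1 e2 e3 n k p
    by unfold_locales (fact assms)+
  show ?thesis using unique_good_rep Phi_bij Phi_hom by blast
qed

end
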